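(* Let $\mathbb{Q}$ be a probability measure on $\mathcal{C}^{(d)}$ such that $\mathbb{Q}(\{K: c(K)=0\})=1$ and, for some $R>0$, $\mathbb{Q}(\{K: B(K)\subset B(0,R)\})=1$. Let $\tau>0$, $\beta\ge 0$, and let $g:\mathcal{C}^{d}\to[0,\infty)$ be a pair potential (measurable, shift-invariant, $g(\emptyset)=0$) which is bounded from above by some constant $a>0$. Let $\mu$ be a stationary Gibbs particle process with conditional intensity $$\lambda^*(K,\mathbf{x})=\tau\exp\Big\{-\beta\sum_{L\in\mathbf{x}}g(K\cap L)\Big\},\qquad K\in\mathcal{C}^{(d)},\ \mathbf{x}\in\mathbf{N}^d,$$ and reference particle distribution $\mathbb{Q}$. Let $b\in[0,\infty)$ be a constant such that $\tau(1-\beta b)\le\mathbb{E}[\lambda^*(K,\mu)]\le\tau$ for $\lambda$-almost all $K\in\mathcal{C}^{(d)}$. Let $\varphi:\mathcal{C}^{(d)}\to\mathbb{R}$ be a measurable function (not depending on $\mathbf{x}\in\mathbf{N}^d$) with $\varphi\in L^1(\mathcal{C}^{(d)},\lambda)\cap L^2(\mathcal{C}^{(d)},\lambda)$, and let $Z$ be a standard Gaussian random variable. Then, writing $\|\varphi\|_p=\|\varphi\|_{L^p(\mathcal{C}^{(d)},\lambda)}$, $$\begin{aligned} d_W(I_\mu(\varphi),Z)\le{}&\sqrt{\tfrac{2}{\pi}}\sqrt{1-2\tau(1-\beta b)\|\varphi\|_2^2+\tau^2\|\varphi\|_2^4}+\tau\|\varphi\|_3^3+\sqrt{\tfrac{2}{\pi}}\,\tau^2\|\varphi\|_1^2\,|1-\mathrm{e}^{-\beta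 a}|\\ &+2\tau^2\|\varphi\|_2^2\,\|\varphi\|_1\,|1-\mathrm{e}^{-\beta a}|+\tau^3\|\varphi\|_1^3\,|1-\mathrm{e}^{-\beta a}|^2 . \end{aligned}$$
   Context: $\mathcal{C}^d$ is the space of compact subsets of $\mathbb{R}^d$ with the Hausdorff metric and its Borel $\sigma$-algebra, and $\mathcal{C}^{(d)}=\mathcal{C}^d\setminus\{\emptyset\}$ (its elements are called particles). For $K\in\mathcal{C}^{(d)}$, $B(K)$ is the circumscribed ball of $K$ and $c(K)$ its centre; $B(x,R)$ is the closed Euclidean ball of radius $R$ centred at $x$. $\mathbf{N}^d$ is the space of locally finite subsets $\mathbf{x}$ of $\mathcal{C}^{(d)}$, i.e. $\mathrm{card}\{L\in\mathbf{x}:L\cap K\neq\emptyset\}<\infty$ for all $K\in\mathcal{C}^{(d)}$, with the $\sigma$-algebra generated by the maps $\mathbf{x}\mapsto\mathrm{card}(\mathbf{x}\cap B)$, $B\subset\mathcal{C}^{d}$ bounded Borel. A particle process is a random element of $\mathbf{N}^d$; it is stationary if its distribution is invariant under $\mathbf{x}\mapsto\{K+x:K\in\mathbf{x}\}$ for every $x\in\mathbb{R}^d$. The reference measure on $\mathcal{C}^{(d)}$ is $$\lambda(B)=\int_{\mathcal{C}^{(d)}}\int_{\mathbb{R}^d}\mathbf{1}\{K+x\in B\}\,dx\,\mathbb{Q}(dK).$$ Shift-invariance of $g$ means $g(K+x)=g(K)$ for all $x\in\mathbb{R}^d$. A stationary Gibbs particle process $\mu$ with activity $\tau$, inverse temperature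 $\beta$, pair potential $g$ and reference particle distribution $\mathbb{Q}$ is a stationary particle process whose distribution $P$ satisfies the DLR equations: for every bounded $\Delta\subset\mathbb{R}^d$ with positive Lebesgue measure, the conditional law of $\mathbf{x}_\Delta=\{K\in\mathbf{x}:c(K)\in\Delta\}$ given $\mathbf{x}_{\Delta^c}=\{K\in\mathbf{x}:c(K)\notin\Delta\}$ has, for $P$-almost all $\mathbf{x}_{\Delta^c}$, density proportional to $\tau^{\mathrm{card}(\mathbf{x}_\Delta)}\exp(-\beta H_\Delta(\mathbf{x}))$ with respect to the Poisson process on $\{K:c(K)\in\Delta\}$ with intensity measure $\lambda$ restricted to that set, where $H_\Delta(\mathbf{x})=\sum g(K\cap L)$ over unordered pairs of distinct $K,L\in\mathbf{x}$ with at least one centre in $\Delta$. Equivalently, the GNZ equations hold: for every measurable $f:\mathcal{C}^{(d)}\times\mathbf{N}^d\to[0,\infty)$, $$\mathbb{E}\sum_{K\in\mu}f(K,\mu\setminus\{K\})=\mathbb{E}\int_{\mathcal{C}^{(d)}}f(K,\mu)\lambda^*(K,\mu)\,\lambda(dK).$$ The innovation of $\mu$ for measurable $\varphi:\mathcal{C}^{(d)}\to\mathbb{R}$ is the random variable $$I_\mu(\varphi)=\sum_{K\in\mu}\varphi(K)-\int_{\mathcal{C}^{(d)}}\varphi(K)\lambda^*(K,\mu)\,\lambda(dK),$$ defined when it is almost surely finite. The Wasserstein distance between real random variables is $d_W(X,Z)=\sup_h|\mathbb{E}h(X)-\mathbb{E}h(Z)|$, the supremum over all $h:\mathbb{R}\to\mathbb{R}$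 with Lipschitz constant at most $1$. The right-hand side of the bound is understood as $+\infty$ if $\|\varphi\|_3=\infty$. *)

theory Defs
  imports "HOL-Probability.Probability"
begin

section \<open>The space of compact sets and the space of particles\<close>

text \<open>Extended-valued Hausdorff distance. As a supremum over the empty set is \<open>0\<close> and an infimum
  over it is \<open>\<infinity>\<close>, the empty set has distance \<open>\<infinity>\<close> to every other compact set, so it is an isolated
  point (the usual convention).\<close>

definition hausdorff_dist :: "'a::metric_space set \<Rightarrow> 'a set \<Rightarrow> ennreal" where
  "hausdorff_dist K L =
     sup (SUP x\<in>K. INF y\<in>L. ennreal (dist x y)) (SUP y\<in>L. INF x\<in>K. ennreal (dist x y))"

definition hausdorff_open :: "'a::metric_space set set \<Rightarrow> bool" where
  "hausdorff_open U \<longleftrightarrow> U \<subseteq> {K. compact K} \<and>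
     (\<forall>K\<in>U. \<exists>e>0. \<forall>L. compact L \<longrightarrow> hausdorff_dist K L < ennreal e \<longrightarrow> L \<in> U)"

definition hausdorff_bounded :: "'a::metric_space set set \<Rightarrow> bool" where
  "hausdorff_bounded B \<longleftrightarrow> (\<exists>K r. compact K \<and> (\<forall>L\<in>B. hausdorff_dist K L \<le> ennreal r))"

definition compacts :: "'a::metric_space set measure" where
  "compacts = sigma {K. compact K} {U. hausdorff_open U}"

definition particles :: "'a::metric_space set measure" where
  "particles = restrict_space compacts {K. K \<noteq> {}}"

definition translate :: "'a::plus \<Rightarrow> 'a set \<Rightarrow> 'a set" where
  "translate v K = (\<lambda>y. y + v) ` K"

text \<open>The circumscribed ball is the (unique) closed ball of minimal radius that contains the
  nonempty compact set \<open>K\<close>.\<close>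

definition circumradius :: "'a::euclidean_space set \<Rightarrow> real" where
  "circumradius K = Inf {r. 0 \<le> r \<and> (\<exists>x. K \<subseteq> cball x r)}"

definition circumcentre :: "'a::euclidean_space set \<Rightarrow> 'a" where
  "circumcentre K = (THE x. K \<subseteq> cball x (circumradius K))"

definition circumball :: "'a::euclidean_space set \<Rightarrow> 'a set" where
  "circumball K = cball (circumcentre K) (circumradius K)"

definition reference_measure :: "'a::euclidean_space set measure \<Rightarrow> 'a set measure" where
  "reference_measure Q = measure_of (space particles) (sets particles)
     (\<lambda>B. \<integral>\<^sup>+ K. (\<integral>\<^sup>+ x. indicator B (translate x K) \<partial>lborel) \<partial>Q)"

section \<open>Particle configurations and particle processes\<close>

definition locally_finite_config :: "'a::metric_space set set \<Rightarrow> bool" where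
  "locally_finite_config x \<longleftrightarrow> x \<subseteq> space particles \<and>
     (\<forall>K\<in>space particles. finite {L\<in>x. L \<inter> K \<noteq> {}})"

text \<open>The \<sigma>-algebra generated by the counting maps of bounded Borel sets. For \<open>x\<close> locally finite and
  \<open>B\<close> bounded, \<open>x \<inter> B\<close> is finite, so \<open>card\<close> is the true number of points.\<close>

definition configs :: "'a::metric_space set set measure" where
  "configs = sigma {x. locally_finite_config x}
     {(\<lambda>x. card (x \<inter> B)) -` A \<inter> {x. locally_finite_config x} | A B.
        B \<in> sets compacts \<and> hausdorff_bounded B}"

definition particle_process :: "'w measure \<Rightarrow> ('w \<Rightarrow> 'a::metric_space set set) \<Rightarrow> bool" where
  "particle_process M \<mu> \<longleftrightarrow> prob_space M \<and> \<mu> \<in> measurable M configs"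

definition stationary_law :: "'a::euclidean_space set set measure \<Rightarrow> bool" where
  "stationary_law P \<longleftrightarrow> (\<forall>v. distr P configs (\<lambda>x. translate v ` x) = P)"

text \<open>Law of a Poisson process whose intensity measure \<open>\<Lambda>\<close> is finite on bounded sets: the number of
  points in a bounded Borel set \<open>B\<close> is Poisson distributed with mean \<open>\<Lambda> B\<close>, and the numbers in
  pairwise disjoint bounded Borel sets are independent. Recall \<open>0 ^ 0 = 1\<close>.\<close>

definition poisson_law :: "'a::metric_space set measure \<Rightarrow> 'a set set measure \<Rightarrow> bool" where
  "poisson_law \<Lambda> \<Psi> \<longleftrightarrow>
     prob_space \<Psi> \<and> sets \<Psi> = sets configs \<and>
     (\<forall>B\<in>sets particles. hausdorff_bounded B \<longrightarrow>
        emeasure \<Lambda> B < \<infinity> \<and>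
        (\<forall>k. measure \<Psi> {x\<in>space \<Psi>. card (x \<inter> B) = k} =
              measure \<Lambda> B ^ k / fact k * exp (- measure \<Lambda> B))) \<and>
     (\<forall>(I::nat set) B. finite I \<and> disjoint_family_on B I \<and>
        (\<forall>i\<in>I. B i \<in> sets particles \<and> hausdorff_bounded (B i)) \<longrightarrow>
        prob_space.indep_vars \<Psi> (\<lambda>_. count_space UNIV) (\<lambda>i x. card (x \<inter> B i)) I)"

section \<open>Gibbs particle processes\<close>

definition inside :: "'a::euclidean_space set \<Rightarrow> 'a set set \<Rightarrow> 'a set set" where
  "inside \<Delta> x = {K\<in>x. circumcentre K \<in> \<Delta>}"

definition outside :: "'a::euclidean_space set \<Rightarrow> 'a set set \<Rightarrow> 'a set set" where
  "outside \<Delta> x = {K\<in>x. circumcentre K \<notin> \<Delta>}"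

text \<open>Unordered pairs are encoded as two-element sets \<open>p = {K, L}\<close>, for which \<open>\<Inter>p = K \<inter> L\<close>. For a
  locally finite \<open>x\<close> with finitely many centres in \<open>\<Delta>\<close> and \<open>g {} = 0\<close> the sum has only finitely many
  nonzero terms.\<close>

definition energy :: "('a::euclidean_space set \<Rightarrow> real) \<Rightarrow> 'a set \<Rightarrow> 'a set set \<Rightarrow> real" where
  "energy g \<Delta> x =
     (\<Sum>\<^sub>\<infinity>p\<in>{{K, L} | K L. K \<in> x \<and> L \<in> x \<and> K \<noteq> L \<and> (circumcentre K \<in> \<Delta> \<or> circumcentre L \<in> \<Delta>)}.
        g (\<Inter>p))"

definition gibbs_weight ::
  "real \<Rightarrow> real \<Rightarrow> ('a::euclidean_space set \<Rightarrow> real) \<Rightarrow> 'a set \<Rightarrow> 'a set set \<Rightarrow> real" where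
  "gibbs_weight \<tau> \<beta> g \<Delta> x = \<tau> ^ card (inside \<Delta> x) * exp (- \<beta> * energy g \<Delta> x)"

text \<open>The probability measure with density proportional to the Gibbs weight with respect to \<open>\<Psi>\<close>,
  given the boundary configuration \<open>\<xi>\<close>.\<close>

definition gibbs_kernel ::
  "real \<Rightarrow> real \<Rightarrow> ('a::euclidean_space set \<Rightarrow> real) \<Rightarrow> 'a set \<Rightarrow> 'a set set measure \<Rightarrow> 'a set set
     \<Rightarrow> 'a set set measure" where
  "gibbs_kernel \<tau> \<beta> g \<Delta> \<Psi> \<xi> = density \<Psi>
     (\<lambda>y. ennreal (gibbs_weight \<tau> \<beta> g \<Delta> (y \<union> \<xi>)) /
          (\<integral>\<^sup>+ z. ennreal (gibbs_weight \<tau> \<beta> g \<Delta> (z \<union> \<xi>)) \<partial>\<Psi>))"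

text \<open>DLR equations: conditionally on the \<sigma>-algebra generated by \<open>outside \<Delta>\<close>, the law of \<open>inside \<Delta>\<close>
  under \<open>P\<close> is \<open>gibbs_kernel\<close>, taken with respect to the Poisson process with the reference measure
  restricted to the particles with centre in \<open>\<Delta>\<close> as intensity. The existential quantifier only names
  the law of this Poisson process, which exists and is unique.\<close>

definition dlr_equations ::
  "'a::euclidean_space set measure \<Rightarrow> real \<Rightarrow> real \<Rightarrow> ('a set \<Rightarrow> real) \<Rightarrow> 'a set set measure \<Rightarrow> bool"
where
  "dlr_equations Q \<tau> \<beta> g P \<longleftrightarrow>
     (\<forall>\<Delta>. \<Delta> \<in> sets borel \<and> bounded \<Delta> \<and> 0 < emeasure lborel \<Delta> \<longrightarrow>
       (\<exists>\<Psi>. poisson_law (density (reference_measure Q) (indicator {K. circumcentre K \<in> \<Delta>})) \<Psi> \<and>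
         (\<forall>A\<in>sets configs. AE x in P.
            nn_cond_exp P (vimage_algebra (space P) (outside \<Delta>) configs)
              (indicator {y\<in>space P. inside \<Delta> y \<in> A}) x =
            emeasure (gibbs_kernel \<tau> \<beta> g \<Delta> \<Psi> (outside \<Delta> x)) A)))"

definition pair_potential :: "('a::euclidean_space set \<Rightarrow> real) \<Rightarrow> bool" where
  "pair_potential g \<longleftrightarrow> g \<in> borel_measurable compacts \<and> (\<forall>K. compact K \<longrightarrow> 0 \<le> g K) \<and>
     (\<forall>K v. compact K \<longrightarrow> g (translate v K) = g K) \<and> g {} = 0"

definition stationary_gibbs_process ::
  "'w measure \<Rightarrow> ('w \<Rightarrow> 'a::euclidean_space set set) \<Rightarrow> real \<Rightarrow> real \<Rightarrow> ('a set \<Rightarrow> real)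
     \<Rightarrow> 'a set measure \<Rightarrow> bool" where
  "stationary_gibbs_process M \<mu> \<tau> \<beta> g Q \<longleftrightarrow> particle_process M \<mu> \<and>
     stationary_law (distr M configs \<mu>) \<and> dlr_equations Q \<tau> \<beta> g (distr M configs \<mu>)"

text \<open>If \<open>x\<close> is locally finite, \<open>K\<close> compact and \<open>g {} = 0\<close>, only finitely many terms of the sum are
  nonzero.\<close>

definition cond_intensity ::
  "real \<Rightarrow> real \<Rightarrow> ('a set \<Rightarrow> real) \<Rightarrow> 'a set \<Rightarrow> 'a set set \<Rightarrow> real" where
  "cond_intensity \<tau> \<beta> g K x = \<tau> * exp (- \<beta> * (\<Sum>\<^sub>\<infinity>L\<in>x. g (K \<inter> L)))"

definition innovation ::
  "'a set measure \<Rightarrow> ('a set \<Rightarrow> 'a set set \<Rightarrow> real) \<Rightarrow> ('a set \<Rightarrow> real) \<Rightarrow> 'a set set \<Rightarrow> real" where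
  "innovation \<Lambda> cint \<phi> x = (\<Sum>\<^sub>\<infinity>K\<in>x. \<phi> K) - (\<integral>K. \<phi> K * cint K x \<partial>\<Lambda>)"

section \<open>Norms and the Wasserstein distance\<close>

definition lp_norm :: "real \<Rightarrow> 'b measure \<Rightarrow> ('b \<Rightarrow> real) \<Rightarrow> ennreal" where
  "lp_norm p M f = (let I = (\<integral>\<^sup>+ x. ennreal (\<bar>f x\<bar> powr p) \<partial>M) in
     if I = \<infinity> then \<infinity> else ennreal (enn2real I powr (1 / p)))"

text \<open>Meaningful for integrable random variables, where all the expectations exist.\<close>

definition wasserstein_dist ::
  "'w measure \<Rightarrow> ('w \<Rightarrow> real) \<Rightarrow> 'z measure \<Rightarrow> ('z \<Rightarrow> real) \<Rightarrow> ennreal" where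
  "wasserstein_dist M X N Z =
     (SUP h\<in>{h :: real \<Rightarrow> real. 1-lipschitz_on UNIV h}.
        ennreal \<bar>(\<integral>\<omega>. h (X \<omega>) \<partial>M) - (\<integral>\<omega>. h (Z \<omega>) \<partial>N)\<bar>)"

end

theory Submission
  imports Defs "HOL-Real_Asymp.Real_Asymp"
begin

text \<open>
  The DLR equations express the law of \<open>(inside \<Delta>, outside \<Delta>)\<close> through a density with respect to the product
  of a Poisson law and the law of \<open>outside \<Delta>\<close>. As the Gibbs weight gains the factor \<open>\<lambda>\<^sup>*(K, x)\<close> when a particle
  \<open>K\<close> is added to \<open>x\<close>, the Mecke equation for the Poisson law turns into the GNZ equation.

  Let \<open>f\<close> solve Stein's equation \<open>f'(w) - w f(w) = h(w) - E h(Z)\<close>. By GNZ, \<open>E F f(F)\<close> for the innovation \<open>F\<close> equals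
  \<open>E \<integral> \<phi>(K) \<lambda>\<^sup>*(K, \<mu>) (f(F(\<mu> \<union> {K})) - f(F(\<mu>))) \<lambda>(dK)\<close>. Adding \<open>K\<close> changes \<open>F\<close> by \<open>\<phi>(K)\<close> up to an error of at
  most \<open>\<tau> \<parallel>\<phi>\<parallel>\<^sub>1 |1 - exp (-\<beta> a)|\<close>, so a second-order expansion of \<open>f\<close> with \<open>|f'| \<le> sqrt (2 / pi)\<close> and \<open>f'\<close>
  Lipschitz with constant \<open>2\<close> gives the bound.
\<close>

subsection \<open>The Borel \<sigma>-algebra of the space of compact sets\<close>

text \<open>Much of the work is measurability. A configuration is a bare set without a measurable
  enumeration of its particles, so sums over it are read as integrals against counting measure,
  which becomes a kernel on \<open>configs\<close> after restriction to bounded windows. Deleting,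
  inserting and comparing particles is controlled through the hit sets {K. K meets U}, which
  generate the Borel \<sigma>-algebra. An added particle is almost surely new: for the indicator of
  K \<in> x the left side of the Mecke or GNZ equation vanishes, as K has been removed from x. The
  Stein solution is expressed through h' with nonnegative kernels, so all its bounds reduce to
  inequalities between \<Phi>, \<gamma> and the primitive \<open>\<A>\<close> of \<Phi>; the
  constant sqrt (2 / pi) is 2 \<gamma>(0). This requires a continuously differentiable h, so a
  Lipschitz h is first averaged over a short interval. The square root in the bound comes from E |1
  - V|, where V is the integral of \<open>\<phi>\<^sup>2\<close> against the conditional intensity:
  V is at most \<open>\<tau> \<parallel>\<phi>\<parallel>\<^sub>2\<^sup>2\<close>, and its mean is
  at least (1 - \<beta> b) times this.\<close>

lemma hausdorff_dist_less_left:
  assumes "hausdorff_dist K L < ennreal e" "x \<in> K"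
  obtains y where "y \<in> L" "dist x y < e"
proof -
  have "(INF y\<in>L. ennreal (dist x y)) < ennreal e"
    by (rule le_less_trans[OF _ assms(1)])
       (use assms(2) in \<open>auto simp: hausdorff_dist_def intro!: le_supI1 SUP_upper\<close>)
  then obtain y where "y \<in> L" "ennreal (dist x y) < ennreal e"
    by (auto simp: INF_less_iff)
  then show ?thesis
    by (auto intro!: that simp: ennreal_less_iff)
qed

lemma hausdorff_dist_less_right:
  assumes "hausdorff_dist K L < ennreal e" "y \<in> L"
  obtains x where "x \<in> K" "dist x y < e"
proof -
  have "(INF x\<in>K. ennreal (dist x y)) < ennreal e"
    by (rule le_less_trans[OF _ assms(1)])
       (use assms(2) in \<open>auto simp: hausdorff_dist_def intro!: le_supI2 SUP_upper\<close>)
  then obtain x where "x \<in> K" "ennreal (dist x y) < ennreal e"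
    by (auto simp: INF_less_iff)
  then show ?thesis
    by (auto intro!: that simp: ennreal_less_iff)
qed

lemma hausdorff_dist_leI:
  assumes "\<And>x. x \<in> K \<Longrightarrow> \<exists>y\<in>L. dist x y \<le> r" "\<And>y. y \<in> L \<Longrightarrow> \<exists>x\<in>K. dist x y \<le> r"
  shows "hausdorff_dist K L \<le> ennreal r"
  unfolding hausdorff_dist_def
proof (intro sup_least SUP_least)
  fix x assume "x \<in> K"
  then obtain y where "y \<in> L" "dist x y \<le> r" using assms(1) by blast
  then show "(INF y\<in>L. ennreal (dist x y)) \<le> ennreal r"
    by (meson INF_lower2 ennreal_leI)
next
  fix y assume "y \<in> L"
  then obtain x where "x \<in> K" "dist x y \<le> r" using assms(2) by blast
  then show "(INF x\<in>K. ennreal (dist x y)) \<le> ennreal r"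
    by (meson INF_lower2 ennreal_leI)
qed

section \<open>Hit sets and the Borel \<sigma>-algebra they generate\<close>

definition hit :: "'a::metric_space set \<Rightarrow> 'a set set" where
  "hit U = {K. compact K \<and> K \<inter> U \<noteq> {}}"

lemma hausdorff_open_hit: "open U \<Longrightarrow> hausdorff_open (hit U)"
  unfolding hausdorff_open_def
proof (intro conjI ballI)
  fix K assume U: "open U" and "K \<in> hit U"
  then obtain x where x: "x \<in> K" "x \<in> U" by (auto simp: hit_def)
  with U obtain e where e: "e > 0" "ball x e \<subseteq> U" by (meson open_contains_ball)
  have "L \<in> hit U" if L: "compact L" "hausdorff_dist K L < ennreal e" for L
  proof -
    obtain y where "y \<in> L" "dist x y < e"
      using hausdorff_dist_less_left[OF L(2) x(1)] .
    with e(2) L(1) show ?thesis by (auto simp: hit_def)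
  qed
  with e(1) show "\<exists>e>0. \<forall>L. compact L \<longrightarrow> hausdorff_dist K L < ennreal e \<longrightarrow> L \<in> hit U" by blast
qed (auto simp: hit_def)

lemma space_compacts [simp]: "space compacts = {K. compact K}"
  by (auto simp: compacts_def intro!: space_measure_of simp: hausdorff_open_def)

lemma sets_compacts: "sets compacts = sigma_sets {K. compact K} {U. hausdorff_open U}"
  unfolding compacts_def by (rule sets_measure_of) (auto simp: hausdorff_open_def)

lemma hit_in_sets [measurable, intro]: "open U \<Longrightarrow> hit U \<in> sets compacts"
  unfolding sets_compacts by (rule sigma_sets.Basic) (simp add: hausdorff_open_hit)

text \<open>The sets \<open>{L. L \<subseteq> \<Union>F, L meets every b \<in> F}\<close> for finite subfamilies \<open>F\<close> of a countable
  base form a countable base of the Hausdorff topology.\<close>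

lemma sets_compacts_eq_hit:
  "sets (compacts :: 'a::euclidean_space set measure)
    = sigma_sets {K. compact K} {hit U |U. open U}" (is "_ = ?S")
proof
  show "?S \<subseteq> sets (compacts :: 'a set measure)"
    unfolding sets_compacts by (rule sigma_sets_mono) (auto simp: hausdorff_open_hit)
  obtain \<B> :: "'a set set" where B: "countable \<B>" "topological_basis \<B>"
    using ex_countable_basis by blast
  interpret S: sigma_algebra "{K. compact K}" ?S
    by (rule sigma_algebra_sigma_sets) (auto simp: hit_def)
  define V where "V F = {L::'a set. compact L \<and> L \<subseteq> \<Union>F \<and> (\<forall>b\<in>F. L \<inter> b \<noteq> {})}" for F
  have hit_S: "hit U \<in> ?S" if "open U" for U
    using that by (auto intro: sigma_sets.Basic)
  have V_S: "V F \<in> ?S" if F: "F \<subseteq> \<B>" "finite F" for F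
  proof -
    define m where "m = {L::'a set. compact L \<and> L \<subseteq> \<Union>F}"
    have op: "open b" if "b \<in> F" for b using that F B(2) by (auto intro: topological_basis_open)
    have mS: "m \<in> ?S"
    \<comment> \<open>\<open>infdist\<close> to the empty set is 0 by default, so the distance to
      the complement says nothing when \<open>F\<close> covers the whole space.\<close>
    proof (cases "\<Union>F = UNIV")
      case True
      then have "m = {K. compact K}" by (auto simp: m_def)
      then show ?thesis using S.top by simp
    next
      case False
      have opU: "open (\<Union>F)" using op by auto
      \<comment> \<open>A compact set inside the open set \<open>\<Union>F\<close> keeps a positive
        distance to the complement, so lying in it means missing some open neighbourhood of the
        complement, and missing an open set is the negation of a hit event.\<close>
      have "m = {K. compact K} - (\<Inter>n::nat. hit {x. infdist x (- \<Union>F) < inverse (Suc n)})"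
      proof (intro set_eqI iffI)
        fix K assume K: "K \<in> m"
        have "K \<notin> (\<Inter>n::nat. hit {x. infdist x (- \<Union>F) < inverse (Suc n)})"
        proof (cases "K = {}")
          case True then show ?thesis by (auto simp: hit_def)
        next
          case False
          have K': "compact K" "K \<subseteq> \<Union>F" using K by (auto simp: m_def)
          have "continuous_on K (\<lambda>x. infdist x (- \<Union>F))" by (intro continuous_intros)
          from continuous_attains_inf[OF K'(1) False this] obtain x where
            x: "x \<in> K" "\<And>y. y \<in> K \<Longrightarrow> infdist x (- \<Union>F) \<le> infdist y (- \<Union>F)" by blast
          have "infdist x (- \<Union>F) \<noteq> 0"
            using in_closed_iff_infdist_zero[of "- \<Union>F" x] opU \<open>\<Union>F \<noteq> UNIV\<close> x(1) K'(2) by auto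
          then have "infdist x (- \<Union>F) > 0" using infdist_nonneg[of x "- \<Union>F"] by linarith
          then obtain n :: nat where "inverse (Suc n) < infdist x (- \<Union>F)"
            using reals_Archimedean by blast
          then have "K \<notin> hit {x. infdist x (- \<Union>F) < inverse (Suc n)}"
            using x(2) by (force simp: hit_def)
          then show ?thesis by blast
        qed
        then show "K \<in> {K. compact K} - (\<Inter>n::nat. hit {x. infdist x (- \<Union>F) < inverse (Suc n)})"
          using K by (auto simp: m_def)
      next
        fix K assume K: "K \<in> {K. compact K} - (\<Inter>n::nat. hit {x. infdist x (- \<Union>F) < inverse (Suc n)})"
        have "x \<in> \<Union>F" if "x \<in> K" for x
        proof (rule ccontr)
          assume "x \<notin> \<Union>F"
          then have "infdist x (- \<Union>F) = 0" by simp
          then have "K \<in> hit {x. infdist x (- \<Union>F) < inverse (Suc n)}" for n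
            using that K by (auto simp: hit_def intro!: exI[of _ x])
          then show False using K by blast
        qed
        then show "K \<in> m" using K by (auto simp: m_def)
      qed
      also have "\<dots> \<in> ?S"
        by (intro S.Diff S.top S.countable_INT' hit_S)
           (auto intro!: open_Collect_less continuous_intros hit_S)
      finally show ?thesis .
    qed
    have "V F = m - ({K. compact K} - {L. compact L \<and> (\<forall>b\<in>F. L \<inter> b \<noteq> {})})"
      by (auto simp: V_def m_def)
    moreover have "{L. compact L \<and> (\<forall>b\<in>F. L \<inter> b \<noteq> {})} \<in> ?S"
    proof (cases "F = {}")
      case True then show ?thesis using S.top by simp
    next
      case False
      then have "{L. compact L \<and> (\<forall>b\<in>F. L \<inter> b \<noteq> {})} = (\<Inter>b\<in>F. hit b)" by (auto simp: hit_def)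
      also have "\<dots> \<in> ?S" using False F(2) op hit_S by (intro S.finite_INT) auto
      finally show ?thesis .
    qed
    ultimately show ?thesis using mS by (auto intro: S.Diff)
  qed
  have "U \<in> ?S" if U: "hausdorff_open U" for U :: "'a set set"
  proof -
    have "\<exists>F. F \<subseteq> \<B> \<and> finite F \<and> K \<in> V F \<and> V F \<subseteq> U" if K: "K \<in> U" for K
    proof -
      have cK: "compact K" using U K by (auto simp: hausdorff_open_def)
      obtain e where e: "e > 0" "\<And>L. compact L \<Longrightarrow> hausdorff_dist K L < ennreal e \<Longrightarrow> L \<in> U"
        using U K unfolding hausdorff_open_def by blast
      \<comment> \<open>Radius e/4 makes two points of one member of the cover closer than e/2. Two
        compact sets that lie in the union of the chosen members and meet each of them then have
        distance at most e/2, strictly less than e.\<close>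
      have "\<exists>b. b \<in> \<B> \<and> x \<in> b \<and> b \<subseteq> ball x (e/4)" for x
        using topological_basisE[OF B(2), of "ball x (e/4)" x] e(1) by auto
      then obtain b where b: "\<And>x. b x \<in> \<B> \<and> x \<in> b x \<and> b x \<subseteq> ball x (e/4)" by metis
      have "\<forall>B\<in>b ` K. open B" using b B(2) by (auto intro: topological_basis_open)
      moreover have "K \<subseteq> \<Union>(b ` K)" using b by blast
      ultimately obtain F where F: "F \<subseteq> b ` K" "finite F" "K \<subseteq> \<Union>F"
        using compactE[OF cK] by metis
      have near: "dist y z < e/2" if c: "c \<in> F" "y \<in> c" "z \<in> c" for c y z
      proof -
        obtain x where "c = b x" using c(1) F(1) by auto
        then have "y \<in> ball x (e/4)" "z \<in> ball x (e/4)" using c b[of x] by auto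
        then show ?thesis using dist_triangle3[of y z x] by (auto simp: dist_commute)
      qed
      have K_V: "K \<in> V F" using F b cK by (fastforce simp: V_def)
      have "L \<in> U" if L_V: "L \<in> V F" for L
      proof (rule e(2))
        show "compact L" using L_V by (simp add: V_def)
        have "hausdorff_dist K L \<le> ennreal (e/2)"
        proof (rule hausdorff_dist_leI)
          fix x assume "x \<in> K"
          then obtain c where c: "c \<in> F" "x \<in> c" using F(3) by blast
          then obtain y where "y \<in> L" "y \<in> c" using L_V by (auto simp: V_def)
          with near[OF c(1) c(2)] show "\<exists>y\<in>L. dist x y \<le> e/2" by (auto intro: less_imp_le)
        next
          fix y assume "y \<in> L"
          then obtain c where c: "c \<in> F" "y \<in> c" using L_V by (auto simp: V_def)
          then obtain x where "x \<in> K" "x \<in> c" using K_V by (auto simp: V_def)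
          with near[OF c(1) _ c(2)] show "\<exists>x\<in>K. dist x y \<le> e/2" by (auto intro: less_imp_le)
        qed
        also have "\<dots> < ennreal e" using e(1) by (simp add: ennreal_less_iff)
        finally show "hausdorff_dist K L < ennreal e" .
      qed
      then show ?thesis using K_V F b by (intro exI[of _ F]) auto
    qed
    then have "U = (\<Union>F\<in>{F. F \<subseteq> \<B> \<and> finite F \<and> V F \<subseteq> U}. V F)" by blast
    also have "\<dots> \<in> ?S"
    proof (rule S.countable_UN')
      have "countable {F. finite F \<and> F \<subseteq> \<B>}"
        using B(1) by (rule countable_Collect_finite_subset)
      then show "countable {F. F \<subseteq> \<B> \<and> finite F \<and> V F \<subseteq> U}"
        by (rule countable_subset[rotated]) auto
    qed (auto intro: V_S)
    finally show ?thesis .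
  qed
  then show "sets (compacts :: 'a set measure) \<subseteq> ?S"
    unfolding sets_compacts by (intro sigma_sets_mono) auto
qed

section \<open>Measurability of intersection, translation and equality of compact sets\<close>

lemma measurable_compactsI:
  fixes f :: "'b \<Rightarrow> 'a::euclidean_space set"
  assumes "\<And>x. x \<in> space M \<Longrightarrow> compact (f x)"
    and "\<And>U. open U \<Longrightarrow> {x\<in>space M. f x \<inter> U \<noteq> {}} \<in> sets M"
  shows "f \<in> measurable M compacts"
proof (rule measurable_sigma_sets[OF sets_compacts_eq_hit])
  fix y :: "'a set set" assume "y \<in> {hit U |U. open U}"
  then obtain U where U: "open U" "y = hit U" by blast
  have "f -` y \<inter> space M = {x\<in>space M. f x \<inter> U \<noteq> {}}"
    using assms(1) U(2) by (auto simp: hit_def)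
  then show "f -` y \<inter> space M \<in> sets M" using assms(2)[OF U(1)] by simp
qed (use assms(1) in \<open>auto simp: hit_def\<close>)

lemma sets_hit_meets [measurable]:
  "open U \<Longrightarrow> Measurable.pred compacts (\<lambda>K::'a::euclidean_space set. K \<inter> U \<noteq> {})"
  using hit_in_sets[of U] by (simp add: pred_def hit_def)

text \<open>Intersection is not continuous for the Hausdorff metric, so the event that K and L meet
  inside U has to be assembled from separate hit events. U is exhausted by compact sets
  \<open>C n\<close>, and three compact sets have a common point exactly if at every scale one ball
  with centre in a countable dense set meets all three.\<close>

lemma measurable_Int_compacts [measurable]:
  "(\<lambda>(K, L). K \<inter> L) \<in> measurable (compacts \<Otimes>\<^sub>M compacts) (compacts :: 'a::euclidean_space set measure)"
proof (rule measurable_compactsI)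
  fix p :: "'a set \<times> 'a set" assume "p \<in> space (compacts \<Otimes>\<^sub>M compacts)"
  then show "compact (case p of (K, L) \<Rightarrow> K \<inter> L)"
    by (auto simp: space_pair_measure compact_Int)
next
  fix U :: "'a set" assume "open U"
  then obtain C :: "nat \<Rightarrow> 'a set" where C: "\<And>n. compact (C n)" "(\<Union>n. C n) = U"
    by (rule open_Union_compact_subsets) blast
  obtain D :: "'a set" where D: "countable D" "\<And>X. open X \<Longrightarrow> X \<noteq> {} \<Longrightarrow> \<exists>d\<in>D. d \<in> X"
    using countable_dense_setE[where 'a='a] by blast
  have key: "K \<inter> L \<inter> C n \<noteq> {} \<longleftrightarrow> (\<forall>m::nat. \<exists>q\<in>D. K \<inter> ball q (inverse (Suc m)) \<noteq> {}
      \<and> L \<inter> ball q (inverse (Suc m)) \<noteq> {} \<and> C n \<inter> ball q (inverse (Suc m)) \<noteq> {})"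
    if KL: "compact K" "compact L" for K L n
  proof
    assume "K \<inter> L \<inter> C n \<noteq> {}"
    then obtain x where x: "x \<in> K" "x \<in> L" "x \<in> C n" by blast
    show "\<forall>m::nat. \<exists>q\<in>D. K \<inter> ball q (inverse (Suc m)) \<noteq> {}
      \<and> L \<inter> ball q (inverse (Suc m)) \<noteq> {} \<and> C n \<inter> ball q (inverse (Suc m)) \<noteq> {}"
    proof
      fix m :: nat
      obtain q where "q \<in> D" "q \<in> ball x (inverse (Suc m))" using D(2)[of "ball x (inverse (Suc m))"] by auto
      then have "q \<in> D" "x \<in> ball q (inverse (Suc m))" by (auto simp: dist_commute)
      then show "\<exists>q\<in>D. K \<inter> ball q (inverse (Suc m)) \<noteq> {}
      \<and> L \<inter> ball q (inverse (Suc m)) \<noteq> {} \<and> C n \<inter> ball q (inverse (Suc m)) \<noteq> {}"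
        using x by blast
    qed
  next
    assume *: "\<forall>m::nat. \<exists>q\<in>D. K \<inter> ball q (inverse (Suc m)) \<noteq> {}
      \<and> L \<inter> ball q (inverse (Suc m)) \<noteq> {} \<and> C n \<inter> ball q (inverse (Suc m)) \<noteq> {}"
    show "K \<inter> L \<inter> C n \<noteq> {}"
    proof (rule ccontr)
      assume e: "\<not> K \<inter> L \<inter> C n \<noteq> {}"
      have "K \<noteq> {}" using * by auto
      \<comment> \<open>Without a common point, the sum of the distances to L and to
        \<open>C n\<close> has a positive minimum on K. A ball of radius \<delta> < \<rho> x / 4
        meeting all three sets gives a point of K with both distances below 2 \<delta>, hence a
        smaller value.\<close>
      define \<rho> where "\<rho> x = infdist x L + infdist x (C n)" for x
      have ne: "L \<noteq> {}" "C n \<noteq> {}" using * by auto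
      have "continuous_on K \<rho>" unfolding \<rho>_def by (intro continuous_intros)
      from continuous_attains_inf[OF KL(1) \<open>K \<noteq> {}\<close> this] obtain x where
        x: "x \<in> K" "\<And>y. y \<in> K \<Longrightarrow> \<rho> x \<le> \<rho> y" by blast
      have "\<rho> x > 0"
      proof (rule ccontr)
        assume "\<not> \<rho> x > 0"
        then have "infdist x L = 0" "infdist x (C n) = 0"
          using infdist_nonneg[of x L] infdist_nonneg[of x "C n"] unfolding \<rho>_def by linarith+
        then have "x \<in> L" "x \<in> C n"
          using in_closed_iff_infdist_zero[of L x] in_closed_iff_infdist_zero[of "C n" x] ne
            compact_imp_closed[OF KL(2)] compact_imp_closed[OF C(1)] by auto
        then show False using e x(1) by blast
      qed
      then obtain m where "inverse (Suc m) < \<rho> x / 4"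
        using reals_Archimedean[of "\<rho> x / 4"] by auto
      moreover define \<delta> where "\<delta> = inverse (real (Suc m))"
      ultimately have m: "\<delta> < \<rho> x / 4" by simp
      obtain q y z w where q: "y \<in> K" "z \<in> L" "w \<in> C n" "dist q y < \<delta>"
        "dist q z < \<delta>" "dist q w < \<delta>" unfolding \<delta>_def
        using *[rule_format, of m] by (auto simp: set_eq_iff)
      have "infdist y L \<le> dist y z" "infdist y (C n) \<le> dist y w"
        using q by (auto intro: infdist_le)
      moreover have "dist y z \<le> dist q y + dist q z" "dist y w \<le> dist q y + dist q w"
        by (metis dist_commute dist_triangle)+
      ultimately have "infdist y L < 2 * \<delta>" "infdist y (C n) < 2 * \<delta>" using q by linarith+
      then have "\<rho> y < \<rho> x" using m by (simp add: \<rho>_def)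
      then show False using x(2)[OF q(1)] by simp
    qed
  qed
  have U: "K \<inter> L \<inter> U \<noteq> {} \<longleftrightarrow> (\<exists>n. \<forall>m::nat. \<exists>q\<in>D. K \<inter> ball q (inverse (Suc m)) \<noteq> {}
      \<and> L \<inter> ball q (inverse (Suc m)) \<noteq> {} \<and> C n \<inter> ball q (inverse (Suc m)) \<noteq> {})"
    if "compact K" "compact L" for K L
    unfolding C(2)[symmetric] key[OF that, symmetric] by blast
  have "{p \<in> space (compacts \<Otimes>\<^sub>M compacts). (case p of (K, L) \<Rightarrow> K \<inter> L) \<inter> U \<noteq> {}}
    = {p \<in> space (compacts \<Otimes>\<^sub>M compacts). \<exists>n. \<forall>m::nat. \<exists>q\<in>D. fst p \<inter> ball q (inverse (Suc m)) \<noteq> {}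
      \<and> snd p \<inter> ball q (inverse (Suc m)) \<noteq> {} \<and> C n \<inter> ball q (inverse (Suc m)) \<noteq> {}}"
    by (intro Collect_cong conj_cong refl) (simp only: split_beta, rule U, auto simp: space_pair_measure)
  also have "\<dots> \<in> sets (compacts \<Otimes>\<^sub>M compacts)"
    using D(1) by measurable
  finally show "{p \<in> space (compacts \<Otimes>\<^sub>M compacts). (case p of (K, L) \<Rightarrow> K \<inter> L) \<inter> U \<noteq> {}}
    \<in> sets (compacts \<Otimes>\<^sub>M compacts)" .
qed

text \<open>Addition is continuous, so x + v lies in the open set U exactly if (x, v) lies in one of
  countably many basic rectangles b \<times> c with b + c inside U. The hit event is thus a
  countable union of products of a hit event for K and an open event for v.\<close>

lemma measurable_translate [measurable]:
  "(\<lambda>(v, K). translate v K) \<in> measurable (borel \<Otimes>\<^sub>M compacts) (compacts :: 'a::euclidean_space set measure)"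
proof (rule measurable_compactsI)
  fix p :: "'a \<times> 'a set" assume "p \<in> space (borel \<Otimes>\<^sub>M compacts)"
  then show "compact (case p of (v, K) \<Rightarrow> translate v K)"
    by (auto simp: space_pair_measure translate_def intro!: compact_continuous_image continuous_intros)
next
  fix U :: "'a set" assume U: "open U"
  obtain \<B> :: "'a set set" where B: "countable \<B>" "topological_basis \<B>"
    using ex_countable_basis by blast
  have op: "open b" if "b \<in> \<B>" for b using that B(2) by (auto intro: topological_basis_open)
  define I where "I = {(b, c). b \<in> \<B> \<and> c \<in> \<B> \<and> (\<forall>x\<in>b. \<forall>y\<in>c. x + y \<in> U)}"
  have I: "countable I"
    by (rule countable_subset[of _ "\<B> \<times> \<B>"]) (use B(1) in \<open>auto simp: I_def\<close>)
  have key: "translate v K \<inter> U \<noteq> {} \<longleftrightarrow> (\<exists>(b, c)\<in>I. K \<inter> b \<noteq> {} \<and> v \<in> c)" for v K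
  proof
    assume "translate v K \<inter> U \<noteq> {}"
    then obtain x where x: "x \<in> K" "x + v \<in> U" by (auto simp: translate_def)
    then obtain e where e: "e > 0" "ball (x + v) e \<subseteq> U" using U by (meson open_contains_ball)
    obtain b where b: "b \<in> \<B>" "x \<in> b" "b \<subseteq> ball x (e/2)"
      using topological_basisE[OF B(2), of "ball x (e/2)" x] e(1) by auto
    obtain c where c: "c \<in> \<B>" "v \<in> c" "c \<subseteq> ball v (e/2)"
      using topological_basisE[OF B(2), of "ball v (e/2)" v] e(1) by auto
    have "y + w \<in> U" if "y \<in> b" "w \<in> c" for y w
    proof -
      have "dist x y < e/2" "dist v w < e/2" using that b c by auto
      then have "dist (x + v) (y + w) < e" using dist_triangle_add[of x v y w] by linarith
      then show ?thesis using e(2) by auto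
    qed
    then show "\<exists>(b, c)\<in>I. K \<inter> b \<noteq> {} \<and> v \<in> c"
      using b c x(1) by (intro bexI[of _ "(b, c)"]) (auto simp: I_def)
  qed (auto simp: I_def translate_def)
  have *: "{p \<in> space (borel \<Otimes>\<^sub>M compacts). snd p \<inter> fst i \<noteq> {} \<and> fst p \<in> snd i} \<in> sets (borel \<Otimes>\<^sub>M compacts)"
    if i: "i \<in> I" for i
  proof -
    have [measurable]: "Measurable.pred compacts (\<lambda>K. K \<inter> fst i \<noteq> {})"
      using i op by (auto simp: I_def)
    have [measurable]: "snd i \<in> sets borel" using i op by (auto simp: I_def)
    show ?thesis by measurable
  qed
  have "{p \<in> space (borel \<Otimes>\<^sub>M compacts). (case p of (v, K) \<Rightarrow> translate v K) \<inter> U \<noteq> {}}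
    = (\<Union>i\<in>I. {p \<in> space (borel \<Otimes>\<^sub>M compacts). snd p \<inter> fst i \<noteq> {} \<and> fst p \<in> snd i})"
    by (auto simp: key split_beta)
  also have "\<dots> \<in> sets (borel \<Otimes>\<^sub>M compacts)"
    using I * by (intro sets.countable_UN') auto
  finally show "{p \<in> space (borel \<Otimes>\<^sub>M compacts). (case p of (v, K) \<Rightarrow> translate v K) \<inter> U \<noteq> {}}
     \<in> sets (borel \<Otimes>\<^sub>M compacts)" .
qed

text \<open>Compact sets are closed, so they coincide as soon as they meet the same members of a
  countable base. Membership in a configuration and deletion from it rest on this event.\<close>

lemma measurable_eq_compacts [measurable]:
  "Measurable.pred (compacts \<Otimes>\<^sub>M compacts) (\<lambda>p :: 'a::euclidean_space set \<times> 'a set. fst p = snd p)"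
proof -
  obtain \<B> :: "'a set set" where B: "countable \<B>" "topological_basis \<B>"
    using ex_countable_basis by blast
  have op: "open b" if "b \<in> \<B>" for b using that B(2) by (auto intro: topological_basis_open)
  have sub: "K \<subseteq> L" if KL: "compact L" "\<forall>b\<in>\<B>. K \<inter> b \<noteq> {} \<longrightarrow> L \<inter> b \<noteq> {}" for K L :: "'a set"
  proof
    fix x assume x: "x \<in> K"
    show "x \<in> L"
    proof (rule ccontr)
      assume "x \<notin> L"
      then obtain b where "b \<in> \<B>" "x \<in> b" "b \<subseteq> - L"
        using topological_basisE[OF B(2), of "- L" x] compact_imp_closed[OF KL(1)] by auto
      then show False using KL(2) x by blast
    qed
  qed
  have eq: "K = L \<longleftrightarrow> (\<forall>b\<in>\<B>. K \<inter> b \<noteq> {} \<longleftrightarrow> L \<inter> b \<noteq> {})" if "compact K" "compact L" for K L :: "'a set"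
    using sub[of K L] sub[of L K] that by (metis subset_antisym)
  have "{p \<in> space (compacts \<Otimes>\<^sub>M compacts). fst p = snd p}
    = {p \<in> space (compacts \<Otimes>\<^sub>M compacts). \<forall>b\<in>\<B>. fst p \<inter> b \<noteq> {} \<longleftrightarrow> snd p \<inter> b \<noteq> {}}"
    by (intro Collect_cong conj_cong refl eq) (auto simp: space_pair_measure)
  also have "\<dots> = space (compacts \<Otimes>\<^sub>M compacts)
    - (\<Union>b\<in>\<B>. {p \<in> space (compacts \<Otimes>\<^sub>M compacts). (fst p \<inter> b \<noteq> {}) \<noteq> (snd p \<inter> b \<noteq> {})})"
    by blast
  also have "\<dots> \<in> sets (compacts \<Otimes>\<^sub>M compacts)"
  proof (intro sets.Diff sets.top sets.countable_UN' B(1) image_subsetI)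
    fix b assume "b \<in> \<B>"
    then have [measurable]: "Measurable.pred compacts (\<lambda>K. K \<inter> b \<noteq> {})" using op by auto
    show "{p \<in> space (compacts \<Otimes>\<^sub>M compacts). (fst p \<inter> b \<noteq> {}) \<noteq> (snd p \<inter> b \<noteq> {})} \<in> sets (compacts \<Otimes>\<^sub>M compacts)"
      by measurable
  qed
  finally show ?thesis by (simp add: pred_def)
qed

subsection \<open>Circumscribed balls\<close>

lemma compact_subset_cball_0:
  fixes K :: "'a::real_normed_vector set"
  assumes "compact K"
  obtains r where "0 < r" "K \<subseteq> cball 0 r"
proof -
  obtain r where "\<forall>x\<in>K. norm x \<le> r" using compact_imp_bounded[OF assms] bounded_iff by blast
  then show ?thesis by (intro that[of "max r 1"]) (auto simp: max_def)
qed

lemma circumradius_lower: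
  fixes K :: "'a::euclidean_space set"
  assumes "K \<noteq> {}" "K \<subseteq> cball x r"
  shows "circumradius K \<le> r"
proof -
  obtain k where "k \<in> K" using assms(1) by blast
  then have "dist x k \<le> r" using assms(2) by auto
  then have "0 \<le> r" using zero_le_dist[of x k] by linarith
  then show ?thesis
    unfolding circumradius_def using assms(2) by (intro cInf_lower bdd_belowI[of _ 0]) auto
qed

lemma circumradius_less:
  fixes K :: "'a::euclidean_space set"
  assumes "compact K" "circumradius K < t"
  obtains x r where "0 \<le> r" "r < t" "K \<subseteq> cball x r"
proof -
  obtain r where "K \<subseteq> cball 0 r" "r > 0" using compact_subset_cball_0[OF assms(1)] by blast
  then have "{r. 0 \<le> r \<and> (\<exists>x. K \<subseteq> cball x r)} \<noteq> {}" by (auto intro!: exI[of _ r])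
  from cInf_lessD[OF this assms(2)[unfolded circumradius_def]] show ?thesis using that by blast
qed

text \<open>The closed set C serves two uses: C = UNIV gives existence of a ball of minimal radius,
  and for C the complement of an open set, approximate centres near C converge to a centre in C,
  which is what measurability of \<open>circumcentre\<close> needs. The sets \<open>E n\<close> of
  approximate centres are nonempty, nested and compact, the last because they lie in a ball around
  any point of K.\<close>

lemma circumball_exists:
  fixes K :: "'a::euclidean_space set"
  assumes "compact K" "K \<noteq> {}" "closed C" 
    and "\<And>e. e > 0 \<Longrightarrow> \<exists>x. infdist x C \<le> e \<and> K \<subseteq> cball x (circumradius K + e)"
    and "C \<noteq> {}"
  shows "\<exists>x\<in>C. K \<subseteq> cball x (circumradius K)"
proof -
  define E where "E n = {x. infdist x C \<le> inverse (Suc n)} \<inter> (\<Inter>y\<in>K. cball y (circumradius K + inverse (Suc n)))" for n :: nat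
  have cl: "closed {x. infdist x C \<le> e}" for e
    by (intro closed_Collect_le continuous_intros)
  have comp: "compact (E n)" for n
  proof -
    obtain k where k: "k \<in> K" using assms(2) by blast
    have "compact (cball k (circumradius K + inverse (Suc n)) \<inter> E n)"
      unfolding E_def by (intro compact_Int_closed compact_cball closed_Int cl closed_INT ballI closed_cball)
    also have "cball k (circumradius K + inverse (Suc n)) \<inter> E n = E n"
      using k by (auto simp: E_def)
    finally show ?thesis .
  qed
  have ne: "E n \<noteq> {}" for n
  proof -
    obtain x where "infdist x C \<le> inverse (Suc n) \<and> K \<subseteq> cball x (circumradius K + inverse (Suc n))"
      using assms(4)[of "inverse (Suc n)"] by auto
    then have "x \<in> E n" by (auto simp: E_def dist_commute)
    then show ?thesis by blast
  qed
  have "decseq E"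
  proof (rule decseq_SucI, rule subsetI)
    fix n x assume "x \<in> E (Suc n)"
    moreover have "inverse (real (Suc (Suc n))) \<le> inverse (real (Suc n))" by simp
    ultimately show "x \<in> E n" unfolding E_def by (fastforce intro: order_trans)
  qed
  then have "\<Inter>(range E) \<noteq> {}"
    using compact_nest[of E, OF comp ne] by (auto simp: decseq_def)
  then obtain x where x: "\<And>n. x \<in> E n" by blast
  have lim: "(\<lambda>n. inverse (real (Suc n))) \<longlonglongrightarrow> 0" by (rule LIMSEQ_inverse_real_of_nat)
  have "infdist x C \<le> 0"
    by (rule LIMSEQ_le_const[OF lim]) (use x in \<open>auto simp: E_def\<close>)
  then have "infdist x C = 0" using infdist_nonneg[of x C] by linarith
  then have "x \<in> C" using in_closed_iff_infdist_zero[OF assms(3,5)] by blast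
  moreover have "K \<subseteq> cball x (circumradius K)"
  proof
    fix y assume y: "y \<in> K"
    have "(\<lambda>n. circumradius K + inverse (real (Suc n))) \<longlonglongrightarrow> circumradius K + 0"
      by (intro tendsto_intros lim)
    then have "dist y x \<le> circumradius K + 0"
      by (rule LIMSEQ_le_const) (use x y in \<open>auto simp: E_def\<close>)
    then show "y \<in> cball x (circumradius K)" by (simp add: dist_commute)
  qed
  ultimately show ?thesis by blast
qed

text \<open>By the parallelogram identity, two different centres of minimal radius r would put K
  into the ball around their midpoint with the smaller radius s, where s^2 = r^2 - |x - y|^2 /
  4.\<close>

lemma circumcentre_unique:
  fixes K :: "'a::euclidean_space set"
  assumes "K \<noteq> {}" "K \<subseteq> cball x (circumradius K)" "K \<subseteq> cball y (circumradius K)"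
  shows "x = y"
proof (rule ccontr)
  assume "x \<noteq> y"
  define r where "r = circumradius K"
  define s where "s = sqrt (r\<^sup>2 - (norm (x - y))\<^sup>2 / 4)"
  have par: "(norm (z - (1/2) *\<^sub>R (x + y)))\<^sup>2
      = ((norm (z - x))\<^sup>2 + (norm (z - y))\<^sup>2) / 2 - (norm (x - y))\<^sup>2 / 4" for z
    by (simp add: power2_norm_eq_inner inner_diff_left inner_diff_right inner_add_left inner_add_right
        inner_commute field_simps)
  have le: "(norm (z - (1/2) *\<^sub>R (x + y)))\<^sup>2 \<le> r\<^sup>2 - (norm (x - y))\<^sup>2 / 4" if "z \<in> K" for z
  proof -
    have "norm (z - x) \<le> r" "norm (z - y) \<le> r"
      using assms(2,3) that by (auto simp: r_def dist_norm norm_minus_commute)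
    then have "(norm (z - x))\<^sup>2 \<le> r\<^sup>2" "(norm (z - y))\<^sup>2 \<le> r\<^sup>2" by (auto intro: power_mono)
    then show ?thesis unfolding par by (simp add: add_divide_distrib)
  qed
  have "K \<subseteq> cball ((1/2) *\<^sub>R (x + y)) s"
  proof
    fix z assume "z \<in> K"
    from real_le_rsqrt[OF le[OF this]] show "z \<in> cball ((1/2) *\<^sub>R (x + y)) s"
      by (simp add: s_def dist_norm norm_minus_commute)
  qed
  from circumradius_lower[OF assms(1) this] have "r \<le> s" by (simp add: r_def)
  obtain z where z: "z \<in> K" using assms(1) by blast
  have "dist x z \<le> r" using z assms(2) by (auto simp: r_def)
  then have "0 \<le> r" using zero_le_dist[of x z] by linarith
  have "s\<^sup>2 = r\<^sup>2 - (norm (x - y))\<^sup>2 / 4"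
    unfolding s_def using le[OF z] by (intro real_sqrt_pow2) (meson order_trans zero_le_power2)
  moreover have "r\<^sup>2 \<le> s\<^sup>2" using \<open>r \<le> s\<close> \<open>0 \<le> r\<close> by (rule power_mono)
  moreover have "(norm (x - y))\<^sup>2 > 0" using \<open>x \<noteq> y\<close> by simp
  ultimately show False by linarith
qed

lemma circumcentre_eqI:
  fixes K :: "'a::euclidean_space set"
  assumes "K \<noteq> {}" "K \<subseteq> cball x (circumradius K)"
  shows "circumcentre K = x"
  unfolding circumcentre_def 
  by (rule the_equality) (use circumcentre_unique[OF assms(1)] assms(2) in auto)

lemma subset_circumball:
  fixes K :: "'a::euclidean_space set"
  assumes "compact K" "K \<noteq> {}"
  shows "K \<subseteq> cball (circumcentre K) (circumradius K)"
proof -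
  have "\<exists>x\<in>UNIV. K \<subseteq> cball x (circumradius K)"
  proof (rule circumball_exists[OF assms])
    fix e :: real assume "e > 0"
    then obtain x r where "r < circumradius K + e" "K \<subseteq> cball x r"
      using circumradius_less[OF assms(1), of "circumradius K + e"] by (metis less_add_same_cancel1)
    moreover have "infdist x UNIV \<le> e" using \<open>e > 0\<close> by simp
    ultimately show "\<exists>x. infdist x UNIV \<le> e \<and> K \<subseteq> cball x (circumradius K + e)"
      by (intro exI[of _ x]) auto
  qed auto
  then show ?thesis using circumcentre_eqI[OF assms(2)] by auto
qed

lemma translate_subset_cball: "translate v K \<subseteq> cball (x + v) r \<longleftrightarrow> K \<subseteq> cball (x::'a::euclidean_space) r"
  by (auto simp: translate_def)

lemma circumradius_translate:
  "circumradius (translate v K) = circumradius (K :: 'a::euclidean_space set)"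
proof -
  have "(\<exists>x. translate v K \<subseteq> cball x r) \<longleftrightarrow> (\<exists>x. K \<subseteq> cball x r)" for r
    using translate_subset_cball[of v K] by (metis diff_add_cancel)
  then show ?thesis by (simp add: circumradius_def)
qed

subsection \<open>Measurability on the space of particles\<close>

lemma space_particles: "space particles = {K. compact K \<and> K \<noteq> {}}"
  by (auto simp: particles_def space_restrict_space)

lemma in_space_particles: "K \<in> space particles \<longleftrightarrow> compact K \<and> K \<noteq> {}"
  by (simp add: space_particles)

lemma measurable_particles_compacts [measurable]: "(\<lambda>K. K) \<in> measurable particles compacts"
  unfolding particles_def by (rule measurable_restrict_space1) simp

lemma measurable_particles_dest [measurable_dest]:
  "f \<in> measurable M particles \<Longrightarrow> f \<in> measurable M compacts"
  using measurable_compose[OF _ measurable_particles_compacts, of f M] by simp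

lemma nonempty_in_compacts: "{K. compact K \<and> K \<noteq> {}} \<in> sets (compacts :: 'a::euclidean_space set measure)"
  using hit_in_sets[OF open_UNIV, where 'a='a] by (simp add: hit_def)

lemma sets_particles_iff:
  "B \<in> sets particles \<longleftrightarrow> B \<in> sets (compacts :: 'a::euclidean_space set measure) \<and> B \<subseteq> {K. compact K \<and> K \<noteq> {}}"
proof
  assume "B \<in> sets particles"
  then obtain A where A: "A \<in> sets compacts" "B = {K. K \<noteq> {}} \<inter> A"
    by (auto simp: particles_def sets_restrict_space)
  then have "B = {K. compact K \<and> K \<noteq> {}} \<inter> A" using sets.sets_into_space[OF A(1)] by auto
  with A(1) show "B \<in> sets compacts \<and> B \<subseteq> {K. compact K \<and> K \<noteq> {}}"
    using nonempty_in_compacts by auto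
qed (auto simp: particles_def sets_restrict_space image_iff)

lemma sets_subset_cball [measurable]:
  "Measurable.pred compacts (\<lambda>K::'a::euclidean_space set. K \<subseteq> cball x r)"
proof -
  have "(\<lambda>K::'a set. K \<subseteq> cball x r) = (\<lambda>K. \<not> K \<inter> - cball x r \<noteq> {})" by auto
  moreover have [measurable]: "Measurable.pred compacts (\<lambda>K::'a set. K \<inter> - cball x r \<noteq> {})"
    by (rule sets_hit_meets) auto
  show ?thesis unfolding calculation by measurable
qed

text \<open>The slack between the circumradius and t lets the centre move into a countable dense set
  and the radius to a rational, which leaves countably many events K \<subseteq> cball q s.\<close>

lemma measurable_circumradius [measurable]:
  "circumradius \<in> borel_measurable (particles :: 'a::euclidean_space set measure)"
proof (rule borel_measurableI_less)
  fix t :: real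
  obtain D :: "'a set" where D: "countable D" "\<And>X. open X \<Longrightarrow> X \<noteq> {} \<Longrightarrow> \<exists>d\<in>D. d \<in> X"
    using countable_dense_setE[where 'a='a] by blast
  have "circumradius K < t \<longleftrightarrow> (\<exists>q\<in>D. \<exists>s\<in>\<rat>. s < t \<and> K \<subseteq> cball q s)" if K: "compact K" "K \<noteq> {}" for K :: "'a set"
  proof
    assume "circumradius K < t"
    then obtain x r where r: "r < t" "K \<subseteq> cball x r" using circumradius_less[OF K(1)] by metis
    obtain s where s: "s \<in> \<rat>" "r < s" "s < t" using Rats_dense_in_real[OF r(1)] by blast
    obtain q where q: "q \<in> D" "q \<in> ball x (s - r)" using D(2)[of "ball x (s - r)"] s by auto
    have "cball x r \<subseteq> cball q s"
      using q(2) by (auto simp: cball_subset_cball_iff dist_commute)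
    with q s r show "\<exists>q\<in>D. \<exists>s\<in>\<rat>. s < t \<and> K \<subseteq> cball q s" by blast
  qed (use circumradius_lower[OF K(2)] in \<open>auto intro: le_less_trans\<close>)
  then have "{K \<in> space particles. circumradius K < t}
    = (\<Union>q\<in>D. \<Union>s\<in>{s\<in>\<rat>. s < t}. {K\<in>space particles. K \<subseteq> cball q s})"
    by (auto simp: in_space_particles)
  also have "\<dots> \<in> sets particles"
  proof (intro sets.countable_UN'[OF D(1)] sets.countable_UN' image_subsetI)
    show "countable {s\<in>\<rat>. s < t}" by (rule countable_subset[OF _ countable_rat]) auto
  qed measurable
  finally show "{K \<in> space particles. circumradius K < t} \<in> sets (particles :: 'a set measure)" .
qed

text \<open>By \<open>circumball_exists\<close>, a centre in the closed set C exists once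
  approximate centres near C exist at every precision, and those can be taken from a countable dense
  set.\<close>

lemma measurable_circumcentre [measurable]:
  "circumcentre \<in> borel_measurable (particles :: 'a::euclidean_space set measure)"
proof (rule borel_measurableI)
  fix U :: "'a set" assume U: "open U"
  obtain D :: "'a set" where D: "countable D" "\<And>X. open X \<Longrightarrow> X \<noteq> {} \<Longrightarrow> \<exists>d\<in>D. d \<in> X"
    using countable_dense_setE[where 'a='a] by blast
  show "circumcentre -` U \<inter> space particles \<in> sets (particles :: 'a set measure)"
  proof (cases "U = UNIV")
    case True then show ?thesis using sets.top[of particles] by simp
  next
    case False
    define C where "C = - U"
    have C: "closed C" "C \<noteq> {}" using U False by (auto simp: C_def)
    \<comment> \<open>The radius circumradius K + 1/(n+1) depends on K, whereas K \<subseteq> cball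
      q t is known to be measurable for fixed t only; quantifying over the rationals t above that
      radius separates the two.\<close>
    have key: "circumcentre K \<in> C \<longleftrightarrow> (\<forall>n::nat. \<exists>q\<in>D. infdist q C < inverse (Suc n) \<and>
        (\<forall>t\<in>\<rat>. circumradius K + inverse (Suc n) < t \<longrightarrow> K \<subseteq> cball q t))" if K: "compact K" "K \<noteq> {}" for K
    proof
      assume c: "circumcentre K \<in> C"
      show "\<forall>n::nat. \<exists>q\<in>D. infdist q C < inverse (Suc n) \<and>
        (\<forall>t\<in>\<rat>. circumradius K + inverse (Suc n) < t \<longrightarrow> K \<subseteq> cball q t)"
      proof
        fix n :: nat
        obtain q where q: "q \<in> D" "q \<in> ball (circumcentre K) (inverse (Suc n))"
          using D(2)[of "ball (circumcentre K) (inverse (Suc n))"] by auto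
        have "infdist q C \<le> dist q (circumcentre K)" using c by (rule infdist_le)
        also have "\<dots> < inverse (Suc n)" using q by (simp add: dist_commute)
        finally have 1: "infdist q C < inverse (Suc n)" .
        have "K \<subseteq> cball q t" if "circumradius K + inverse (Suc n) < t" for t
        proof -
          have "cball (circumcentre K) (circumradius K) \<subseteq> cball q t"
            using q(2) that by (auto simp: cball_subset_cball_iff dist_commute)
          then show ?thesis using subset_circumball[OF K] by blast
        qed
        with 1 q(1) show "\<exists>q\<in>D. infdist q C < inverse (Suc n) \<and>
        (\<forall>t\<in>\<rat>. circumradius K + inverse (Suc n) < t \<longrightarrow> K \<subseteq> cball q t)" by blast
      qed
    next
      assume *: "\<forall>n::nat. \<exists>q\<in>D. infdist q C < inverse (Suc n) \<and>
        (\<forall>t\<in>\<rat>. circumradius K + inverse (Suc n) < t \<longrightarrow> K \<subseteq> cball q t)"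
      have "\<exists>x\<in>C. K \<subseteq> cball x (circumradius K)"
      proof (rule circumball_exists[OF K C(1) _ C(2)])
        fix e :: real assume "e > 0"
        then obtain n where n: "inverse (real (Suc n)) < e" using reals_Archimedean by blast
        obtain q where q: "infdist q C < inverse (Suc n)"
          "\<And>t. t\<in>\<rat> \<Longrightarrow> circumradius K + inverse (Suc n) < t \<Longrightarrow> K \<subseteq> cball q t" using * by blast
        obtain t where "t \<in> \<rat>" "circumradius K + inverse (Suc n) < t" "t < circumradius K + e"
          using Rats_dense_in_real[of "circumradius K + inverse (Suc n)" "circumradius K + e"] n by auto
        with q(2)[of t] have "K \<subseteq> cball q (circumradius K + e)" by (auto intro: order_trans)
        then show "\<exists>x. infdist x C \<le> e \<and> K \<subseteq> cball x (circumradius K + e)"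
          using q(1) n by (intro exI[of _ q]) auto
      qed
      then show "circumcentre K \<in> C" using circumcentre_eqI[OF K(2)] by blast
    qed
    have "{K \<in> space particles. circumcentre K \<in> C} =
      (\<Inter>n::nat. \<Union>q\<in>{q\<in>D. infdist q C < inverse (Suc n)}.
          {K\<in>space particles. \<forall>t\<in>\<rat>. circumradius K + inverse (Suc n) < t \<longrightarrow> K \<subseteq> cball q t})"
      (is "_ = ?I")
    proof -
      have "{K \<in> space particles. circumcentre K \<in> C} = {K \<in> space particles.
        \<forall>n::nat. \<exists>q\<in>D. infdist q C < inverse (Suc n) \<and>
        (\<forall>t\<in>\<rat>. circumradius K + inverse (Suc n) < t \<longrightarrow> K \<subseteq> cball q t)}"
        by (intro Collect_cong conj_cong refl key) (simp_all add: in_space_particles)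
      also have "\<dots> = ?I" by blast
      finally show ?thesis .
    qed
    also have "\<dots> \<in> sets particles"
    proof (intro sets.countable_INT' sets.countable_UN' image_subsetI)
      fix n :: nat and q
      show "countable {q\<in>D. infdist q C < inverse (Suc n)}" using D(1) by (rule countable_subset[rotated]) auto
      have "{K\<in>space particles. \<forall>t\<in>\<rat>. circumradius K + inverse (Suc n) < t \<longrightarrow> K \<subseteq> cball q t}
        = (\<Inter>t\<in>\<rat>. {K\<in>space particles. circumradius K + inverse (Suc n) < t \<longrightarrow> K \<subseteq> cball q t})" by auto
      also have "\<dots> \<in> sets particles"
      proof (intro sets.countable_INT' countable_rat image_subsetI)
        show "\<rat> \<noteq> ({} :: real set)" by auto
      qed measurable
      finally show "{K\<in>space particles. \<forall>t\<in>\<rat>. circumradius K + inverse (Suc n) < t \<longrightarrow> K \<subseteq> cball q t} \<in> sets particles" .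
    qed auto
    finally have "space particles - {K \<in> space particles. circumcentre K \<in> C} \<in> sets (particles :: 'a set measure)"
      by blast
    also have "space particles - {K \<in> space particles. circumcentre K \<in> C} = circumcentre -` U \<inter> space particles"
      by (auto simp: C_def)
    finally show ?thesis .
  qed
qed

section \<open>Windows: bounded sets that exhaust the particles\<close>

definition window :: "nat \<Rightarrow> 'a::euclidean_space set set" where
  "window n = {K. compact K \<and> K \<noteq> {} \<and> K \<subseteq> cball 0 (real n)}"

lemma sets_window [measurable]: "window n \<in> sets particles"
proof -
  have "window n = {K\<in>space particles. K \<subseteq> cball 0 (real n)}" by (auto simp: window_def in_space_particles)
  also have "\<dots> \<in> sets particles" by measurable
  finally show ?thesis .
qed

lemma hausdorff_bounded_window: "hausdorff_bounded (window n :: 'a::euclidean_space set set)"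
  unfolding hausdorff_bounded_def
proof (intro exI[of _ "{0}"] exI[of _ "real n"] conjI ballI)
  fix L :: "'a set" assume L: "L \<in> window n"
  then obtain k where "k \<in> L" by (auto simp: window_def)
  with L show "hausdorff_dist {0} L \<le> ennreal (real n)"
    by (intro hausdorff_dist_leI) (auto simp: window_def intro!: bexI[of _ k])
qed simp

lemma hausdorff_bounded_subset: "hausdorff_bounded B \<Longrightarrow> A \<subseteq> B \<Longrightarrow> hausdorff_bounded A"
  unfolding hausdorff_bounded_def by blast

lemma incseq_window: "incseq window"
  unfolding incseq_def window_def by (auto intro: order_trans)

lemma UN_window: "(\<Union>n. window n) = space (particles :: 'a::euclidean_space set measure)"
proof
  show "space particles \<subseteq> (\<Union>n. window n :: 'a set set)"
  proof
    fix K :: "'a set" assume K: "K \<in> space particles"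
    then obtain r where "K \<subseteq> cball 0 r" using compact_subset_cball_0[of K] by (auto simp: in_space_particles)
    moreover obtain n where "r \<le> real n" using real_arch_simple by blast
    ultimately have "K \<in> window n" using K by (auto simp: window_def in_space_particles)
    then show "K \<in> (\<Union>n. window n)" by blast
  qed
qed (auto simp: window_def in_space_particles)

text \<open>Windows are cofinal among the bounded sets of particles, so finiteness on windows is
  finiteness on every bounded set.\<close>

lemma hausdorff_bounded_subset_window:
  fixes B :: "'a::euclidean_space set set"
  assumes "hausdorff_bounded B" "B \<subseteq> space particles"
  obtains n where "B \<subseteq> window n"
proof -
  obtain K r where K: "compact K" "\<And>L. L \<in> B \<Longrightarrow> hausdorff_dist K L \<le> ennreal r"
    using assms(1) by (auto simp: hausdorff_bounded_def)
  obtain s where s: "K \<subseteq> cball 0 s" using compact_subset_cball_0[OF K(1)] by blast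
  \<comment> \<open>r may be negative, in which case \<open>ennreal r\<close> is 0; the extra 1
    turns the weak inequality into the strict one that yields a nearby point of K.\<close>
  obtain n where n: "s + (max r 0 + 1) \<le> real n" using real_arch_simple by blast
  have "L \<in> window n" if L: "L \<in> B" for L
  proof -
    have "hausdorff_dist K L \<le> ennreal (max r 0)" using K(2)[OF L] by (simp add: ennreal_max_0)
    also have "\<dots> < ennreal (max r 0 + 1)" by (simp add: ennreal_less_iff)
    finally have d: "hausdorff_dist K L < ennreal (max r 0 + 1)" .
    have "L \<subseteq> cball 0 (real n)"
    proof
      fix y assume "y \<in> L"
      with d obtain x where "x \<in> K" "dist x y < max r 0 + 1" using hausdorff_dist_less_right by metis
      moreover from this have "norm x \<le> s" using s by auto
      ultimately show "y \<in> cball 0 (real n)"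
        using n norm_triangle_ineq2[of y x] by (auto simp: dist_norm norm_minus_commute)
    qed
    then show ?thesis using L assms(2) by (auto simp: window_def in_space_particles)
  qed
  then show ?thesis using that by blast
qed

subsection \<open>The reference measure\<close>

lemma translate_particle: "K \<in> space particles \<Longrightarrow> translate v K \<in> space (particles :: 'a::euclidean_space set measure)"
  by (auto simp: translate_def in_space_particles intro!: compact_continuous_image continuous_intros)

lemma measurable_translate_particles [measurable]:
  "(\<lambda>(v, K). translate v K) \<in> measurable (borel \<Otimes>\<^sub>M particles) (particles :: 'a::euclidean_space set measure)"
proof -
  have "(\<lambda>p. translate (fst p) (snd p)) \<in> measurable (borel \<Otimes>\<^sub>M particles) (compacts :: 'a set measure)"
    using measurable_compose[OF _ measurable_translate, of "\<lambda>p. (fst p, snd p)" "borel \<Otimes>\<^sub>M particles"]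
    by simp
  moreover have "translate (fst p) (snd p) \<noteq> {}" if "p \<in> space (borel \<Otimes>\<^sub>M particles)" for p :: "'a \<times> 'a set"
    using that by (auto simp: space_pair_measure translate_def in_space_particles)
  ultimately show ?thesis
    unfolding particles_def by (auto simp: split_beta' intro!: measurable_restrict_space2)
qed

lemma
  shows space_reference_measure [simp]: "space (reference_measure Q) = space particles"
    and sets_reference_measure [simp, measurable_cong]: "sets (reference_measure Q) = sets particles"
  by (simp_all add: reference_measure_def sets.sigma_sets_eq)

lemma measurable_translate_indicator:
  assumes B [measurable]: "B \<in> sets (particles :: 'a::euclidean_space set measure)"
  shows "(\<lambda>K. \<integral>\<^sup>+ x. indicator B (translate x K) \<partial>lborel) \<in> borel_measurable particles"
proof (rule lborel.borel_measurable_nn_integral)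
  have "(\<lambda>(K, x). (x, K)) \<in> measurable (particles \<Otimes>\<^sub>M lborel) (borel \<Otimes>\<^sub>M particles)"
    by measurable
  from measurable_compose[OF measurable_compose[OF this measurable_translate_particles], of "indicator B" borel]
  show "(\<lambda>(K, x). indicator B (translate x K) :: ennreal) \<in> borel_measurable (particles \<Otimes>\<^sub>M lborel)"
    by (simp add: split_beta')
qed

text \<open>\<open>measure_of\<close> returns the prescribed set function only once this is shown to
  be positive and countably additive; additivity comes from interchanging the series with both
  integrals.\<close>

lemma emeasure_reference_measure:
  assumes sQ [measurable_cong]: "sets Q = sets (particles :: 'a::euclidean_space set measure)"
    and B: "B \<in> sets particles"
  shows "emeasure (reference_measure Q) B
    = (\<integral>\<^sup>+ K. (\<integral>\<^sup>+ x. indicator B (translate x K) \<partial>lborel) \<partial>Q)"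
  unfolding reference_measure_def
proof (rule emeasure_measure_of_sigma)
  show "sigma_algebra (space particles) (sets (particles :: 'a set measure))" by (rule sets.sigma_algebra_axioms)
  show "positive (sets particles) (\<lambda>B. \<integral>\<^sup>+ K. (\<integral>\<^sup>+ x. indicator B (translate x K) \<partial>lborel) \<partial>Q)"
    by (simp add: positive_def)
  show "countably_additive (sets particles) (\<lambda>B. \<integral>\<^sup>+ K. (\<integral>\<^sup>+ x. indicator B (translate x K) \<partial>lborel) \<partial>Q)"
  proof (rule countably_additiveI)
    fix A :: "nat \<Rightarrow> 'a set set" assume A: "range A \<subseteq> sets particles" "disjoint_family A"
    then have [measurable]: "A n \<in> sets particles" for n by auto
    have spQ: "space Q = space particles" by (rule sets_eq_imp_space_eq[OF sQ])
    have m: "(\<lambda>x. indicator (A n) (translate x K) :: ennreal) \<in> borel_measurable lborel" if "K \<in> space Q" for K n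
    proof -
      have [simp]: "K \<in> space particles" using that spQ by simp
      have [measurable]: "(\<lambda>x. translate x K) \<in> measurable lborel particles"
        using measurable_compose[OF _ measurable_translate_particles, of "\<lambda>x. (x, K)" lborel] by simp
      show ?thesis by measurable
    qed
    show "(\<Sum>i. \<integral>\<^sup>+ K. (\<integral>\<^sup>+ x. indicator (A i) (translate x K) \<partial>lborel) \<partial>Q)
      = (\<integral>\<^sup>+ K. (\<integral>\<^sup>+ x. indicator (\<Union>i. A i) (translate x K) \<partial>lborel) \<partial>Q)"
    proof (subst nn_integral_suminf[symmetric])
      show "(\<integral>\<^sup>+ K. (\<Sum>i. \<integral>\<^sup>+ x. indicator (A i) (translate x K) \<partial>lborel) \<partial>Q)
        = (\<integral>\<^sup>+ K. (\<integral>\<^sup>+ x. indicator (\<Union>i. A i) (translate x K) \<partial>lborel) \<partial>Q)"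
        using m by (intro nn_integral_cong)
           (simp add: nn_integral_suminf[symmetric] suminf_indicator[OF A(2)])
    qed (use measurable_translate_indicator[OF \<open>A _ \<in> sets particles\<close>] measurable_cong_sets[OF sQ refl] in blast)
  qed
qed (rule B)

text \<open>For K inside cball 0 R, a translate K + x can lie in cball 0 n only if |x| is at most n
  + R, so the inner integral is bounded by the volume of one ball, uniformly in K.\<close>

lemma emeasure_reference_window:
  fixes Q :: "'a::euclidean_space set measure"
  assumes Q: "prob_space Q" and sQ: "sets Q = sets particles"
    and c: "AE K in Q. circumcentre K = 0" and R: "AE K in Q. circumball K \<subseteq> cball 0 R"
  shows "emeasure (reference_measure Q) (window n) < \<infinity>"
proof -
  interpret Q: prob_space Q by fact
  have "emeasure (reference_measure Q) (window n)
      = (\<integral>\<^sup>+ K. (\<integral>\<^sup>+ x. indicator (window n) (translate x K) \<partial>lborel) \<partial>Q)"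
    by (rule emeasure_reference_measure[OF sQ sets_window])
  also have "\<dots> \<le> (\<integral>\<^sup>+ K. emeasure lborel (cball 0 (real n + R) :: 'a set) \<partial>Q)"
  proof (rule nn_integral_mono_AE)
    show "AE K in Q. (\<integral>\<^sup>+ x. indicator (window n) (translate x K) \<partial>lborel) \<le> emeasure lborel (cball 0 (real n + R) :: 'a set)"
      using c R
    proof eventually_elim
      case (elim K)
      have "(\<integral>\<^sup>+ x. indicator (window n) (translate x K) \<partial>lborel) \<le> (\<integral>\<^sup>+ x. indicator (cball 0 (real n + R)) x \<partial>(lborel :: 'a measure))"
      proof (rule nn_integral_mono)
        fix x :: 'a
        show "indicator (window n) (translate x K) \<le> (indicator (cball 0 (real n + R)) x :: ennreal)"
        proof (cases "translate x K \<in> window n")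
          case True
          then have "translate x K \<noteq> {}" "translate x K \<subseteq> cball 0 (real n)" by (auto simp: window_def)
          then obtain y where y: "y \<in> K" "norm (y + x) \<le> real n"
            by (fastforce simp: translate_def)
          have "translate (-x) (translate x K) = K" by (auto simp: translate_def image_image)
          moreover have "compact (translate (-x) (translate x K))"
            using True by (intro translate_particle[unfolded in_space_particles, THEN conjunct1]) (auto simp: window_def)
          ultimately have "K \<subseteq> circumball K"
            using subset_circumball[of K] y(1) by (auto simp: circumball_def)
          with y(1) elim have "norm y \<le> R" by auto
          have "norm x \<le> norm (y + x) + norm y" using norm_triangle_ineq4[of "y + x" y] by simp
          then show ?thesis using \<open>norm y \<le> R\<close> y(2) by (auto simp: indicator_def)
        qed auto
      qed
      then show ?case by simp
    qed
  qed
  also have "\<dots> = emeasure lborel (cball 0 (real n + R) :: 'a set)"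
    by (simp add: Q.emeasure_space_1)
  also have "\<dots> < \<infinity>" by (rule emeasure_lborel_cball_finite)
  finally show ?thesis .
qed

lemma sigma_finite_reference_measure:
  fixes Q :: "'a::euclidean_space set measure"
  assumes "prob_space Q" "sets Q = sets particles"
    "AE K in Q. circumcentre K = 0" "AE K in Q. circumball K \<subseteq> cball 0 R"
  shows "sigma_finite_measure (reference_measure Q)"
proof
  show "\<exists>A. countable A \<and> A \<subseteq> sets (reference_measure Q) \<and> \<Union>A = space (reference_measure Q)
      \<and> (\<forall>a\<in>A. emeasure (reference_measure Q) a \<noteq> \<infinity>)"
    using emeasure_reference_window[OF assms] UN_window
    by (intro exI[of _ "range window"]) (auto simp: less_top[symmetric])
qed

text \<open>The circumradius is invariant under translation, so the bound for
  \<open>Q\<close>-almost every particle survives the integration over positions.\<close>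

lemma AE_reference_subset_cball:
  fixes Q :: "'a::euclidean_space set measure"
  assumes sQ: "sets Q = sets particles"
    and c: "AE K in Q. circumcentre K = 0" and R: "AE K in Q. circumball K \<subseteq> cball 0 R"
  shows "AE K in reference_measure Q. circumradius K \<le> R"
proof (rule AE_I')
  have B: "{K \<in> space particles. \<not> circumradius K \<le> R} \<in> sets (particles :: 'a set measure)"
    by measurable
  have spQ: "space Q = space particles" by (rule sets_eq_imp_space_eq[OF sQ])
  have "emeasure (reference_measure Q) {K \<in> space particles. \<not> circumradius K \<le> R}
    = (\<integral>\<^sup>+ K. (\<integral>\<^sup>+ x. indicator {K \<in> space particles. \<not> circumradius K \<le> R} (translate x K) \<partial>lborel) \<partial>Q)"
    by (rule emeasure_reference_measure[OF sQ B])
  also have "\<dots> = (\<integral>\<^sup>+ K. 0 \<partial>Q)"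
  proof (rule nn_integral_cong_AE)
    show "AE K in Q. (\<integral>\<^sup>+ x. indicator {K \<in> space particles. \<not> circumradius K \<le> R} (translate x K) \<partial>lborel) = 0"
      using c R AE_space
    proof eventually_elim
      case (elim K)
      then have "circumball K \<subseteq> cball 0 R" "K \<subseteq> circumball K" "K \<noteq> {}"
        using subset_circumball[of K] by (auto simp: circumball_def spQ in_space_particles)
      then have "circumradius K \<le> R" by (intro circumradius_lower[of K 0]) auto
      then show ?case by (simp add: circumradius_translate)
    qed
  qed
  finally show "{K \<in> space particles. \<not> circumradius K \<le> R} \<in> null_sets (reference_measure Q)"
    using B by (intro null_setsI) auto
qed auto

subsection \<open>Particle configurations\<close>

lemma space_configs: "space configs = {x. locally_finite_config x}"
  unfolding configs_def by (rule space_measure_of) auto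

lemma sets_configs: "sets configs = sigma_sets {x. locally_finite_config x}
     {(\<lambda>x. card (x \<inter> B)) -` A \<inter> {x. locally_finite_config x} | A B.
        B \<in> sets compacts \<and> hausdorff_bounded B}"
  unfolding configs_def by (rule sets_measure_of) auto

lemma config_particles: "x \<in> space configs \<Longrightarrow> x \<subseteq> space particles"
  by (auto simp: space_configs locally_finite_config_def)

lemma config_finite_hits:
  fixes K :: "'a::euclidean_space set"
  assumes "x \<in> space configs" "compact K"
  shows "finite {L\<in>x. L \<inter> K \<noteq> {}}"
  using assms by (cases "K = {}") (auto simp: space_configs locally_finite_config_def in_space_particles)

lemma config_finite_window:
  fixes x :: "'a::euclidean_space set set"
  assumes "x \<in> space configs"
  shows "finite (x \<inter> window n)"
  by (rule finite_subset[OF _ config_finite_hits[OF assms compact_cball[of 0 "real n"]]])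
     (auto simp: window_def)

lemma config_finite_bounded:
  fixes x :: "'a::euclidean_space set set"
  assumes x: "x \<in> space configs" and B: "hausdorff_bounded B"
  shows "finite (x \<inter> B)"
proof -
  obtain n where "B \<inter> space particles \<subseteq> window n"
    using hausdorff_bounded_subset_window[of "B \<inter> space particles"] hausdorff_bounded_subset[OF B] by blast
  then have "x \<inter> B \<subseteq> x \<inter> window n" using config_particles[OF x] by auto
  then show ?thesis using config_finite_window[OF x] by (rule finite_subset)
qed

lemma config_subset:
  assumes "x \<in> space configs" "y \<subseteq> x" shows "y \<in> space configs"
  using assms unfolding space_configs locally_finite_config_def
  by (auto intro: finite_subset[rotated])

lemma config_insert:
  assumes "x \<in> space configs" "K \<in> space particles" shows "insert K x \<in> space configs"
proof -
  have "finite {L\<in>insert K x. L \<inter> C \<noteq> {}}" if "C \<in> space particles" for C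
  proof (rule finite_subset)
    show "finite (insert K {L\<in>x. L \<inter> C \<noteq> {}})"
      using assms(1) that by (auto simp: space_configs locally_finite_config_def)
  qed auto
  then show ?thesis using assms by (auto simp: space_configs locally_finite_config_def)
qed

lemma config_Un:
  assumes "x \<in> space configs" "y \<in> space configs" shows "x \<union> y \<in> space configs"
proof -
  have "{L\<in>x \<union> y. L \<inter> K \<noteq> {}} = {L\<in>x. L \<inter> K \<noteq> {}} \<union> {L\<in>y. L \<inter> K \<noteq> {}}" for K by auto
  then show ?thesis using assms by (simp add: space_configs locally_finite_config_def)
qed

lemma measurable_card_config:
  assumes "B \<in> sets compacts" "hausdorff_bounded B"
  shows "(\<lambda>x. card (x \<inter> B)) \<in> measurable configs (count_space UNIV)"
proof (intro measurableI)
  fix A :: "nat set" 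
  have "(\<lambda>x. card (x \<inter> B)) -` A \<inter> {x. locally_finite_config x} \<in> sets configs"
    unfolding sets_configs using assms by (intro sigma_sets.Basic) blast
  then show "(\<lambda>x. card (x \<inter> B)) -` A \<inter> space configs \<in> sets configs" by (simp add: space_configs)
qed auto

section \<open>Sums over a configuration as integrals against counting measure\<close>

lemma nn_integral_indicator_config:
  assumes "finite (x \<inter> B)"
  shows "(\<integral>\<^sup>+K. indicator B K \<partial>count_space x) = of_nat (card (x \<inter> B))"
proof -
  have "(\<integral>\<^sup>+K. indicator B K \<partial>count_space x) = (\<integral>\<^sup>+K. indicator (x \<inter> B) K \<partial>count_space x)"
    by (intro nn_integral_cong) (auto simp: indicator_def)
  also have "\<dots> = emeasure (count_space x) (x \<inter> B)" by (intro nn_integral_indicator) auto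
  also have "\<dots> = of_nat (card (x \<inter> B))" using assms by (intro emeasure_count_space_finite) auto
  finally show ?thesis .
qed

lemma nn_integral_count_space_restrict:
  "(\<integral>\<^sup>+K. f K \<partial>count_space (x \<inter> B)) = (\<integral>\<^sup>+K. f K * indicator B K \<partial>count_space x)"
  by (subst (1 2) nn_integral_count_space_indicator) (auto intro!: nn_integral_cong simp: indicator_def)

text \<open>Normalised to mass at most \<open>1\<close>, so that the measurability theorems for subprobability kernels apply.\<close>

definition config_kernel :: "nat \<Rightarrow> 'a::euclidean_space set set \<Rightarrow> 'a set measure" where
  "config_kernel n x = distr (scale_measure (1 / of_nat (Suc (card (x \<inter> window n)))) (count_space (x \<inter> window n))) particles (\<lambda>K. K)"

lemma nn_integral_config_kernel:
  assumes f: "f \<in> borel_measurable particles"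
  shows "(\<integral>\<^sup>+K. f K \<partial>config_kernel n x)
    = (1 / of_nat (Suc (card (x \<inter> window n)))) * (\<integral>\<^sup>+K. f K \<partial>count_space (x \<inter> window n))"
proof -
  have "(\<integral>\<^sup>+K. f K \<partial>config_kernel n x) = (\<integral>\<^sup>+K. f K \<partial>scale_measure (1 / of_nat (Suc (card (x \<inter> window n)))) (count_space (x \<inter> window n)))"
    unfolding config_kernel_def
  proof (rule nn_integral_distr)
    have "(\<lambda>K. K) \<in> measurable (count_space (x \<inter> window n)) particles"
      by (auto simp: window_def in_space_particles)
    then show "(\<lambda>K. K) \<in> measurable (scale_measure (1 / of_nat (Suc (card (x \<inter> window n)))) (count_space (x \<inter> window n))) particles"
      unfolding measurable_cong_sets[OF sets_scale_measure refl] .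
  qed (use f in simp)
  also have "\<dots> = (1 / of_nat (Suc (card (x \<inter> window n)))) * (\<integral>\<^sup>+K. f K \<partial>count_space (x \<inter> window n))"
    by (rule nn_integral_scale_measure) simp
  finally show ?thesis .
qed

lemma measurable_config_kernel:
  "config_kernel n \<in> measurable configs (subprob_algebra (particles :: 'a::euclidean_space set measure))"
proof (rule measurable_subprob_algebra)
  fix x :: "'a set set" assume x: "x \<in> space configs"
  have s: "sets (config_kernel n x) = sets particles" by (simp add: config_kernel_def)
  then show "sets (config_kernel n x) = sets particles" .
  have sp: "space (config_kernel n x) = space particles" by (rule sets_eq_imp_space_eq[OF s])
  show "subprob_space (config_kernel n x)"
  proof
    have "emeasure (config_kernel n x) (space (config_kernel n x)) = (\<integral>\<^sup>+K. 1 \<partial>config_kernel n x)" by simp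
    also have "\<dots> = (1 / of_nat (Suc (card (x \<inter> window n)))) * of_nat (card (x \<inter> window n))"
      using config_finite_window[OF x] by (subst nn_integral_config_kernel) (auto simp: emeasure_count_space_finite)
    also have "\<dots> \<le> 1"
      by (simp add: ennreal_of_nat_eq_real_of_nat ennreal_1[symmetric] divide_ennreal ennreal_mult[symmetric] del: ennreal_1 of_nat_Suc)
    finally show "emeasure (config_kernel n x) (space (config_kernel n x)) \<le> 1" .
    show "space (config_kernel n x) \<noteq> {}" unfolding sp by (auto simp: space_particles intro!: exI[of _ "{0}"])
  qed
next
  fix A :: "'a set set" assume A: "A \<in> sets particles"
  then have A': "A \<inter> window n \<in> sets compacts" using sets_window[of n] by (auto simp: sets_particles_iff)
  have b: "hausdorff_bounded (A \<inter> window n)"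
    by (rule hausdorff_bounded_subset[OF hausdorff_bounded_window]) auto
  have w: "(\<lambda>x. card (x \<inter> window n)) \<in> measurable configs (count_space UNIV)"
    using sets_window[of n] by (intro measurable_card_config hausdorff_bounded_window) (auto simp: sets_particles_iff)
  have [measurable]: "(\<lambda>x. of_nat (card (x \<inter> window n)) :: ennreal) \<in> borel_measurable configs"
    "(\<lambda>x. of_nat (card (x \<inter> (A \<inter> window n))) :: ennreal) \<in> borel_measurable configs"
    by (rule measurable_compose[OF w], simp, rule measurable_compose[OF measurable_card_config[OF A' b]], simp)
  have eq: "emeasure (config_kernel n x) A = 1 / (1 + of_nat (card (x \<inter> window n))) * of_nat (card (x \<inter> (A \<inter> window n)))"
    if x: "x \<in> space configs" for x
  proof -
    have "emeasure (config_kernel n x) A = (\<integral>\<^sup>+K. indicator A K \<partial>config_kernel n x)"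
      using A by (subst nn_integral_indicator) (auto simp: config_kernel_def)
    also have "\<dots> = (1 / of_nat (Suc (card (x \<inter> window n)))) * of_nat (card (x \<inter> window n \<inter> A))"
      using A config_finite_window[OF x] by (simp add: nn_integral_config_kernel nn_integral_indicator_config)
    finally show ?thesis by (simp add: Int_ac)
  qed
  show "(\<lambda>x. emeasure (config_kernel n x) A) \<in> borel_measurable configs"
    by (subst measurable_cong[OF eq]) (assumption, measurable)
qed

lemma nn_integral_config_SUP:
  assumes "x \<in> space configs"
  shows "(\<integral>\<^sup>+K. f K \<partial>count_space x) = (SUP n. \<integral>\<^sup>+K. f K \<partial>count_space (x \<inter> window n))"
proof -
  have "(\<integral>\<^sup>+K. f K \<partial>count_space x) = (\<integral>\<^sup>+K. (SUP n. f K * indicator (window n) K) \<partial>count_space x)"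
  proof (rule nn_integral_cong)
    fix K assume "K \<in> space (count_space x)"
    then have "K \<in> (\<Union>n. window n)" using config_particles[OF assms] by (auto simp: UN_window)
    then obtain n where "K \<in> window n" by blast
    then have "f K \<le> (SUP n. f K * indicator (window n) K)" by (intro SUP_upper2[of n]) auto
    moreover have "(SUP n. f K * indicator (window n) K) \<le> f K" by (intro SUP_least) (auto simp: indicator_def)
    ultimately show "f K = (SUP n. f K * indicator (window n) K)" by (rule antisym)
  qed
  also have "\<dots> = (SUP n. \<integral>\<^sup>+K. f K * indicator (window n) K \<partial>count_space x)"
    using incseq_window
  proof (intro nn_integral_monotone_convergence_SUP borel_measurable_count_space incseq_SucI le_funI)
    fix n K show "f K * indicator (window n) K \<le> f K * indicator (window (Suc n)) K"
      using incseq_SucD[OF incseq_window, of n] by (auto simp: indicator_def)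
  qed
  finally show ?thesis by (simp add: nn_integral_count_space_restrict)
qed

text \<open>Inside a window the sum is the integral against \<open>config_kernel\<close>, multiplied
  back by the normalising factor 1 + card, and both depend measurably on the configuration; the
  supremum over windows gives the whole sum. The summand may depend on the parameter z, which admits
  iterated sums.\<close>

lemma measurable_config_sum [measurable (raw)]:
  assumes f [measurable]: "(\<lambda>(z, K). f z K) \<in> borel_measurable (M \<Otimes>\<^sub>M particles)"
    and X [measurable]: "X \<in> measurable M (configs :: 'a::euclidean_space set set measure)"
  shows "(\<lambda>z. \<integral>\<^sup>+K. f z K \<partial>count_space (X z)) \<in> borel_measurable M"
proof -
  have w: "(\<lambda>z. of_nat (card (X z \<inter> window n)) :: ennreal) \<in> borel_measurable M" for n
    using sets_window[of n]
    by (intro measurable_compose[OF measurable_compose[OF X measurable_card_config[OF _ hausdorff_bounded_window]]])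
       (auto simp: sets_particles_iff)
  have m: "(\<lambda>z. \<integral>\<^sup>+K. f z K \<partial>config_kernel n (X z)) \<in> borel_measurable M" for n
    by (rule nn_integral_measurable_subprob_algebra2[OF f measurable_compose[OF X measurable_config_kernel]])
  have eq: "(\<integral>\<^sup>+K. f z K \<partial>count_space (X z \<inter> window n))
    = (1 + of_nat (card (X z \<inter> window n))) * (\<integral>\<^sup>+K. f z K \<partial>config_kernel n (X z))" if "z \<in> space M" for z n
  proof -
    have "f z \<in> borel_measurable particles" using measurable_Pair2[OF f that] by simp
    then have "(1 + of_nat (card (X z \<inter> window n))) * (\<integral>\<^sup>+K. f z K \<partial>config_kernel n (X z))
      = (of_nat (Suc (card (X z \<inter> window n))) * (1 / of_nat (Suc (card (X z \<inter> window n)))))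
          * (\<integral>\<^sup>+K. f z K \<partial>count_space (X z \<inter> window n))"
      by (simp add: nn_integral_config_kernel mult.assoc)
    also have "of_nat (Suc (card (X z \<inter> window n))) * (1 / of_nat (Suc (card (X z \<inter> window n)))) = (1::ennreal)"
      by (simp add: ennreal_of_nat_eq_real_of_nat ennreal_1[symmetric] divide_ennreal ennreal_mult[symmetric] del: ennreal_1 of_nat_Suc)
    finally show ?thesis by simp
  qed
  have "(\<lambda>z. \<integral>\<^sup>+K. f z K \<partial>count_space (X z \<inter> window n)) \<in> borel_measurable M" for n
    by (subst measurable_cong[OF eq], assumption) (use w m in measurable)
  then have "(\<lambda>z. SUP n. \<integral>\<^sup>+K. f z K \<partial>count_space (X z \<inter> window n)) \<in> borel_measurable M"
    by (intro borel_measurable_SUP) auto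
  then show ?thesis
    by (subst measurable_cong[OF nn_integral_config_SUP]) (use measurable_space[OF X] in auto)
qed

section \<open>Measurable operations on configurations\<close>

lemma nn_integral_count_space_insert:
  assumes "k \<notin> x"
  shows "(\<integral>\<^sup>+K. f K \<partial>count_space (insert k x)) = f k + (\<integral>\<^sup>+K. f K \<partial>count_space x)"
proof -
  have "(\<integral>\<^sup>+K. f K \<partial>count_space (insert k x))
    = (\<integral>\<^sup>+K. f K * indicator {k} K + f K * indicator x K \<partial>count_space UNIV)"
    using assms by (subst nn_integral_count_space_indicator)
      (auto intro!: nn_integral_cong simp: indicator_def)
  also have "\<dots> = (\<integral>\<^sup>+K. f K * indicator {k} K \<partial>count_space UNIV) + (\<integral>\<^sup>+K. f K * indicator x K \<partial>count_space UNIV)"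
    by (rule nn_integral_add) auto
  also have "(\<integral>\<^sup>+K. f K * indicator {k} K \<partial>count_space UNIV) = f k"
    by (simp add: nn_integral_count_space_indicator[symmetric] nn_integral_count_space_finite)
  finally show ?thesis by (simp add: nn_integral_count_space_indicator)
qed

lemma nn_integral_count_space_Un:
  assumes "x \<inter> y = {}"
  shows "(\<integral>\<^sup>+K. f K \<partial>count_space (x \<union> y)) = (\<integral>\<^sup>+K. f K \<partial>count_space x) + (\<integral>\<^sup>+K. f K \<partial>count_space y)"
proof -
  have "(\<integral>\<^sup>+K. f K \<partial>count_space (x \<union> y))
    = (\<integral>\<^sup>+K. f K * indicator x K + f K * indicator y K \<partial>count_space UNIV)"
    using assms by (subst nn_integral_count_space_indicator)
      (auto intro!: nn_integral_cong simp: indicator_def)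
  then show ?thesis by (simp add: nn_integral_count_space_indicator nn_integral_add)
qed

text \<open>Phrasing the test with counting-measure integrals instead of \<open>card\<close> lets
  \<open>measurable_config_sum\<close> handle each of the maps below. On the bounded sets that
  generate \<open>configs\<close> the two agree because the counts are finite.\<close>

lemma measurable_configsI:
  fixes f :: "'b \<Rightarrow> 'a::euclidean_space set set"
  assumes sp: "\<And>z. z \<in> space M \<Longrightarrow> f z \<in> space configs"
    and m: "\<And>B. B \<in> sets particles \<Longrightarrow> (\<lambda>z. \<integral>\<^sup>+K. indicator B K \<partial>count_space (f z)) \<in> borel_measurable M"
  shows "f \<in> measurable M configs"
proof (rule measurable_sigma_sets[OF sets_configs])
  fix Y :: "'a set set set"
  assume "Y \<in> {(\<lambda>x. card (x \<inter> B)) -` A \<inter> {x. locally_finite_config x} | A B.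
        B \<in> sets compacts \<and> hausdorff_bounded B}"
  then obtain A B where Y: "Y = (\<lambda>x. card (x \<inter> B)) -` A \<inter> {x. locally_finite_config x}"
    and B: "B \<in> sets compacts" "hausdorff_bounded B" by blast
  \<comment> \<open>The generating sets may contain the empty set, which is compact but not a
    particle.\<close>
  define C where "C = B \<inter> space particles"
  have C: "C \<in> sets particles"
    using B(1) nonempty_in_compacts by (auto simp: C_def sets_particles_iff space_particles)
  have fin: "finite (f z \<inter> C)" if "z \<in> space M" for z
    using config_finite_bounded[OF sp[OF that] B(2)] by (rule finite_subset[rotated]) (auto simp: C_def)
  have BC: "f z \<inter> B = f z \<inter> C" if "z \<in> space M" for z
    using config_particles[OF sp[OF that]] by (auto simp: C_def)
  have "f -` Y \<inter> space M = (\<Union>c\<in>A. {z\<in>space M. (\<integral>\<^sup>+K. indicator C K \<partial>count_space (f z)) = of_nat c})"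
    using sp by (auto simp: Y BC fin nn_integral_indicator_config space_configs)
  also have "\<dots> \<in> sets M"
  proof (intro sets.countable_UN' image_subsetI)
    fix c show "{z\<in>space M. (\<integral>\<^sup>+K. indicator C K \<partial>count_space (f z)) = of_nat c} \<in> sets M"
      using measurable_sets[OF m[OF C], of "{of_nat c}"] by (simp add: vimage_def Int_def conj_commute)
  qed auto
  finally show "f -` Y \<inter> space M \<in> sets M" .
qed (use sp in \<open>auto simp: space_configs\<close>)

lemma measurable_filter_config:
  assumes P: "Measurable.pred (M \<Otimes>\<^sub>M particles) (\<lambda>(z, K). P z K)"
    and X: "X \<in> measurable M (configs :: 'a::euclidean_space set set measure)"
  shows "(\<lambda>z. {K\<in>X z. P z K}) \<in> measurable M configs"
proof (rule measurable_configsI)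
  fix z assume z: "z \<in> space M"
  show "{K\<in>X z. P z K} \<in> space configs"
    by (rule config_subset[OF measurable_space[OF X z]]) auto
next
  note P [measurable] X [measurable]
  fix B :: "'a set set" assume [measurable]: "B \<in> sets particles"
  have [measurable]: "Measurable.pred (M \<Otimes>\<^sub>M particles) (\<lambda>q. P (fst q) (snd q))"
    using P by (simp add: split_beta')
  have "(\<lambda>z. \<integral>\<^sup>+K. indicator B K * (if P z K then 1 else 0) \<partial>count_space (X z)) \<in> borel_measurable M"
    by (rule measurable_config_sum) (simp_all add: split_beta', measurable)
  moreover have "(\<integral>\<^sup>+K. indicator B K \<partial>count_space {K\<in>X z. P z K})
    = (\<integral>\<^sup>+K. indicator B K * (if P z K then 1 else 0) \<partial>count_space (X z))" for z
    by (subst (1 2) nn_integral_count_space_indicator) (auto intro!: nn_integral_cong simp: indicator_def)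
  ultimately show "(\<lambda>z. \<integral>\<^sup>+K. indicator B K \<partial>count_space {K\<in>X z. P z K}) \<in> borel_measurable M"
    by simp
qed

lemma measurable_eq_particles [measurable (raw)]:
  assumes f [measurable]: "f \<in> measurable M particles" and g [measurable]: "g \<in> measurable M (particles :: 'a::euclidean_space set measure)"
  shows "Measurable.pred M (\<lambda>z. f z = g z)"
proof -
  have "(\<lambda>z. (f z, g z)) \<in> measurable M (compacts \<Otimes>\<^sub>M compacts)" by measurable
  from measurable_compose[OF this measurable_eq_compacts] show ?thesis by simp
qed

text \<open>The sum over \<open>X z\<close> of the indicator of equality with \<open>k z\<close> is
  1 or 0 according to membership.\<close>

lemma pred_mem_config:
  assumes k [measurable]: "k \<in> measurable M particles" and X [measurable]: "X \<in> measurable M (configs :: 'a::euclidean_space set set measure)"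
  shows "Measurable.pred M (\<lambda>z. k z \<in> X z)"
proof -
  have "(\<lambda>z. \<integral>\<^sup>+K. (if K = k z then 1 else 0) \<partial>count_space (X z)) \<in> borel_measurable M"
    by (rule measurable_config_sum) (simp_all add: split_beta', measurable)
  moreover have "(\<integral>\<^sup>+K. (if K = k z then 1 else 0) \<partial>count_space (X z)) = (if k z \<in> X z then 1 else 0)" for z
    by (subst nn_integral_count_space'[where A="{k z} \<inter> X z"]) auto
  ultimately have [measurable]: "(\<lambda>z. if k z \<in> X z then 1 else 0::ennreal) \<in> borel_measurable M" by simp
  have "Measurable.pred M (\<lambda>z. (if k z \<in> X z then 1 else 0::ennreal) = 1)" by measurable
  moreover have "(\<lambda>z. (if k z \<in> X z then 1 else 0::ennreal) = 1) = (\<lambda>z. k z \<in> X z)" by auto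
  ultimately show ?thesis by (simp only:)
qed

lemma measurable_delete_config:
  assumes k [measurable]: "k \<in> measurable M particles" and X: "X \<in> measurable M (configs :: 'a::euclidean_space set set measure)"
  shows "(\<lambda>z. X z - {k z}) \<in> measurable M configs"
proof -
  have "(\<lambda>z. {K\<in>X z. K \<noteq> k z}) \<in> measurable M configs"
    by (rule measurable_filter_config[OF _ X]) (simp add: split_beta')
  then show ?thesis by (simp add: set_diff_eq)
qed

lemma measurable_insert_config:
  assumes k [measurable]: "k \<in> measurable M particles" and X [measurable]: "X \<in> measurable M (configs :: 'a::euclidean_space set set measure)"
  shows "(\<lambda>z. insert (k z) (X z)) \<in> measurable M configs"
proof (rule measurable_configsI)
  fix z assume z: "z \<in> space M"
  show "insert (k z) (X z) \<in> space configs"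
    by (rule config_insert[OF measurable_space[OF X z] measurable_space[OF k z]])
next
  fix B :: "'a set set" assume [measurable]: "B \<in> sets particles"
  have [measurable]: "Measurable.pred M (\<lambda>z. k z \<in> X z)" by (rule pred_mem_config) measurable
  have "(\<lambda>z. (if k z \<in> X z then 0 else indicator B (k z)) + (\<integral>\<^sup>+K. indicator B K \<partial>count_space (X z))) \<in> borel_measurable M"
    by measurable
  moreover have "(\<integral>\<^sup>+K. indicator B K \<partial>count_space (insert (k z) (X z)))
    = (if k z \<in> X z then 0 else indicator B (k z)) + (\<integral>\<^sup>+K. indicator B K \<partial>count_space (X z))" for z
    by (simp add: nn_integral_count_space_insert insert_absorb)
  ultimately show "(\<lambda>z. \<integral>\<^sup>+K. indicator B K \<partial>count_space (insert (k z) (X z))) \<in> borel_measurable M"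
    by simp
qed

lemma measurable_inside_outside:
  fixes X Y :: "'b \<Rightarrow> 'a::euclidean_space set set"
  assumes [measurable]: "\<Delta> \<in> sets borel" "X \<in> measurable M configs" "Y \<in> measurable M configs"
  shows measurable_inside: "(\<lambda>z. inside \<Delta> (X z)) \<in> measurable M configs"
    and measurable_outside: "(\<lambda>z. outside \<Delta> (X z)) \<in> measurable M configs"
    and measurable_glue: "(\<lambda>z. inside \<Delta> (X z) \<union> outside \<Delta> (Y z)) \<in> measurable M configs"
proof -
  have i: "(\<lambda>z. inside \<Delta> (Z z)) \<in> measurable M configs"
    if Z: "Z \<in> measurable M configs" for Z :: "'b \<Rightarrow> 'a::euclidean_space set set"
    unfolding inside_def by (rule measurable_filter_config[OF _ Z]) (simp add: split_beta')
  have o: "(\<lambda>z. outside \<Delta> (Z z)) \<in> measurable M configs"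
    if Z: "Z \<in> measurable M configs" for Z :: "'b \<Rightarrow> 'a::euclidean_space set set"
    unfolding outside_def by (rule measurable_filter_config[OF _ Z]) (simp add: split_beta')
  note [measurable] = i[OF assms(2)] o[OF assms(3)]
  show "(\<lambda>z. inside \<Delta> (X z)) \<in> measurable M configs" by (rule i) fact
  show "(\<lambda>z. outside \<Delta> (X z)) \<in> measurable M configs" by (rule o) fact
  show "(\<lambda>z. inside \<Delta> (X z) \<union> outside \<Delta> (Y z)) \<in> measurable M configs"
  proof (rule measurable_configsI)
    fix z assume "z \<in> space M"
    then show "inside \<Delta> (X z) \<union> outside \<Delta> (Y z) \<in> space configs"
      using measurable_space[OF i[OF assms(2)]] measurable_space[OF o[OF assms(3)]] by (intro config_Un)
  next
    fix B :: "'a set set" assume [measurable]: "B \<in> sets particles"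
    have "inside \<Delta> (X z) \<inter> outside \<Delta> (Y z) = {}" for z by (auto simp: inside_def outside_def)
    then show "(\<lambda>z. \<integral>\<^sup>+K. indicator B K \<partial>count_space (inside \<Delta> (X z) \<union> outside \<Delta> (Y z))) \<in> borel_measurable M"
      by (simp add: nn_integral_count_space_Un)
  qed
qed

text \<open>For real summands, summability over a set is absolute summability, hence integrability
  against counting measure; where it fails, both sides are 0 by convention.\<close>

lemma infsum_eq_integral_count_space:
  fixes f :: "'b \<Rightarrow> real"
  shows "infsum f A = (\<integral>x. f x \<partial>count_space A)"
proof (cases "f summable_on A")
  case True
  then have "Infinite_Set_Sum.abs_summable_on f A"
    by (metis abs_summable_equivalent summable_on_iff_abs_summable_on_real)
  then show ?thesis by (simp add: infsetsum_infsum[symmetric] infsetsum_def)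
next
  case False
  then have "\<not> Infinite_Set_Sum.abs_summable_on f A"
    by (metis abs_summable_equivalent summable_on_iff_abs_summable_on_real)
  then show ?thesis using False
    by (simp add: infsum_not_exists not_integrable_integral_eq Infinite_Set_Sum.abs_summable_on_def)
qed

text \<open>The sum is split into its positive and negative parts, each covered by
  \<open>measurable_config_sum\<close>; the branch 0 is the value of \<open>infsum\<close> on a
  family that is not summable.\<close>

lemma measurable_config_infsum [measurable (raw)]:
  fixes f :: "'b \<Rightarrow> 'a::euclidean_space set \<Rightarrow> real"
  assumes f: "(\<lambda>(z, K). f z K) \<in> borel_measurable (M \<Otimes>\<^sub>M particles)"
    and X [measurable]: "X \<in> measurable M configs"
  shows "(\<lambda>z. \<Sum>\<^sub>\<infinity>K\<in>X z. f z K) \<in> borel_measurable M"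
proof -
  have [measurable]: "(\<lambda>q. f (fst q) (snd q)) \<in> borel_measurable (M \<Otimes>\<^sub>M particles)"
    using f by (simp add: split_beta')
  have m: "(\<lambda>z. \<integral>\<^sup>+K. ennreal \<bar>f z K\<bar> \<partial>count_space (X z)) \<in> borel_measurable M"
    "(\<lambda>z. \<integral>\<^sup>+K. ennreal (f z K) \<partial>count_space (X z)) \<in> borel_measurable M"
    "(\<lambda>z. \<integral>\<^sup>+K. ennreal (- f z K) \<partial>count_space (X z)) \<in> borel_measurable M"
    by (rule measurable_config_sum; simp add: split_beta')+
  have "(\<Sum>\<^sub>\<infinity>K\<in>X z. f z K) = (if (\<integral>\<^sup>+K. ennreal \<bar>f z K\<bar> \<partial>count_space (X z)) < \<infinity>
    then enn2real (\<integral>\<^sup>+K. ennreal (f z K) \<partial>count_space (X z)) - enn2real (\<integral>\<^sup>+K. ennreal (- f z K) \<partial>count_space (X z))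
    else 0)" for z
  proof (cases "integrable (count_space (X z)) (f z)")
    case True
    then show ?thesis
      by (simp add: infsum_eq_integral_count_space real_lebesgue_integral_def integrable_iff_bounded)
  next
    case False
    then show ?thesis
      by (auto simp: infsum_eq_integral_count_space integrable_iff_bounded not_integrable_integral_eq)
  qed
  then show ?thesis using m by simp
qed

lemma pair_potential_measurable:
  fixes g :: "'a::euclidean_space set \<Rightarrow> real"
  assumes "pair_potential g"
    and [measurable]: "k \<in> measurable M particles" "l \<in> measurable M particles"
  shows "(\<lambda>z. g (k z \<inter> l z)) \<in> borel_measurable M"
proof -
  have g: "g \<in> borel_measurable compacts" using assms by (simp add: pair_potential_def)
  have "(\<lambda>z. (k z, l z)) \<in> measurable M (compacts \<Otimes>\<^sub>M compacts)" by measurable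
  from measurable_compose[OF measurable_compose[OF this measurable_Int_compacts] g] show ?thesis by simp
qed

lemma measurable_cond_intensity:
  fixes g :: "'a::euclidean_space set \<Rightarrow> real"
  assumes g: "pair_potential g"
    and [measurable]: "k \<in> measurable M particles" "X \<in> measurable M configs"
  shows "(\<lambda>z. cond_intensity \<tau> \<beta> g (k z) (X z)) \<in> borel_measurable M"
proof -
  have "(\<lambda>z. \<Sum>\<^sub>\<infinity>L\<in>X z. g (k z \<inter> L)) \<in> borel_measurable M"
    by (rule measurable_config_infsum)
       (simp_all add: split_beta', intro pair_potential_measurable[OF g], measurable)
  then show ?thesis unfolding cond_intensity_def by measurable
qed

subsection \<open>The Mecke equation\<close>

lemma poisson_lawD:
  assumes "poisson_law \<Lambda> (\<Psi> :: 'a::euclidean_space set set measure)"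
  shows "prob_space \<Psi>" "sets \<Psi> = sets configs" "space \<Psi> = space configs"
    and "B \<in> sets particles \<Longrightarrow> hausdorff_bounded B \<Longrightarrow> emeasure \<Lambda> B < \<infinity>"
    and "B \<in> sets particles \<Longrightarrow> hausdorff_bounded B \<Longrightarrow>
      measure \<Psi> {x\<in>space \<Psi>. card (x \<inter> B) = k} = measure \<Lambda> B ^ k / fact k * exp (- measure \<Lambda> B)"
proof -
  note p = assms[unfolded poisson_law_def]
  show "prob_space \<Psi>" "sets \<Psi> = sets configs" using p by blast+
  then show "space \<Psi> = space configs" by (metis sets_eq_imp_space_eq)
  show "B \<in> sets particles \<Longrightarrow> hausdorff_bounded B \<Longrightarrow> emeasure \<Lambda> B < \<infinity>" using p by blast
  show "B \<in> sets particles \<Longrightarrow> hausdorff_bounded B \<Longrightarrow>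
      measure \<Psi> {x\<in>space \<Psi>. card (x \<inter> B) = k} = measure \<Lambda> B ^ k / fact k * exp (- measure \<Lambda> B)"
    using p by blast
qed

section \<open>The Mecke equation for events given by finitely many counts\<close>

lemma measurable_removed [measurable]:
  fixes f :: "'a::euclidean_space set \<times> 'a set set \<Rightarrow> ennreal"
  assumes f [measurable]: "f \<in> borel_measurable (particles \<Otimes>\<^sub>M configs)"
  shows "(\<lambda>y. \<integral>\<^sup>+K. f (K, y - {K}) \<partial>count_space y) \<in> borel_measurable configs"
proof -
  have "(\<lambda>q. snd q) \<in> measurable (configs \<Otimes>\<^sub>M particles) (particles :: 'a set measure)"
    "(\<lambda>q. fst q) \<in> measurable (configs \<Otimes>\<^sub>M particles) (configs :: 'a set set measure)" by measurable
  from measurable_delete_config[OF this] this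
  have "(\<lambda>q. (snd q, fst q - {snd q})) \<in> measurable (configs \<Otimes>\<^sub>M particles) (particles \<Otimes>\<^sub>M (configs :: 'a set set measure))"
    by measurable
  from measurable_compose[OF this f]
  have "(\<lambda>(y, K). f (K, y - {K})) \<in> borel_measurable (configs \<Otimes>\<^sub>M particles)" by (simp add: split_beta')
  from measurable_config_sum[OF this, of "\<lambda>y. y"] show ?thesis by simp
qed

definition counts :: "(nat \<Rightarrow> 'a::euclidean_space set set) \<Rightarrow> nat set \<Rightarrow> (nat \<Rightarrow> nat) \<Rightarrow> 'a set set set" where
  "counts C J k = {y\<in>space configs. \<forall>j\<in>J. card (y \<inter> C j) = k j}"

lemma sets_counts:
  assumes "finite J" "\<And>j. j \<in> J \<Longrightarrow> C j \<in> sets particles" "\<And>j. j \<in> J \<Longrightarrow> hausdorff_bounded (C j)"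
  shows "counts C J k \<in> sets configs"
proof -
  have "{y\<in>space configs. card (y \<inter> C j) = k j} \<in> sets configs" if "j \<in> J" for j
  proof -
    have "(\<lambda>x. card (x \<inter> C j)) \<in> measurable configs (count_space UNIV)"
      using assms(2)[OF that] assms(3)[OF that] by (intro measurable_card_config) (auto simp: sets_particles_iff)
    from measurable_sets[OF this, of "{k j}"] show ?thesis by (simp add: vimage_def Int_def conj_commute)
  qed
  then have "{y\<in>space configs. \<forall>j\<in>J. card (y \<inter> C j) = k j} \<in> sets configs"
    using assms(1) by (intro sets.sets_Collect_finite_All) auto
  then show ?thesis by (simp add: counts_def)
qed

text \<open>This is the recursion (k + 1) p(k + 1) = m p(k) for the Poisson weights p with mean m.
  If removing a point K in \<open>C i\<close> leaves the counts k, then y has one more point in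
  \<open>C i\<close>, and each of its k i + 1 points there can be taken for K.\<close>

lemma poisson_mecke_atom:
  fixes \<Psi> :: "'a::euclidean_space set set measure"
  assumes P: "poisson_law \<Lambda> \<Psi>"
    and J: "finite J" "i \<in> J" and C: "\<And>j. j \<in> J \<Longrightarrow> C j \<in> sets particles" "\<And>j. j \<in> J \<Longrightarrow> hausdorff_bounded (C j)"
    and disj: "disjoint_family_on C J"
  shows "(\<integral>\<^sup>+y. (\<integral>\<^sup>+K. indicator (C i) K * indicator (counts C J k) (y - {K}) \<partial>count_space y) \<partial>\<Psi>)
    = emeasure \<Lambda> (C i) * emeasure \<Psi> (counts C J k)"
proof -
  interpret \<Psi>: prob_space \<Psi> by (rule poisson_lawD(1)[OF P])
  note sp = poisson_lawD(3)[OF P] and ss [measurable_cong] = poisson_lawD(2)[OF P]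
  define m where "m j = measure \<Lambda> (C j)" for j
  have prob: "emeasure \<Psi> (counts C J k) = ennreal (\<Prod>j\<in>J. m j ^ k j / fact (k j) * exp (- m j))" for k
  proof -
    have "\<Psi>.indep_vars (\<lambda>_. count_space UNIV) (\<lambda>i x. card (x \<inter> C i)) J"
      using P J(1) disj C unfolding poisson_law_def by blast
    from \<Psi>.indep_varsD[OF this _ J(1) subset_refl, of "\<lambda>j. {k j}"] J(2)
    have "\<Psi>.prob (\<Inter>j\<in>J. (\<lambda>x. card (x \<inter> C j)) -` {k j} \<inter> space \<Psi>)
      = (\<Prod>j\<in>J. \<Psi>.prob ((\<lambda>x. card (x \<inter> C j)) -` {k j} \<inter> space \<Psi>))" by auto
    moreover have "(\<Inter>j\<in>J. (\<lambda>x. card (x \<inter> C j)) -` {k j} \<inter> space \<Psi>) = counts C J k"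
      using J(2) by (auto simp: counts_def sp)
    moreover have "\<Psi>.prob ((\<lambda>x. card (x \<inter> C j)) -` {k j} \<inter> space \<Psi>) = m j ^ k j / fact (k j) * exp (- m j)" if "j \<in> J" for j
    proof -
      have "(\<lambda>x. card (x \<inter> C j)) -` {k j} \<inter> space \<Psi> = {x\<in>space \<Psi>. card (x \<inter> C j) = k j}" by auto
      then show ?thesis using poisson_lawD(5)[OF P C(1)[OF that] C(2)[OF that]] by (simp add: m_def)
    qed
    ultimately show ?thesis by (simp add: \<Psi>.emeasure_eq_measure)
  qed
  define k' where "k' = k(i := Suc (k i))"
  have inner: "(\<integral>\<^sup>+K. indicator (C i) K * indicator (counts C J k) (y - {K}) \<partial>count_space y)
      = of_nat (Suc (k i)) * indicator (counts C J k') y" if y: "y \<in> space configs" for y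
  proof -
    have fin: "finite (y \<inter> C j)" if "j \<in> J" for j by (rule config_finite_bounded[OF y C(2)[OF that]])
    have iff: "y - {K} \<in> counts C J k \<longleftrightarrow> y \<in> counts C J k'" if K: "K \<in> y" "K \<in> C i" for K
    proof -
      have "card ((y - {K}) \<inter> C j) = k j \<longleftrightarrow> card (y \<inter> C j) = k' j" if j: "j \<in> J" for j
      proof (cases "j = i")
        case True
        have "card (y \<inter> C i) = Suc (card (y \<inter> C i - {K}))"
          using K fin[OF J(2)] by (intro card.remove) auto
        moreover have "y \<inter> C i - {K} = (y - {K}) \<inter> C i" by auto
        ultimately show ?thesis by (simp add: True k'_def)
      next
        case False
        then have "K \<notin> C j" using disj J(2) j K(2) by (auto simp: disjoint_family_on_def)
        then have "(y - {K}) \<inter> C j = y \<inter> C j" by auto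
        then show ?thesis using False by (simp add: k'_def)
      qed
      moreover have "y - {K} \<in> space configs" by (rule config_subset[OF y]) auto
      ultimately show ?thesis using y by (auto simp: counts_def)
    qed
    have "(\<integral>\<^sup>+K. indicator (C i) K * indicator (counts C J k) (y - {K}) \<partial>count_space y)
      = (\<integral>\<^sup>+K. indicator (C i) K * indicator (counts C J k') y \<partial>count_space y)"
      by (intro nn_integral_cong) (auto simp: indicator_def iff)
    also have "\<dots> = of_nat (card (y \<inter> C i)) * indicator (counts C J k') y"
      by (simp add: nn_integral_multc nn_integral_indicator_config[OF fin[OF J(2)]])
    also have "\<dots> = of_nat (Suc (k i)) * indicator (counts C J k') y"
      using J(2) by (auto simp: indicator_def counts_def k'_def)
    finally show ?thesis .
  qed
  have "(\<integral>\<^sup>+y. (\<integral>\<^sup>+K. indicator (C i) K * indicator (counts C J k) (y - {K}) \<partial>count_space y) \<partial>\<Psi>)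
    = (\<integral>\<^sup>+y. of_nat (Suc (k i)) * indicator (counts C J k') y \<partial>\<Psi>)"
    by (intro nn_integral_cong inner) (simp add: sp)
  also have "\<dots> = of_nat (Suc (k i)) * emeasure \<Psi> (counts C J k')"
    using sets_counts[OF J(1) C] by (simp add: nn_integral_cmult ss)
  also have "\<dots> = ennreal (real (Suc (k i)) * (\<Prod>j\<in>J. m j ^ k' j / fact (k' j) * exp (- m j)))"
    unfolding prob by (simp add: ennreal_of_nat_eq_real_of_nat ennreal_mult'[symmetric] del: of_nat_Suc)
  also have "real (Suc (k i)) * (\<Prod>j\<in>J. m j ^ k' j / fact (k' j) * exp (- m j))
      = m i * (\<Prod>j\<in>J. m j ^ k j / fact (k j) * exp (- m j))"
  proof -
    define q where "q l j = m j ^ l j / fact (l j) * exp (- m j)" for l :: "nat \<Rightarrow> nat" and j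
    have rem: "(\<Prod>j\<in>J. q l j) = q l i * (\<Prod>j\<in>J-{i}. q l j)" for l
      by (rule prod.remove[OF J])
    have rest: "(\<Prod>j\<in>J-{i}. q k' j) = (\<Prod>j\<in>J-{i}. q k j)"
      by (intro prod.cong) (auto simp: k'_def q_def)
    have "real (Suc (k i)) * q k' i = m i * q k i"
      by (simp add: k'_def q_def field_simps del: of_nat_Suc)
    then have "real (Suc (k i)) * (\<Prod>j\<in>J. q k' j) = m i * (\<Prod>j\<in>J. q k j)"
      unfolding rem rest mult.assoc[symmetric] by (rule arg_cong)
    then show ?thesis by (simp only: q_def)
  qed
  also have "ennreal (m i * (\<Prod>j\<in>J. m j ^ k j / fact (k j) * exp (- m j))) = ennreal (m i) * emeasure \<Psi> (counts C J k)"
    unfolding prob by (rule ennreal_mult') (simp add: m_def)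
  also have "ennreal (m i) = emeasure \<Lambda> (C i)"
    using poisson_lawD(4)[OF P C(1)[OF J(2)] C(2)[OF J(2)]]
    by (simp add: m_def emeasure_eq_ennreal_measure)
  finally show ?thesis .
qed

text \<open>\<open>poisson_law\<close> prescribes joint counts for disjoint sets only. The sets B i,
  which may overlap, are dissolved into the atoms of the finite algebra they generate, and both
  sides are additive over the atoms of B 0 and over the possible counts on all atoms.\<close>

lemma poisson_mecke_counts:
  fixes \<Psi> :: "'a::euclidean_space set set measure"
  assumes P: "poisson_law \<Lambda> \<Psi>" and sL: "sets \<Lambda> = sets particles"
    and n: "0 < n" and B: "\<And>i. i < n \<Longrightarrow> B i \<in> sets particles" "\<And>i. i < n \<Longrightarrow> hausdorff_bounded (B i)"
  shows "(\<integral>\<^sup>+y. (\<integral>\<^sup>+K. indicator (B 0) K * indicator (counts B {..<n} k) (y - {K}) \<partial>count_space y) \<partial>\<Psi>)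
    = emeasure \<Lambda> (B 0) * emeasure \<Psi> (counts B {..<n} k)"
proof -
  interpret \<Psi>: prob_space \<Psi> by (rule poisson_lawD(1)[OF P])
  note sp = poisson_lawD(3)[OF P] and ss [measurable_cong] = poisson_lawD(2)[OF P]
  text \<open>Atom \<open>j\<close> consists of the particles that lie in exactly the sets \<open>B i\<close> with \<open>i\<close> a binary digit of \<open>j\<close>.\<close>
  define C where "C j = {K\<in>space particles. \<forall>i\<in>{..<n}. K \<in> B i \<longleftrightarrow> i \<in> set_decode j}" for j
  \<comment> \<open>The empty digit set is excluded: its atom lies outside all B i and need not be
    bounded.\<close>
  define J where "J = {j. set_decode j \<subseteq> {..<n} \<and> set_decode j \<noteq> {}}"
  have "J \<subseteq> set_encode ` Pow {..<n}"
    by (auto simp: J_def intro!: image_eqI[of _ _ "set_decode _"])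
  then have fJ: "finite J" by (rule finite_subset) auto
  have C1: "C j \<in> sets particles" for j
  proof -
    have "{K\<in>space particles. K \<in> B i \<longleftrightarrow> i \<in> set_decode j} \<in> sets particles" if "i < n" for i
    proof -
      have [measurable]: "B i \<in> sets particles" by (rule B(1)[OF that])
      show ?thesis by measurable
    qed
    then show ?thesis unfolding C_def by (intro sets.sets_Collect_finite_All) auto
  qed
  have C2: "hausdorff_bounded (C j)" if j: "j \<in> J" for j
  proof -
    obtain i where "i \<in> set_decode j" "i < n" using j by (auto simp: J_def)
    then have "C j \<subseteq> B i" by (auto simp: C_def)
    then show ?thesis using hausdorff_bounded_subset B(2)[OF \<open>i < n\<close>] by blast
  qed
  have disj: "disjoint_family_on C J"
  proof -
    have "j = l" if "K \<in> C j" "K \<in> C l" "j \<in> J" "l \<in> J" for K j l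
    proof -
      have "set_decode j = set_decode l" using that by (auto simp: C_def J_def)
      then show ?thesis by (metis set_decode_inverse)
    qed
    then show ?thesis by (auto simp: disjoint_family_on_def)
  qed
  define I where "I i = {j\<in>J. i \<in> set_decode j}" for i
  have fI: "finite (I i)" and IJ: "I i \<subseteq> J" for i using fJ by (auto simp: I_def)
  have BC: "B i = (\<Union>j\<in>I i. C j)" if i: "i < n" for i
  proof
    show "B i \<subseteq> (\<Union>j\<in>I i. C j)"
    proof
      fix K assume K: "K \<in> B i"
      define T where "T = {i. i < n \<and> K \<in> B i}"
      have "set_decode (set_encode T) = T" by (rule set_encode_inverse) (simp add: T_def)
      then have "set_encode T \<in> I i" "K \<in> C (set_encode T)"
        using K i sets.sets_into_space[OF B(1)[OF i]] by (auto simp: I_def J_def C_def T_def)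
      then show "K \<in> (\<Union>j\<in>I i. C j)" by blast
    qed
  qed (use i in \<open>auto simp: I_def C_def\<close>)
  have cardB: "card (y \<inter> B i) = (\<Sum>j\<in>I i. card (y \<inter> C j))" if "i < n" "y \<in> space configs" for i y
  proof -
    have "y \<inter> B i = (\<Union>j\<in>I i. y \<inter> C j)" using BC[OF that(1)] by auto
    also have "card \<dots> = (\<Sum>j\<in>I i. card (y \<inter> C j))"
    proof (intro card_UN_disjoint fI ballI impI)
      fix j assume "j \<in> I i"
      then show "finite (y \<inter> C j)" using IJ[of i] by (intro config_finite_bounded[OF that(2) C2]) auto
      fix l assume "l \<in> I i" "j \<noteq> l"
      then have "C j \<inter> C l = {}" using disj IJ[of i] \<open>j \<in> I i\<close> by (auto simp: disjoint_family_on_def)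
      then show "y \<inter> C j \<inter> (y \<inter> C l) = {}" by auto
    qed
    finally show ?thesis .
  qed
  \<comment> \<open>All ways to distribute the prescribed counts over the atoms. The upper bound
    makes the set finite, and functions extensional on J make the vector of atom counts of a
    configuration unique.\<close>
  define S where "S = {v\<in>J \<rightarrow>\<^sub>E {..(\<Sum>i<n. k i)}. \<forall>i<n. (\<Sum>j\<in>I i. v j) = k i}"
  have fS: "finite S" unfolding S_def using fJ by (intro finite_subset[OF _ finite_PiE[OF fJ, of "\<lambda>_. {..(\<Sum>i<n. k i)}"]]) auto
  have ind: "indicator (counts B {..<n} k) y = (\<Sum>v\<in>S. indicator (counts C J v) y :: ennreal)" for y
  proof (cases "y \<in> counts B {..<n} k")
    case True
    then have y: "y \<in> space configs" by (simp add: counts_def)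
    define v where "v = restrict (\<lambda>j. card (y \<inter> C j)) J"
    have sumv: "(\<Sum>j\<in>I i. v j) = k i" if "i < n" for i
    proof -
      have "(\<Sum>j\<in>I i. v j) = (\<Sum>j\<in>I i. card (y \<inter> C j))" using IJ[of i] by (intro sum.cong) (auto simp: v_def)
      then show ?thesis using cardB[OF that y] True that by (simp add: counts_def)
    qed
    have "v j \<le> (\<Sum>i<n. k i)" if j: "j \<in> J" for j
    proof -
      obtain i where i: "i \<in> set_decode j" "i < n" using j by (auto simp: J_def)
      have "v j \<le> (\<Sum>j\<in>I i. v j)" using i j fI by (intro member_le_sum) (auto simp: I_def)
      also have "\<dots> = k i" by (rule sumv[OF i(2)])
      also have "\<dots> \<le> (\<Sum>i<n. k i)" using i by (intro member_le_sum) auto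
      finally show ?thesis .
    qed
    then have "v \<in> S" using sumv by (auto simp: S_def v_def)
    have "indicator (counts C J w) y = (if w = v then 1 else 0 :: ennreal)" if "w \<in> S" for w
    proof -
      have "y \<in> counts C J w \<longleftrightarrow> w = v"
        using that y by (auto simp: counts_def v_def S_def PiE_def extensional_def restrict_def fun_eq_iff)
      then show ?thesis by (simp add: indicator_def)
    qed
    then have "(\<Sum>w\<in>S. indicator (counts C J w) y :: ennreal) = 1"
      using \<open>v \<in> S\<close> fS by (simp cong: sum.cong)
    then show ?thesis using True by simp
  next
    case False
    have "y \<notin> counts C J v" if v: "v \<in> S" for v
    proof
      assume y: "y \<in> counts C J v"
      have "card (y \<inter> B i) = k i" if "i < n" for i
      proof -
        have "card (y \<inter> B i) = (\<Sum>j\<in>I i. card (y \<inter> C j))" using y that by (intro cardB) (auto simp: counts_def)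
        also have "\<dots> = (\<Sum>j\<in>I i. v j)" using y IJ[of i] by (intro sum.cong) (auto simp: counts_def)
        finally show ?thesis using v that by (simp add: S_def)
      qed
      then show False using False y by (simp add: counts_def)
    qed
    then show ?thesis using False by simp
  qed
  have ind0: "indicator (B 0) K = (\<Sum>j\<in>I 0. indicator (C j) K :: ennreal)" for K
    unfolding BC[OF n] using disj IJ[of 0] fI[of 0]
    by (intro indicator_UN_disjoint) (auto intro: disjoint_family_on_mono)
  have mC: "(\<lambda>y. \<integral>\<^sup>+K. indicator (C j) K * indicator (counts C J v) (y - {K}) \<partial>count_space y) \<in> borel_measurable \<Psi>" for j v
  proof -
    have [measurable]: "counts C J v \<in> sets configs" by (rule sets_counts[OF fJ C1 C2])
    have [measurable]: "C j \<in> sets particles" by (rule C1)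
    have "(\<lambda>p. indicator (C j) (fst p) * indicator (counts C J v) (snd p) :: ennreal) \<in> borel_measurable (particles \<Otimes>\<^sub>M configs)"
      by measurable
    from measurable_removed[OF this] show ?thesis by (simp cong: measurable_cong_sets add: ss)
  qed
  have "(\<integral>\<^sup>+y. (\<integral>\<^sup>+K. indicator (B 0) K * indicator (counts B {..<n} k) (y - {K}) \<partial>count_space y) \<partial>\<Psi>)
    = (\<integral>\<^sup>+y. (\<Sum>j\<in>I 0. \<Sum>v\<in>S. \<integral>\<^sup>+K. indicator (C j) K * indicator (counts C J v) (y - {K}) \<partial>count_space y) \<partial>\<Psi>)"
    by (simp add: ind ind0 sum_product nn_integral_sum)
  also have "\<dots> = (\<Sum>j\<in>I 0. \<Sum>v\<in>S. \<integral>\<^sup>+y. (\<integral>\<^sup>+K. indicator (C j) K * indicator (counts C J v) (y - {K}) \<partial>count_space y) \<partial>\<Psi>)"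
    using mC by (simp add: nn_integral_sum)
  also have "\<dots> = (\<Sum>j\<in>I 0. \<Sum>v\<in>S. emeasure \<Lambda> (C j) * emeasure \<Psi> (counts C J v))"
    using IJ[of 0] by (intro sum.cong refl poisson_mecke_atom[OF P fJ _ C1 C2 disj]) auto
  also have "\<dots> = (\<Sum>j\<in>I 0. emeasure \<Lambda> (C j)) * (\<Sum>v\<in>S. emeasure \<Psi> (counts C J v))"
    by (simp add: sum_product)
  also have "(\<Sum>j\<in>I 0. emeasure \<Lambda> (C j)) = emeasure \<Lambda> (B 0)"
    unfolding BC[OF n] using disj IJ[of 0] fI[of 0] C1
    by (intro sum_emeasure) (auto simp: sL intro: disjoint_family_on_mono)
  also have "(\<Sum>v\<in>S. emeasure \<Psi> (counts C J v)) = emeasure \<Psi> (counts B {..<n} k)"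
  proof -
    have "(\<Sum>v\<in>S. emeasure \<Psi> (counts C J v)) = (\<integral>\<^sup>+y. (\<Sum>v\<in>S. indicator (counts C J v) y) \<partial>\<Psi>)"
      using sets_counts[OF fJ C1 C2] by (subst nn_integral_sum) (auto simp: ss)
    also have "\<dots> = (\<integral>\<^sup>+y. indicator (counts B {..<n} k) y \<partial>\<Psi>)" by (simp add: ind)
    also have "\<dots> = emeasure \<Psi> (counts B {..<n} k)"
      using sets_counts[of "{..<n}" B k] B by (subst nn_integral_indicator) (auto simp: ss)
    finally show ?thesis .
  qed
  finally show ?thesis .
qed

text \<open>A generator of \<open>configs\<close> that is closed under intersection: two lists of
  conditions are concatenated, so the sets in a list have to be allowed to overlap.\<close>

definition count_events :: "'a::euclidean_space set set set set" where
  "count_events = {counts B {..<n} k | B n k. \<forall>i<n. B i \<in> sets particles \<and> hausdorff_bounded (B i)}"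

lemma count_events_sets: "count_events \<subseteq> sets (configs :: 'a::euclidean_space set set measure)"
  by (auto simp: count_events_def intro!: sets_counts)

lemma space_in_count_events: "space configs \<in> count_events"
  unfolding count_events_def by (intro CollectI exI[of _ "\<lambda>_. {}"] exI[of _ "0::nat"]) (auto simp: counts_def)

lemma Int_stable_count_events: "Int_stable (count_events :: 'a::euclidean_space set set set set)"
proof (rule Int_stableI)
  fix X Y :: "'a set set set" assume "X \<in> count_events" "Y \<in> count_events"
  then obtain B n k C m l where X: "X = counts B {..<n} k" "\<forall>i<n. B i \<in> sets particles \<and> hausdorff_bounded (B i)"
    and Y: "Y = counts C {..<m} l" "\<forall>i<m. C i \<in> sets particles \<and> hausdorff_bounded (C i)"
    unfolding count_events_def by blast
  define D where "D i = (if i < n then B i else C (i - n))" for i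
  define h where "h i = (if i < n then k i else l (i - n))" for i
  have "(\<forall>i<n + m. card (y \<inter> D i) = h i) \<longleftrightarrow> (\<forall>i<n. card (y \<inter> B i) = k i) \<and> (\<forall>i<m. card (y \<inter> C i) = l i)" for y
  proof (intro iffI conjI allI impI)
    fix i assume *: "\<forall>i<n + m. card (y \<inter> D i) = h i"
    show "card (y \<inter> B i) = k i" if "i < n" using *[rule_format, of i] that by (simp add: D_def h_def)
    show "card (y \<inter> C i) = l i" if "i < m" using *[rule_format, of "n + i"] that by (simp add: D_def h_def)
  next
    fix i assume *: "(\<forall>i<n. card (y \<inter> B i) = k i) \<and> (\<forall>i<m. card (y \<inter> C i) = l i)" "i < n + m"
    then show "card (y \<inter> D i) = h i" by (cases "i < n") (auto simp: D_def h_def)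
  qed
  then have "X \<inter> Y = counts D {..<n + m} h" by (auto simp: X Y counts_def)
  moreover have "\<forall>i<n + m. D i \<in> sets particles \<and> hausdorff_bounded (D i)"
    using X(2) Y(2) by (auto simp: D_def)
  ultimately show "X \<inter> Y \<in> count_events" unfolding count_events_def by blast
qed

lemma sets_configs_count_events:
  "sets configs = sigma_sets (space configs) (count_events :: 'a::euclidean_space set set set set)"
proof
  interpret S: sigma_algebra "space configs" "sigma_sets (space configs) (count_events :: 'a set set set set)"
    using count_events_sets sets.space_closed by (intro sigma_algebra_sigma_sets) blast
  show "sets configs \<subseteq> sigma_sets (space configs) (count_events :: 'a set set set set)"
    unfolding sets_configs space_configs
  proof (rule sigma_sets_mono, rule subsetI)
    fix Y :: "'a set set set"
    assume "Y \<in> {(\<lambda>x. card (x \<inter> B)) -` A \<inter> {x. locally_finite_config x} | A B.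
          B \<in> sets compacts \<and> hausdorff_bounded B}"
    then obtain A B where Y: "Y = (\<lambda>x. card (x \<inter> B)) -` A \<inter> {x. locally_finite_config x}"
      and B: "B \<in> sets compacts" "hausdorff_bounded B" by blast
    define C where "C = B \<inter> space particles"
    have C: "C \<in> sets particles"
      using B(1) nonempty_in_compacts by (auto simp: C_def sets_particles_iff space_particles)
    have bC: "hausdorff_bounded C" by (rule hausdorff_bounded_subset[OF B(2)]) (auto simp: C_def)
    have "x \<inter> B = x \<inter> C" if "x \<in> space configs" for x
      using config_particles[OF that] by (auto simp: C_def)
    then have "Y = (\<Union>c\<in>A. counts (\<lambda>_. C) {..<1} (\<lambda>_. c))"
      by (auto simp: Y counts_def space_configs)
    also have "\<dots> \<in> sigma_sets (space configs) count_events"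
    proof (intro S.countable_UN' image_subsetI sigma_sets.Basic)
      fix c show "counts (\<lambda>_. C) {..<1} (\<lambda>_. c) \<in> count_events"
        unfolding count_events_def using C bC by blast
    qed auto
    finally show "Y \<in> sigma_sets {x. locally_finite_config x} count_events" by (simp add: space_configs)
  qed
  show "sigma_sets (space configs) (count_events :: 'a set set set set) \<subseteq> sets configs"
    using count_events_sets by (rule sets.sigma_sets_subset)
qed

text \<open>As a function of E, the left side is a measure on pairs of a particle and the remaining
  configuration. It agrees with the product measure on the intersection-stable class of rectangles a
  \<times> b with b a count event; the window makes the total mass finite, as uniqueness
  requires.\<close>

lemma nn_integral_removed_window:
  fixes \<Psi> :: "'a::euclidean_space set set measure"
  assumes P: "poisson_law \<Lambda> \<Psi>" and sL [measurable_cong]: "sets \<Lambda> = sets particles"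
    and E: "E \<in> sets (particles \<Otimes>\<^sub>M configs)"
  shows "(\<integral>\<^sup>+y. (\<integral>\<^sup>+K. indicator (window m) K * indicator E (K, y - {K}) \<partial>count_space y) \<partial>\<Psi>)
    = emeasure (density \<Lambda> (indicator (window m)) \<Otimes>\<^sub>M \<Psi>) E"
proof -
  interpret \<Psi>: prob_space \<Psi> by (rule poisson_lawD(1)[OF P])
  note sp = poisson_lawD(3)[OF P] and ss [measurable_cong] = poisson_lawD(2)[OF P]
  define W where "W = density \<Lambda> (indicator (window m))"
  have sW [measurable_cong]: "sets W = sets particles" by (simp add: W_def sL)
  define \<nu> where "\<nu> E = (\<integral>\<^sup>+y. (\<integral>\<^sup>+K. indicator (window m) K * indicator E (K, y - {K}) \<partial>count_space y) \<partial>\<Psi>)"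
    for E :: "('a set \<times> 'a set set) set"
  define PC where "PC = (particles \<Otimes>\<^sub>M configs :: ('a set \<times> 'a set set) measure)"
  define N where "N = measure_of (space PC) (sets PC) \<nu>"
  have m: "(\<lambda>y. \<integral>\<^sup>+K. indicator (window m) K * indicator E (K, y - {K}) \<partial>count_space y) \<in> borel_measurable \<Psi>"
    if [measurable]: "E \<in> sets PC" for E
  proof -
    have "(\<lambda>p. indicator (window m) (fst p) * indicator E p :: ennreal) \<in> borel_measurable PC"
      unfolding PC_def using that[unfolded PC_def] by measurable
    from measurable_removed[OF this[unfolded PC_def]] show ?thesis by (simp cong: measurable_cong_sets add: ss)
  qed
  have eN: "emeasure N E = \<nu> E" if "E \<in> sets PC" for E
    unfolding N_def
  proof (rule emeasure_measure_of_sigma)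
    show "countably_additive (sets PC) \<nu>"
    proof (rule countably_additiveI)
      fix A :: "nat \<Rightarrow> ('a set \<times> 'a set set) set" assume A: "range A \<subseteq> sets PC" "disjoint_family A"
      have "(\<Sum>i. \<nu> (A i)) = (\<integral>\<^sup>+y. (\<Sum>i. \<integral>\<^sup>+K. indicator (window m) K * indicator (A i) (K, y - {K}) \<partial>count_space y) \<partial>\<Psi>)"
        unfolding \<nu>_def using A(1) m by (intro nn_integral_suminf[symmetric]) auto
      also have "\<dots> = (\<integral>\<^sup>+y. (\<integral>\<^sup>+K. (\<Sum>i. indicator (window m) K * indicator (A i) (K, y - {K})) \<partial>count_space y) \<partial>\<Psi>)"
        by (intro nn_integral_cong nn_integral_suminf[symmetric]) auto
      also have "\<dots> = \<nu> (\<Union>i. A i)"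
        by (simp add: \<nu>_def ennreal_suminf_cmult suminf_indicator[OF A(2)])
      finally show "(\<Sum>i. \<nu> (A i)) = \<nu> (\<Union>i. A i)" .
    qed
  qed (use that in \<open>auto simp: positive_def \<nu>_def sets.sigma_algebra_axioms\<close>)
  define G where "G = {a \<times> b | a b. a \<in> sets (particles :: 'a set measure) \<and> b \<in> (count_events :: 'a set set set set)}"
  have G_Pow: "G \<subseteq> Pow (space particles \<times> space configs)"
  proof
    fix X assume "X \<in> G"
    then obtain a b where X: "X = a \<times> b" "a \<in> sets particles" "b \<in> count_events" by (auto simp: G_def)
    then have "a \<subseteq> space particles" "b \<subseteq> space configs"
      using count_events_sets sets.sets_into_space by blast+
    then show "X \<in> Pow (space particles \<times> space configs)" using X(1) by blast
  qed
  have sets_PC: "sets PC = sigma_sets (space particles \<times> space configs) G"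
  proof -
    have "sets PC = sets (sigma (space particles \<times> space configs) G)"
      unfolding PC_def G_def
    proof (rule sets_pair_eq)
      show "sets (particles :: 'a set measure) = sigma_sets (space particles) (sets particles)"
        by (simp add: sets.sigma_sets_eq)
      show "{space particles} \<subseteq> sets (particles :: 'a set measure)" by auto
      show "{space configs} \<subseteq> (count_events :: 'a set set set set)" using space_in_count_events by simp
      show "count_events \<subseteq> Pow (space (configs :: 'a set set measure))"
        using count_events_sets sets.space_closed by blast
    qed (auto simp: sets_configs_count_events sets.space_closed)
    also have "\<dots> = sigma_sets (space particles \<times> space configs) G"
      using G_Pow by (rule sets_measure_of)
    finally show ?thesis .
  qed
  have fin: "emeasure \<Lambda> (window m) < \<infinity>" by (rule poisson_lawD(4)[OF P sets_window hausdorff_bounded_window])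
  have W_emeasure: "emeasure W a = emeasure \<Lambda> (a \<inter> window m)" if a: "a \<in> sets particles" for a
  proof -
    have "emeasure W a = (\<integral>\<^sup>+K. indicator (window m) K * indicator a K \<partial>\<Lambda>)"
      unfolding W_def using sets_window a by (intro emeasure_density borel_measurable_indicator) (auto simp: sL)
    also have "\<dots> = (\<integral>\<^sup>+K. indicator (a \<inter> window m) K \<partial>\<Lambda>)"
      by (intro nn_integral_cong) (auto simp: indicator_def)
    also have "\<dots> = emeasure \<Lambda> (a \<inter> window m)" using a sets_window by (intro nn_integral_indicator) (auto simp: sL)
    finally show ?thesis .
  qed
  have eq: "emeasure N (a \<times> b) = emeasure W a * emeasure \<Psi> b"
    if a [measurable]: "a \<in> sets particles" and b: "b \<in> count_events" for a b
  proof -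
    obtain B n k where b': "b = counts B {..<n} k" "\<forall>i<n. B i \<in> sets particles \<and> hausdorff_bounded (B i)"
      using b by (auto simp: count_events_def)
    have [measurable]: "b \<in> sets configs" using b count_events_sets by blast
    \<comment> \<open>\<open>poisson_mecke_counts\<close> draws the particle from the first set of
      the list. So a \<inter> window m is put in front, and b is cut into countably many disjoint
      pieces by the number c of particles in that set.\<close>
    define B' where "B' i = (case i of 0 \<Rightarrow> a \<inter> window m | Suc i \<Rightarrow> B i)" for i
    define k' where "k' c i = (case i of 0 \<Rightarrow> c | Suc i \<Rightarrow> k i)" for c i
    define b'' where "b'' c = counts B' {..<Suc n} (k' c)" for c
    have B': "B' i \<in> sets particles" "hausdorff_bounded (B' i)" if "i < Suc n" for i
      using b'(2) that hausdorff_bounded_subset[OF hausdorff_bounded_window, of "a \<inter> window m" m]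
      by (auto simp: B'_def split: nat.splits)
    have un: "b = (\<Union>c. b'' c)"
      by (auto simp: b'(1) b''_def counts_def B'_def k'_def less_Suc_eq_0_disj All_less_Suc2 split: nat.splits)
    have dis: "disjoint_family b''"
    proof -
      have "c = d" if "y \<in> b'' c" "y \<in> b'' d" for c d y
      proof -
        have "card (y \<inter> B' 0) = k' c 0" "card (y \<inter> B' 0) = k' d 0" using that by (auto simp: b''_def counts_def)
        then show ?thesis by (simp add: k'_def)
      qed
      then show ?thesis by (auto simp: disjoint_family_on_def)
    qed
    have sb: "b'' c \<in> sets configs" for c unfolding b''_def by (rule sets_counts) (use B' in auto)
    have "a \<times> b = (\<Union>c. a \<times> b'' c)" using un by auto
    then have "emeasure N (a \<times> b) = emeasure N (\<Union>c. a \<times> b'' c)" by (rule arg_cong)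
    also have "\<dots> = (\<Sum>c. emeasure N (a \<times> b'' c))"
    proof (rule suminf_emeasure[symmetric])
      have sN: "sets N = sets PC" by (simp add: N_def sets.sigma_sets_eq)
      show "range (\<lambda>c. a \<times> b'' c) \<subseteq> sets N" using sb a unfolding sN by (auto simp: PC_def)
      show "disjoint_family (\<lambda>c. a \<times> b'' c)" using dis by (auto simp: disjoint_family_on_def)
    qed
    also have "\<dots> = (\<Sum>c. emeasure \<Lambda> (a \<inter> window m) * emeasure \<Psi> (b'' c))"
    proof (rule arg_cong[where f=suminf], rule ext)
      fix c
      have "emeasure N (a \<times> b'' c) = \<nu> (a \<times> b'' c)" by (rule eN) (use sb a in \<open>auto simp: PC_def\<close>)
      also have "\<dots> = (\<integral>\<^sup>+y. (\<integral>\<^sup>+K. indicator (B' 0) K * indicator (b'' c) (y - {K}) \<partial>count_space y) \<partial>\<Psi>)"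
        unfolding \<nu>_def by (intro nn_integral_cong) (auto simp: indicator_def B'_def)
      also have "\<dots> = emeasure \<Lambda> (B' 0) * emeasure \<Psi> (b'' c)"
        unfolding b''_def by (rule poisson_mecke_counts[OF P sL _ B']) auto
      finally show "emeasure N (a \<times> b'' c) = emeasure \<Lambda> (a \<inter> window m) * emeasure \<Psi> (b'' c)" by (simp add: B'_def)
    qed
    also have "\<dots> = emeasure \<Lambda> (a \<inter> window m) * emeasure \<Psi> b"
      using sb by (subst ennreal_suminf_cmult, subst suminf_emeasure) (auto simp: ss un dis)
    also have "emeasure \<Lambda> (a \<inter> window m) = emeasure W a"
      by (rule W_emeasure[OF a, symmetric])
    finally show ?thesis .
  qed
  have sN: "sets N = sets PC" by (simp add: N_def sets.sigma_sets_eq)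
  have "N = W \<Otimes>\<^sub>M \<Psi>"
  proof (rule measure_eqI_generator_eq[where \<Omega>="space particles \<times> space configs" and E=G and A="\<lambda>_. space particles \<times> space configs"])
    show "Int_stable G"
      unfolding G_def Int_stable_def
    proof safe
      fix a a' :: "'a set set" and b b' :: "'a set set set"
      assume "a \<in> sets particles" "a' \<in> sets particles" "b \<in> count_events" "b' \<in> count_events"
      then show "\<exists>c d. a \<times> b \<inter> a' \<times> b' = c \<times> d \<and> c \<in> sets particles \<and> d \<in> count_events"
        using Int_stable_count_events
        by (intro exI[of _ "a \<inter> a'"] exI[of _ "b \<inter> b'"]) (auto simp: Int_stable_def)
    qed
    show "G \<subseteq> Pow (space particles \<times> space configs)" by (rule G_Pow)
    show "sets N = sigma_sets (space particles \<times> space configs) G" by (simp add: sN sets_PC)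
    have "sets (W \<Otimes>\<^sub>M \<Psi>) = sets PC" unfolding PC_def by (rule sets_pair_measure_cong[OF sW ss])
    then show "sets (W \<Otimes>\<^sub>M \<Psi>) = sigma_sets (space particles \<times> space configs) G" by (simp add: sets_PC)
    show "range (\<lambda>_. space particles \<times> space configs) \<subseteq> G"
      using space_in_count_events by (auto simp: G_def)
    fix X assume "X \<in> G"
    then obtain a b where X: "X = a \<times> b" "a \<in> sets particles" "b \<in> count_events" by (auto simp: G_def)
    then have "b \<in> sets \<Psi>" "a \<in> sets W" using count_events_sets ss sW by auto
    then show "emeasure N X = emeasure (W \<Otimes>\<^sub>M \<Psi>) X"
      using eq[OF X(2,3)] by (simp add: X(1) \<Psi>.emeasure_pair_measure_Times)
  next
    fix i :: nat
    have "emeasure N (space particles \<times> space configs) = emeasure W (space particles) * emeasure \<Psi> (space configs)"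
      by (rule eq[OF sets.top space_in_count_events])
    also have "\<dots> = emeasure \<Lambda> (window m)"
      using sets.sets_into_space[OF sets_window[of m]] \<Psi>.emeasure_space_1
      by (simp add: W_emeasure sp Int_absorb1)
    finally show "emeasure N (space particles \<times> space configs) \<noteq> \<infinity>" using fin by simp
  qed auto
  then show ?thesis using eN[of E] E by (simp add: PC_def \<nu>_def W_def)
qed

text \<open>Linearity and monotone convergence pass from indicators to all nonnegative f while the
  particle stays in a window; a second monotone limit removes the window.\<close>

theorem poisson_mecke:
  fixes \<Psi> :: "'a::euclidean_space set set measure"
  assumes P: "poisson_law \<Lambda> \<Psi>" and sL [measurable_cong]: "sets \<Lambda> = sets particles"
    and f: "f \<in> borel_measurable (particles \<Otimes>\<^sub>M configs)"
  shows "(\<integral>\<^sup>+y. (\<integral>\<^sup>+K. f (K, y - {K}) \<partial>count_space y) \<partial>\<Psi>) = (\<integral>\<^sup>+K. (\<integral>\<^sup>+y. f (K, y) \<partial>\<Psi>) \<partial>\<Lambda>)"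
proof -
  interpret \<Psi>: prob_space \<Psi> by (rule poisson_lawD(1)[OF P])
  note sp = poisson_lawD(3)[OF P] and ss [measurable_cong] = poisson_lawD(2)[OF P]
  define W where "W m = density \<Lambda> (indicator (window m))" for m
  have sW [measurable_cong]: "sets (W m) = sets particles" for m by (simp add: W_def sL)
  have m: "(\<lambda>y. \<integral>\<^sup>+K. indicator (window m) K * h (K, y - {K}) \<partial>count_space y) \<in> borel_measurable \<Psi>"
    if [measurable]: "h \<in> borel_measurable (particles \<Otimes>\<^sub>M configs)" for h m
  proof -
    have "(\<lambda>p. indicator (window m) (fst p) * h p :: ennreal) \<in> borel_measurable (particles \<Otimes>\<^sub>M configs)"
      by measurable
    from measurable_removed[OF this] show ?thesis by (simp cong: measurable_cong_sets add: ss)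
  qed
  have window: "(\<integral>\<^sup>+y. (\<integral>\<^sup>+K. indicator (window m) K * f (K, y - {K}) \<partial>count_space y) \<partial>\<Psi>) = (\<integral>\<^sup>+p. f p \<partial>(W m \<Otimes>\<^sub>M \<Psi>))" for m
    using f
  proof (induction f rule: borel_measurable_induct)
    case (cong f h)
    have "(K, y - {K}) \<in> space (particles \<Otimes>\<^sub>M configs)" if "y \<in> space \<Psi>" "K \<in> y" for y K
      using that config_particles[of y] config_subset[of y "y - {K}"] by (auto simp: sp space_pair_measure)
    then have "(\<integral>\<^sup>+y. (\<integral>\<^sup>+K. indicator (window m) K * f (K, y - {K}) \<partial>count_space y) \<partial>\<Psi>)
      = (\<integral>\<^sup>+y. (\<integral>\<^sup>+K. indicator (window m) K * h (K, y - {K}) \<partial>count_space y) \<partial>\<Psi>)"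
      using cong(3) by (intro nn_integral_cong) auto
    moreover have "(\<integral>\<^sup>+p. f p \<partial>(W m \<Otimes>\<^sub>M \<Psi>)) = (\<integral>\<^sup>+p. h p \<partial>(W m \<Otimes>\<^sub>M \<Psi>))"
      by (intro nn_integral_cong cong(3))
         (simp add: space_pair_measure sp sets_eq_imp_space_eq[OF sW])
    ultimately show ?case using cong by simp
  next
    case (set E)
    then have "E \<in> sets (W m \<Otimes>\<^sub>M \<Psi>)" using sets_pair_measure_cong[OF sW ss] by simp
    then show ?case using nn_integral_removed_window[OF P sL set] by (simp add: W_def)
  next
    case (mult u c)
    have mu [measurable]: "u \<in> borel_measurable (particles \<Otimes>\<^sub>M configs)" by fact
    have "(\<integral>\<^sup>+y. (\<integral>\<^sup>+K. indicator (window m) K * (c * u (K, y - {K})) \<partial>count_space y) \<partial>\<Psi>)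
      = (\<integral>\<^sup>+y. c * (\<integral>\<^sup>+K. indicator (window m) K * u (K, y - {K}) \<partial>count_space y) \<partial>\<Psi>)"
      by (simp add: nn_integral_cmult[symmetric] mult.left_commute)
    also have "\<dots> = c * (\<integral>\<^sup>+p. u p \<partial>(W m \<Otimes>\<^sub>M \<Psi>))"
      using m[OF mu] mult by (simp add: nn_integral_cmult)
    also have "\<dots> = (\<integral>\<^sup>+p. c * u p \<partial>(W m \<Otimes>\<^sub>M \<Psi>))"
      by (rule nn_integral_cmult[symmetric]) measurable
    finally show ?case .
  next
    case (add u v)
    have mu [measurable]: "u \<in> borel_measurable (particles \<Otimes>\<^sub>M configs)" "v \<in> borel_measurable (particles \<Otimes>\<^sub>M configs)" by fact+
    have "(\<integral>\<^sup>+y. (\<integral>\<^sup>+K. indicator (window m) K * (v (K, y - {K}) + u (K, y - {K})) \<partial>count_space y) \<partial>\<Psi>)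
      = (\<integral>\<^sup>+y. (\<integral>\<^sup>+K. indicator (window m) K * v (K, y - {K}) \<partial>count_space y)
           + (\<integral>\<^sup>+K. indicator (window m) K * u (K, y - {K}) \<partial>count_space y) \<partial>\<Psi>)"
      by (simp add: nn_integral_add[symmetric] distrib_left)
    also have "\<dots> = (\<integral>\<^sup>+p. v p \<partial>(W m \<Otimes>\<^sub>M \<Psi>)) + (\<integral>\<^sup>+p. u p \<partial>(W m \<Otimes>\<^sub>M \<Psi>))"
      using m[OF mu(1)] m[OF mu(2)] add by (simp add: nn_integral_add)
    also have "\<dots> = (\<integral>\<^sup>+p. v p + u p \<partial>(W m \<Otimes>\<^sub>M \<Psi>))"
      by (rule nn_integral_add[symmetric]) measurable
    finally show ?case .
  next
    case (seq U)
    have mu [measurable]: "U i \<in> borel_measurable (particles \<Otimes>\<^sub>M configs)" for i by fact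
    have le: "U i p \<le> U (Suc i) p" for i p by (rule le_funD[OF incseq_SucD[OF \<open>incseq U\<close>]])
    have "(\<integral>\<^sup>+y. (\<integral>\<^sup>+K. indicator (window m) K * (SUP i. U i) (K, y - {K}) \<partial>count_space y) \<partial>\<Psi>)
      = (\<integral>\<^sup>+y. (\<integral>\<^sup>+K. (SUP i. indicator (window m) K * U i (K, y - {K})) \<partial>count_space y) \<partial>\<Psi>)"
      by (simp add: SUP_mult_left_ennreal image_comp)
    also have "\<dots> = (\<integral>\<^sup>+y. (SUP i. \<integral>\<^sup>+K. indicator (window m) K * U i (K, y - {K}) \<partial>count_space y) \<partial>\<Psi>)"
      by (intro nn_integral_cong nn_integral_monotone_convergence_SUP incseq_SucI le_funI mult_left_mono le) auto
    also have "\<dots> = (SUP i. \<integral>\<^sup>+y. (\<integral>\<^sup>+K. indicator (window m) K * U i (K, y - {K}) \<partial>count_space y) \<partial>\<Psi>)"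
      by (intro nn_integral_monotone_convergence_SUP incseq_SucI le_funI nn_integral_mono mult_left_mono le m) auto
    also have "\<dots> = (SUP i. \<integral>\<^sup>+p. U i p \<partial>(W m \<Otimes>\<^sub>M \<Psi>))" by (simp only: seq.IH)
    also have "\<dots> = (\<integral>\<^sup>+p. (SUP i. U i p) \<partial>(W m \<Otimes>\<^sub>M \<Psi>))"
      by (rule nn_integral_monotone_convergence_SUP[symmetric]) (use \<open>incseq U\<close> in auto)
    also have "\<dots> = (\<integral>\<^sup>+p. (SUP i. U i) p \<partial>(W m \<Otimes>\<^sub>M \<Psi>))" by (simp add: image_comp)
    finally show ?case .
  qed
  note [measurable] = f
  have le: "indicator (window m) K \<le> (indicator (window (Suc m)) K :: ennreal)" for m and K :: "'a set"
    using incseq_SucD[OF incseq_window, of m] by (auto simp: indicator_def)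
  have "(\<integral>\<^sup>+y. (\<integral>\<^sup>+K. f (K, y - {K}) \<partial>count_space y) \<partial>\<Psi>)
    = (\<integral>\<^sup>+y. (SUP m. \<integral>\<^sup>+K. indicator (window m) K * f (K, y - {K}) \<partial>count_space y) \<partial>\<Psi>)"
    by (intro nn_integral_cong)
       (simp add: sp nn_integral_config_SUP nn_integral_count_space_restrict mult.commute)
  also have "\<dots> = (SUP m. \<integral>\<^sup>+y. (\<integral>\<^sup>+K. indicator (window m) K * f (K, y - {K}) \<partial>count_space y) \<partial>\<Psi>)"
    by (intro nn_integral_monotone_convergence_SUP incseq_SucI le_funI nn_integral_mono mult_right_mono le m f) auto
  also have "\<dots> = (SUP m. \<integral>\<^sup>+K. indicator (window m) K * (\<integral>\<^sup>+y. f (K, y) \<partial>\<Psi>) \<partial>\<Lambda>)"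
  proof (rule arg_cong[where f=Sup], rule image_cong[OF refl])
    fix m
    have "(\<integral>\<^sup>+p. f p \<partial>(W m \<Otimes>\<^sub>M \<Psi>)) = (\<integral>\<^sup>+K. (\<integral>\<^sup>+y. f (K, y) \<partial>\<Psi>) \<partial>W m)"
      by (rule \<Psi>.nn_integral_fst[symmetric]) measurable
    also have "\<dots> = (\<integral>\<^sup>+K. indicator (window m) K * (\<integral>\<^sup>+y. f (K, y) \<partial>\<Psi>) \<partial>\<Lambda>)"
      unfolding W_def by (rule nn_integral_density) measurable
    finally show "(\<integral>\<^sup>+y. (\<integral>\<^sup>+K. indicator (window m) K * f (K, y - {K}) \<partial>count_space y) \<partial>\<Psi>)
      = (\<integral>\<^sup>+K. indicator (window m) K * (\<integral>\<^sup>+y. f (K, y) \<partial>\<Psi>) \<partial>\<Lambda>)"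
      unfolding window .
  qed
  also have "\<dots> = (\<integral>\<^sup>+K. (SUP m. indicator (window m) K * (\<integral>\<^sup>+y. f (K, y) \<partial>\<Psi>)) \<partial>\<Lambda>)"
    by (rule nn_integral_monotone_convergence_SUP[symmetric])
       (auto intro!: incseq_SucI le_funI mult_right_mono le, measurable)
  also have "\<dots> = (\<integral>\<^sup>+K. (\<integral>\<^sup>+y. f (K, y) \<partial>\<Psi>) \<partial>\<Lambda>)"
  proof (rule nn_integral_cong)
    fix K assume "K \<in> space \<Lambda>"
    then have "K \<in> (\<Union>m. window m)" using sets_eq_imp_space_eq[OF sL] by (simp add: UN_window)
    then obtain m where "K \<in> window m" by blast
    then have "(1::ennreal) \<le> (SUP m. indicator (window m) K)" by (intro SUP_upper2[of m]) auto
    moreover have "(SUP m. indicator (window m) K) \<le> (1::ennreal)" by (intro SUP_least) (auto simp: indicator_def)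
    ultimately have "(SUP m. indicator (window m) K) = (1::ennreal)" by (rule antisym[rotated])
    then show "(SUP m. indicator (window m) K * (\<integral>\<^sup>+y. f (K, y) \<partial>\<Psi>)) = (\<integral>\<^sup>+y. f (K, y) \<partial>\<Psi>)"
      by (simp add: SUP_mult_right_ennreal[symmetric])
  qed
  finally show ?thesis .
qed

subsection \<open>Energies and Gibbs weights\<close>

definition interacting_pairs :: "'a::euclidean_space set \<Rightarrow> 'a set set \<Rightarrow> 'a set set set" where
  "interacting_pairs \<Delta> x = {{K, L} | K L. K \<in> x \<and> L \<in> x \<and> K \<noteq> L \<and> (circumcentre K \<in> \<Delta> \<or> circumcentre L \<in> \<Delta>)}"

lemma energy_interacting_pairs: "energy g \<Delta> x = (\<Sum>\<^sub>\<infinity>p\<in>interacting_pairs \<Delta> x. g (\<Inter>p))"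
  by (simp add: energy_def interacting_pairs_def)

lemma pair_potential_nonneg: "pair_potential g \<Longrightarrow> compact K \<Longrightarrow> 0 \<le> g K"
  and pair_potential_empty: "pair_potential g \<Longrightarrow> g {} = 0"
  by (auto simp: pair_potential_def)

text \<open>Double sums over a configuration run over ordered pairs and so meet each unordered pair
  of the energy twice. Pairs with zero interaction are left out to obtain a finite set.\<close>

definition ordered_pairs :: "('a::euclidean_space set \<Rightarrow> real) \<Rightarrow> 'a set \<Rightarrow> 'a set set \<Rightarrow> ('a set \<times> 'a set) set" where
  "ordered_pairs g \<Delta> x = {(K, L). K \<in> x \<and> L \<in> x \<and> K \<noteq> L \<and> (circumcentre K \<in> \<Delta> \<or> circumcentre L \<in> \<Delta>) \<and> g (K \<inter> L) \<noteq> 0}"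

lemma finite_interactions:
  fixes x :: "'a::euclidean_space set set"
  assumes x: "x \<in> space configs" and g: "pair_potential g" and K: "compact K"
  shows "finite {L\<in>x. g (K \<inter> L) \<noteq> 0}"
  by (rule finite_subset[OF _ config_finite_hits[OF x K]]) (use pair_potential_empty[OF g] in \<open>auto simp: Int_commute\<close>)

text \<open>One partner has its centre in \<Delta>, which leaves finitely many choices; the other
  interacts with it, hence meets it because g vanishes at the empty set, and local finiteness
  applies.\<close>

lemma finite_ordered_pairs:
  fixes x :: "'a::euclidean_space set set"
  assumes x: "x \<in> space configs" and fin: "finite (inside \<Delta> x)" and g: "pair_potential g"
  shows "finite (ordered_pairs g \<Delta> x)"
proof (rule finite_subset)
  let ?F = "\<lambda>K. {L\<in>x. g (K \<inter> L) \<noteq> 0}"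
  have cpt: "compact K" if "K \<in> inside \<Delta> x" for K
    using config_particles[OF x] that by (auto simp: inside_def in_space_particles)
  show "finite ((\<Union>K\<in>inside \<Delta> x. {K} \<times> ?F K) \<union> (\<Union>K\<in>inside \<Delta> x. ?F K \<times> {K}))"
    using fin finite_interactions[OF x g cpt] by auto
  show "ordered_pairs g \<Delta> x \<subseteq> (\<Union>K\<in>inside \<Delta> x. {K} \<times> ?F K) \<union> (\<Union>K\<in>inside \<Delta> x. ?F K \<times> {K})"
    by (auto simp: ordered_pairs_def inside_def Int_commute)
qed

lemma interacting_pairs_support:
  "{p \<in> interacting_pairs \<Delta> x. g (\<Inter>p) \<noteq> 0} = (\<lambda>(K, L). {K, L}) ` ordered_pairs g \<Delta> x"
proof
  show "{p \<in> interacting_pairs \<Delta> x. g (\<Inter>p) \<noteq> 0} \<subseteq> (\<lambda>(K, L). {K, L}) ` ordered_pairs g \<Delta> x"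
  proof
    fix p assume "p \<in> {p \<in> interacting_pairs \<Delta> x. g (\<Inter>p) \<noteq> 0}"
    then obtain K L where p: "p = {K, L}" "K \<in> x" "L \<in> x" "K \<noteq> L" "circumcentre K \<in> \<Delta> \<or> circumcentre L \<in> \<Delta>" "g (\<Inter>p) \<noteq> 0"
      unfolding interacting_pairs_def by blast
    then have "(K, L) \<in> ordered_pairs g \<Delta> x" by (simp add: ordered_pairs_def)
    then show "p \<in> (\<lambda>(K, L). {K, L}) ` ordered_pairs g \<Delta> x" unfolding p(1) by (rule rev_image_eqI) simp
  qed
  show "(\<lambda>(K, L). {K, L}) ` ordered_pairs g \<Delta> x \<subseteq> {p \<in> interacting_pairs \<Delta> x. g (\<Inter>p) \<noteq> 0}"
    by (auto simp: interacting_pairs_def ordered_pairs_def)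
qed

lemma finite_interacting_support:
  fixes x :: "'a::euclidean_space set set"
  assumes "x \<in> space configs" "finite (inside \<Delta> x)" "pair_potential g"
  shows "finite {p \<in> interacting_pairs \<Delta> x. g (\<Inter>p) \<noteq> 0}"
  unfolding interacting_pairs_support using finite_ordered_pairs[OF assms] by simp

lemma energy_ordered_pairs:
  fixes x :: "'a::euclidean_space set set"
  assumes "x \<in> space configs" "finite (inside \<Delta> x)" "pair_potential g"
  shows "2 * energy g \<Delta> x = (\<Sum>(K, L)\<in>ordered_pairs g \<Delta> x. g (K \<inter> L))"
proof -
  let ?O = "ordered_pairs g \<Delta> x" and ?u = "\<lambda>(K, L). {K, L} :: 'a set set"
  have fO: "finite ?O" by (rule finite_ordered_pairs[OF assms])
  have "energy g \<Delta> x = (\<Sum>\<^sub>\<infinity>p\<in>?u ` ?O. g (\<Inter>p))"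
    unfolding energy_interacting_pairs interacting_pairs_support[symmetric]
    by (rule infsum_cong_neutral) auto
  also have "\<dots> = (\<Sum>p\<in>?u ` ?O. g (\<Inter>p))" using fO by (intro infsum_finite) auto
  finally have e: "energy g \<Delta> x = (\<Sum>p\<in>?u ` ?O. g (\<Inter>p))" .
  have "(\<Sum>q\<in>?O. g (fst q \<inter> snd q)) = (\<Sum>p\<in>?u ` ?O. \<Sum>q\<in>{q\<in>?O. ?u q = p}. g (fst q \<inter> snd q))"
    using fO by (rule sum.image_gen)
  also have "\<dots> = (\<Sum>p\<in>?u ` ?O. 2 * g (\<Inter>p))"
  proof (rule sum.cong[OF refl])
    fix p assume "p \<in> ?u ` ?O"
    then obtain K L where KL: "(K, L) \<in> ?O" "p = {K, L}" by auto
    then have "K \<noteq> L" by (simp add: ordered_pairs_def)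
    have "{q\<in>?O. ?u q = p} = {(K, L), (L, K)}"
    proof (intro equalityI subsetI)
      fix q assume q: "q \<in> {q\<in>?O. ?u q = p}"
      obtain A B where AB: "q = (A, B)" by (rule prod.exhaust)
      then have "{A, B} = {K, L}" using q KL(2) by simp
      then show "q \<in> {(K, L), (L, K)}" unfolding doubleton_eq_iff AB by blast
    next
      fix q assume "q \<in> {(K, L), (L, K)}"
      moreover have "(L, K) \<in> ?O" using KL(1) by (auto simp only: ordered_pairs_def Int_commute mem_Collect_eq prod.case)
      ultimately show "q \<in> {q\<in>?O. ?u q = p}" using KL by (auto simp only: mem_Collect_eq insert_iff insert_commute prod.case)
    qed
    then show "(\<Sum>q\<in>{q\<in>?O. ?u q = p}. g (fst q \<inter> snd q)) = 2 * g (\<Inter>p)"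
      using KL(2) \<open>K \<noteq> L\<close> by (simp add: Int_commute)
  qed
  finally show ?thesis by (simp add: e sum_distrib_left split_beta)
qed

text \<open>Twice the energy, as an iterated sum over particles:
  \<open>measurable_config_sum\<close> applies to it twice, but not to the sum over two-element sets
  in \<open>energy\<close>.\<close>

definition pair_sum :: "('a::euclidean_space set \<Rightarrow> real) \<Rightarrow> 'a set \<Rightarrow> 'a set set \<Rightarrow> ennreal" where
  "pair_sum g \<Delta> x = (\<integral>\<^sup>+K. (\<integral>\<^sup>+L. (if K \<noteq> L \<and> (circumcentre K \<in> \<Delta> \<or> circumcentre L \<in> \<Delta>)
     then ennreal (g (K \<inter> L)) else 0) \<partial>count_space x) \<partial>count_space x)"

lemma energy_pair_sum:
  fixes x :: "'a::euclidean_space set set"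
  assumes x: "x \<in> space configs" and fin: "finite (inside \<Delta> x)" and g: "pair_potential g"
  shows "energy g \<Delta> x = enn2real (pair_sum g \<Delta> x) / 2"
proof -
  let ?O = "ordered_pairs g \<Delta> x"
  have fO: "finite ?O" by (rule finite_ordered_pairs[OF assms])
  \<comment> \<open>F collects the finitely many particles that take part in some interaction; all
    other terms of the double sum vanish.\<close>
  define F where "F = fst ` ?O \<union> snd ` ?O"
  have fF: "finite F" using fO by (auto simp: F_def)
  have Fx: "F \<subseteq> x" by (auto simp: F_def ordered_pairs_def)
  have nn: "0 \<le> g (K \<inter> L)" if "K \<in> x" "L \<in> x" for K L
  proof -
    have "K \<in> space particles" "L \<in> space particles" using config_particles[OF x] that by blast+
    then show ?thesis by (intro pair_potential_nonneg[OF g] compact_Int) (auto simp: in_space_particles)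
  qed
  let ?h = "\<lambda>K L. if K \<noteq> L \<and> (circumcentre K \<in> \<Delta> \<or> circumcentre L \<in> \<Delta>) then ennreal (g (K \<inter> L)) else 0"
  have zero: "?h K L = 0" if "K \<in> x" "L \<in> x" "K \<notin> F \<or> L \<notin> F" for K L
  proof -
    have "(K, L) \<notin> ?O" using that by (force simp: F_def)
    then show ?thesis using that by (auto simp: ordered_pairs_def)
  qed
  have "pair_sum g \<Delta> x = (\<integral>\<^sup>+K. (\<Sum>L\<in>F. ?h K L) \<partial>count_space x)"
    unfolding pair_sum_def using zero fF Fx
    by (intro nn_integral_cong nn_integral_count_space') auto
  also have "\<dots> = (\<Sum>K\<in>F. \<Sum>L\<in>F. ?h K L)"
  proof (rule nn_integral_count_space'[OF fF _ Fx])
    fix K assume "K \<in> x" "K \<notin> F"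
    then show "(\<Sum>L\<in>F. ?h K L) = 0" using Fx by (intro sum.neutral ballI zero) auto
  qed
  also have "\<dots> = (\<Sum>q\<in>F\<times>F. ?h (fst q) (snd q))" by (simp add: sum.cartesian_product split_beta)
  also have "\<dots> = (\<Sum>q\<in>?O. ?h (fst q) (snd q))"
  proof (rule sum.mono_neutral_right)
    show "?O \<subseteq> F \<times> F" by (force simp: F_def)
    show "\<forall>q\<in>F \<times> F - ?O. ?h (fst q) (snd q) = 0"
      using Fx by (auto simp: ordered_pairs_def)
  qed (use fF in auto)
  also have "\<dots> = (\<Sum>q\<in>?O. ennreal (g (fst q \<inter> snd q)))"
    by (rule sum.cong) (auto simp: ordered_pairs_def)
  also have "\<dots> = ennreal (\<Sum>q\<in>?O. g (fst q \<inter> snd q))"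
    by (rule sum_ennreal) (auto simp: ordered_pairs_def intro: nn)
  also have "(\<Sum>q\<in>?O. g (fst q \<inter> snd q)) = 2 * energy g \<Delta> x"
    by (simp add: energy_ordered_pairs[OF assms] split_beta)
  finally have "pair_sum g \<Delta> x = ennreal (2 * energy g \<Delta> x)" .
  moreover have "0 \<le> 2 * energy g \<Delta> x"
    unfolding energy_ordered_pairs[OF assms] by (rule sum_nonneg) (auto simp: ordered_pairs_def intro: nn)
  ultimately show ?thesis by simp
qed

text \<open>As the centre of K lies in \<Delta>, every pair {K, L} with L in x becomes an
  interacting pair, wherever the centre of L is; this is why the sum over the whole of x in the
  conditional intensity appears.\<close>

lemma energy_insert:
  fixes x :: "'a::euclidean_space set set"
  assumes x: "x \<in> space configs" and fin: "finite (inside \<Delta> x)" and g: "pair_potential g"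
    and K: "K \<in> space particles" "circumcentre K \<in> \<Delta>" "K \<notin> x"
  shows "energy g \<Delta> (insert K x) = energy g \<Delta> x + (\<Sum>\<^sub>\<infinity>L\<in>x. g (K \<inter> L))"
proof -
  have "interacting_pairs \<Delta> (insert K x) = interacting_pairs \<Delta> x \<union> (\<lambda>L. {K, L}) ` x"
  proof
    show "interacting_pairs \<Delta> (insert K x) \<subseteq> interacting_pairs \<Delta> x \<union> (\<lambda>L. {K, L}) ` x"
    proof
      fix p assume "p \<in> interacting_pairs \<Delta> (insert K x)"
      then obtain A B where p: "p = {A, B}" "A \<in> insert K x" "B \<in> insert K x" "A \<noteq> B"
        "circumcentre A \<in> \<Delta> \<or> circumcentre B \<in> \<Delta>" unfolding interacting_pairs_def by blast
      consider "A = K" "B \<in> x" | "B = K" "A \<in> x" | "A \<in> x" "B \<in> x" using p by blast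
      then show "p \<in> interacting_pairs \<Delta> x \<union> (\<lambda>L. {K, L}) ` x"
      proof cases
        case 3 then show ?thesis using p unfolding interacting_pairs_def by blast
      qed (use p(1) in \<open>auto simp: insert_commute\<close>)
    qed
    show "interacting_pairs \<Delta> x \<union> (\<lambda>L. {K, L}) ` x \<subseteq> interacting_pairs \<Delta> (insert K x)"
      using K unfolding interacting_pairs_def by blast
  qed
  moreover have "interacting_pairs \<Delta> x \<inter> (\<lambda>L. {K, L}) ` x = {}"
    using K by (auto simp: interacting_pairs_def doubleton_eq_iff)
  moreover have "(\<lambda>p. g (\<Inter>p)) summable_on interacting_pairs \<Delta> x"
    by (rule finite_nonzero_values_imp_summable_on[OF finite_interacting_support[OF x fin g]])
  moreover have inj: "inj_on (\<lambda>L. {K, L}) x" by (auto simp: inj_on_def doubleton_eq_iff)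
  moreover have "(\<lambda>p. g (\<Inter>p)) summable_on (\<lambda>L. {K, L}) ` x"
  proof (rule finite_nonzero_values_imp_summable_on)
    have "{p \<in> (\<lambda>L. {K, L}) ` x. g (\<Inter>p) \<noteq> 0} \<subseteq> (\<lambda>L. {K, L}) ` {L\<in>x. g (K \<inter> L) \<noteq> 0}"
    proof
      fix p assume "p \<in> {p \<in> (\<lambda>L. {K, L}) ` x. g (\<Inter>p) \<noteq> 0}"
      then obtain L where L: "L \<in> x" "p = {K, L}" "g (\<Inter>p) \<noteq> 0" by blast
      then show "p \<in> (\<lambda>L. {K, L}) ` {L\<in>x. g (K \<inter> L) \<noteq> 0}"
        unfolding L(2) by (intro imageI) simp
    qed
    then show "finite {p \<in> (\<lambda>L. {K, L}) ` x. g (\<Inter>p) \<noteq> 0}"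
      by (rule finite_subset) (intro finite_imageI finite_interactions[OF x g], use K(1) in \<open>simp add: in_space_particles\<close>)
  qed
  ultimately have "energy g \<Delta> (insert K x) = energy g \<Delta> x + (\<Sum>\<^sub>\<infinity>p\<in>(\<lambda>L. {K, L}) ` x. g (\<Inter>p))"
    unfolding energy_interacting_pairs by (simp add: infsum_Un_disjoint)
  also have "(\<Sum>\<^sub>\<infinity>p\<in>(\<lambda>L. {K, L}) ` x. g (\<Inter>p)) = (\<Sum>\<^sub>\<infinity>L\<in>x. g (K \<inter> L))"
    by (subst infsum_reindex[OF inj]) (simp add: o_def)
  finally show ?thesis .
qed

lemma gibbs_weight_insert:
  fixes x :: "'a::euclidean_space set set"
  assumes x: "x \<in> space configs" and fin: "finite (inside \<Delta> x)" and g: "pair_potential g"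
    and K: "K \<in> space particles" "circumcentre K \<in> \<Delta>" "K \<notin> x"
  shows "gibbs_weight \<tau> \<beta> g \<Delta> (insert K x) = gibbs_weight \<tau> \<beta> g \<Delta> x * cond_intensity \<tau> \<beta> g K x"
proof -
  have "inside \<Delta> (insert K x) = insert K (inside \<Delta> x)" "K \<notin> inside \<Delta> x" using K by (auto simp: inside_def)
  then have "card (inside \<Delta> (insert K x)) = Suc (card (inside \<Delta> x))" using fin by simp
  then show ?thesis
    by (simp add: gibbs_weight_def cond_intensity_def energy_insert[OF assms] exp_add distrib_left right_diff_distrib exp_minus exp_diff field_simps)
qed

text \<open>Equals \<open>gibbs_weight\<close> on the configurations with finitely many centres in \<open>\<Delta>\<close>, and is measurable everywhere.\<close>

definition weight :: "real \<Rightarrow> real \<Rightarrow> ('a::euclidean_space set \<Rightarrow> real) \<Rightarrow> 'a set \<Rightarrow> 'a set set \<Rightarrow> real" where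
  "weight \<tau> \<beta> g \<Delta> x = \<tau> powr enn2real (\<integral>\<^sup>+K. indicator \<Delta> (circumcentre K) \<partial>count_space x)
     * exp (- \<beta> * (enn2real (pair_sum g \<Delta> x) / 2))"

lemma weight_eq_gibbs_weight:
  fixes x :: "'a::euclidean_space set set"
  assumes "x \<in> space configs" "finite (inside \<Delta> x)" "pair_potential g" "\<tau> > 0"
  shows "weight \<tau> \<beta> g \<Delta> x = gibbs_weight \<tau> \<beta> g \<Delta> x"
proof -
  have "(\<integral>\<^sup>+K. indicator \<Delta> (circumcentre K) \<partial>count_space x) = (\<integral>\<^sup>+K. indicator {K. circumcentre K \<in> \<Delta>} K \<partial>count_space x)"
    by (intro nn_integral_cong) (auto simp: indicator_def)
  also have "\<dots> = of_nat (card (x \<inter> {K. circumcentre K \<in> \<Delta>}))"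
    using assms(2) by (intro nn_integral_indicator_config) (simp add: inside_def Int_def)
  also have "x \<inter> {K. circumcentre K \<in> \<Delta>} = inside \<Delta> x" by (auto simp: inside_def)
  finally show ?thesis
    using assms(4) by (simp add: weight_def gibbs_weight_def energy_pair_sum[OF assms(1-3)] powr_realpow)
qed

lemma measurable_pair_sum:
  assumes g: "pair_potential g" and [measurable]: "\<Delta> \<in> sets borel"
  shows "pair_sum g \<Delta> \<in> borel_measurable (configs :: 'a::euclidean_space set set measure)"
proof -
  have [measurable]: "(\<lambda>q. g (snd (fst q) \<inter> snd q)) \<in> borel_measurable ((configs \<Otimes>\<^sub>M particles) \<Otimes>\<^sub>M particles :: (('a set set \<times> 'a set) \<times> 'a set) measure)"
    by (rule pair_potential_measurable[OF g]) measurable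
  have "(\<lambda>(x, K). \<integral>\<^sup>+L. (if K \<noteq> L \<and> (circumcentre K \<in> \<Delta> \<or> circumcentre L \<in> \<Delta>)
     then ennreal (g (K \<inter> L)) else 0) \<partial>count_space x) \<in> borel_measurable (configs \<Otimes>\<^sub>M particles :: ('a set set \<times> 'a set) measure)"
    unfolding split_beta' by (rule measurable_config_sum) (simp_all add: split_beta', measurable)
  from measurable_config_sum[OF this measurable_ident]
  show ?thesis unfolding pair_sum_def[abs_def] id_def .
qed

lemma measurable_weight:
  assumes g: "pair_potential g" and [measurable]: "\<Delta> \<in> sets borel"
  shows "weight \<tau> \<beta> g \<Delta> \<in> borel_measurable (configs :: 'a::euclidean_space set set measure)"
proof -
  note [measurable] = measurable_pair_sum[OF assms]
  have [measurable]: "(\<lambda>x. \<integral>\<^sup>+K. indicator \<Delta> (circumcentre K) \<partial>count_space x) \<in> borel_measurable (configs :: 'a set set measure)"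
    by (rule measurable_config_sum) (simp_all add: split_beta', measurable)
  show ?thesis unfolding weight_def[abs_def] by measurable
qed

subsection \<open>The Georgii-Nguyen-Zessin equations\<close>

locale gibbs_window =
  fixes \<Lambda> :: "'a::euclidean_space set measure" and P \<Psi> :: "'a set set measure"
    and \<Delta> :: "'a set" and g :: "'a set \<Rightarrow> real" and R \<tau> \<beta> :: real
  assumes sets_\<Lambda>: "sets \<Lambda> = sets particles" and sf: "sigma_finite_measure \<Lambda>"
    and R: "AE K in \<Lambda>. circumradius K \<le> R"
    and g: "pair_potential g" and \<tau>: "\<tau> > 0"
    and P: "prob_space P" "sets P = sets configs"
    and \<Delta>: "\<Delta> \<in> sets borel" "bounded \<Delta>"
    and poisson: "poisson_law (density \<Lambda> (indicator {K. circumcentre K \<in> \<Delta>})) \<Psi>"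
    and dlr: "\<And>A. A \<in> sets configs \<Longrightarrow> AE x in P.
            nn_cond_exp P (vimage_algebra (space P) (outside \<Delta>) configs)
              (indicator {y\<in>space P. inside \<Delta> y \<in> A}) x =
            emeasure (gibbs_kernel \<tau> \<beta> g \<Delta> \<Psi> (outside \<Delta> x)) A"
begin

declare sets_\<Lambda> [measurable_cong]
declare P(2) [measurable_cong]
declare \<Delta>(1) [measurable]

sublocale P: prob_space P by (rule P)
sublocale \<Lambda>: sigma_finite_measure \<Lambda> by (rule sf)
sublocale \<Psi>: prob_space \<Psi> by (rule poisson_lawD(1)[OF poisson])

lemma sets_\<Psi> [measurable_cong]: "sets \<Psi> = sets configs" by (rule poisson_lawD(2)[OF poisson])
lemma space_\<Psi>: "space \<Psi> = space configs" by (rule poisson_lawD(3)[OF poisson])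
lemma space_P: "space P = space configs" by (rule sets_eq_imp_space_eq[OF P(2)])
lemma space_\<Lambda>: "space \<Lambda> = space particles" by (rule sets_eq_imp_space_eq[OF sets_\<Lambda>])

definition D where "D = density \<Lambda> (indicator {K. circumcentre K \<in> \<Delta>})"

lemma indicator_centre [measurable]:
  "(indicator {K. circumcentre K \<in> \<Delta>} :: 'a set \<Rightarrow> ennreal) \<in> borel_measurable particles"
proof -
  have "(indicator {K. circumcentre K \<in> \<Delta>} :: 'a set \<Rightarrow> ennreal) = (\<lambda>K. indicator \<Delta> (circumcentre K))"
    by (auto simp: indicator_def)
  then show ?thesis by simp
qed

lemma sets_D [measurable_cong]: "sets D = sets particles" by (simp add: D_def sets_\<Lambda>)

lemma poisson_D: "poisson_law D \<Psi>" unfolding D_def by (rule poisson)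

lemma mecke:
  "f \<in> borel_measurable (particles \<Otimes>\<^sub>M configs) \<Longrightarrow>
    (\<integral>\<^sup>+y. (\<integral>\<^sup>+K. f (K, y - {K}) \<partial>count_space y) \<partial>\<Psi>) = (\<integral>\<^sup>+K. (\<integral>\<^sup>+y. f (K, y) \<partial>\<Psi>) \<partial>D)"
  by (rule poisson_mecke[OF poisson_D sets_D])

lemma nn_integral_D:
  assumes "f \<in> borel_measurable particles"
  shows "(\<integral>\<^sup>+K. f K \<partial>D) = (\<integral>\<^sup>+K. indicator \<Delta> (circumcentre K) * f K \<partial>\<Lambda>)"
proof -
  have "(\<integral>\<^sup>+K. f K \<partial>D) = (\<integral>\<^sup>+K. indicator {K. circumcentre K \<in> \<Delta>} K * f K \<partial>\<Lambda>)"
    unfolding D_def using assms by (intro nn_integral_density) measurable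
  also have "\<dots> = (\<integral>\<^sup>+K. indicator \<Delta> (circumcentre K) * f K \<partial>\<Lambda>)"
    by (intro nn_integral_cong) (auto simp: indicator_def)
  finally show ?thesis .
qed

lemma AE_D: "AE K in D. circumcentre K \<in> \<Delta> \<and> circumradius K \<le> R"
  unfolding D_def
proof (subst AE_density)
  show "AE K in \<Lambda>. 0 < (indicator {K. circumcentre K \<in> \<Delta>} K :: ennreal) \<longrightarrow> circumcentre K \<in> \<Delta> \<and> circumradius K \<le> R"
    using R by eventually_elim (auto simp: indicator_def)
qed measurable

lemma sigma_finite_D: "sigma_finite_measure D"
proof
  have "emeasure D (window n) < \<infinity>" for n
    by (rule poisson_lawD(4)[OF poisson_D sets_window hausdorff_bounded_window])
  then show "\<exists>A. countable A \<and> A \<subseteq> sets D \<and> \<Union>A = space D \<and> (\<forall>a\<in>A. emeasure D a \<noteq> \<infinity>)"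
    using UN_window sets_eq_imp_space_eq[OF sets_D]
    by (intro exI[of _ "range window"]) (auto simp: less_top[symmetric] sets_D)
qed

text \<open>The Mecke equation for the indicator of the bad particles shows that their expected
  number is 0. Good particles have centres in the bounded set \<Delta> and radius at most R, so all
  of them lie in one window, where a configuration is finite.\<close>

lemma AE_good: "AE y in \<Psi>. inside \<Delta> y = y \<and> finite y"
proof -
  define bad where "bad = {K\<in>space particles. \<not> (circumcentre K \<in> \<Delta> \<and> circumradius K \<le> R)}"
  have [measurable]: "bad \<in> sets particles" unfolding bad_def by measurable
  have "(\<integral>\<^sup>+y. (\<integral>\<^sup>+K. indicator bad K \<partial>count_space y) \<partial>\<Psi>) = (\<integral>\<^sup>+K. (\<integral>\<^sup>+y. indicator bad K \<partial>\<Psi>) \<partial>D)"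
    using mecke[of "\<lambda>p. indicator bad (fst p)"] by simp
  also have "\<dots> = (\<integral>\<^sup>+K. 0 \<partial>D)"
    by (rule nn_integral_cong_AE) (use AE_D in eventually_elim, auto simp: bad_def indicator_def)
  finally have "(\<integral>\<^sup>+y. (\<integral>\<^sup>+K. indicator bad K \<partial>count_space y) \<partial>\<Psi>) = 0" by simp
  moreover have "(\<lambda>y. \<integral>\<^sup>+K. indicator bad K \<partial>count_space y) \<in> borel_measurable \<Psi>"
    by (rule measurable_config_sum) (simp_all add: split_beta')
  ultimately have "AE y in \<Psi>. (\<integral>\<^sup>+K. indicator bad K \<partial>count_space y) = 0"
    by (simp add: nn_integral_0_iff_AE)
  then show ?thesis
    using AE_space
  proof eventually_elim
    case (elim y)
    obtain r where r: "\<And>x. x \<in> \<Delta> \<Longrightarrow> norm x \<le> r" using \<Delta>(2) by (auto simp: bounded_iff)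
    obtain n where n: "r + R \<le> real n" using real_arch_simple by blast
    have y: "y \<in> space configs" using elim(2) by (simp add: space_\<Psi>)
    have good: "K \<notin> bad" if "K \<in> y" for K
      using nn_integral_ge_point[OF that, of "indicator bad"] elim(1) by (auto simp: indicator_def split: if_splits)
    have part: "K \<in> space particles" if "K \<in> y" for K using config_particles[OF y] that by blast
    have "inside \<Delta> y = y" using good part by (auto simp: inside_def bad_def)
    moreover have "y \<subseteq> y \<inter> window n"
    proof
      fix K assume K: "K \<in> y"
      then have c: "circumcentre K \<in> \<Delta>" "circumradius K \<le> R" using good part by (auto simp: bad_def)
      have cK: "compact K" "K \<noteq> {}" using part[OF K] by (auto simp: in_space_particles)
      have "cball (circumcentre K) (circumradius K) \<subseteq> cball 0 (real n)"
        using r[OF c(1)] c(2) n by (simp add: cball_subset_cball_iff)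
      then have "K \<subseteq> cball 0 (real n)" using subset_circumball[OF cK] by blast
      then show "K \<in> y \<inter> window n" using K cK by (simp add: window_def)
    qed
    then have "finite y" using config_finite_window[OF y] by (rule finite_subset)
    ultimately show ?case by simp
  qed
qed

text \<open>Both arguments are filtered, so the two parts are disjoint for arbitrary configurations
  and the union is jointly measurable. For almost every y under \<Psi> the filter leaves y unchanged
  (\<open>AE_good\<close>), and the result is the union that occurs in
  \<open>gibbs_kernel\<close>.\<close>

definition glue :: "'a set set \<Rightarrow> 'a set set \<Rightarrow> 'a set set" where
  "glue y \<xi> = inside \<Delta> y \<union> outside \<Delta> \<xi>"

lemma measurable_glue' [measurable (raw)]:
  "X \<in> measurable M configs \<Longrightarrow> Y \<in> measurable M configs \<Longrightarrow> (\<lambda>z. glue (X z) (Y z)) \<in> measurable M configs"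
  unfolding glue_def by (rule measurable_glue) (use \<Delta> in auto)

lemma measurable_io [measurable]:
  "inside \<Delta> \<in> measurable configs configs" "outside \<Delta> \<in> measurable configs configs"
  using measurable_inside[OF \<Delta>(1) measurable_ident measurable_ident]
    measurable_outside[OF \<Delta>(1) measurable_ident measurable_ident] by (simp_all add: id_def)

lemma glue_config: "y \<in> space configs \<Longrightarrow> \<xi> \<in> space configs \<Longrightarrow> glue y \<xi> \<in> space configs"
  unfolding glue_def by (intro config_Un) (auto intro: config_subset simp: inside_def outside_def)

lemma inside_glue: "inside \<Delta> (glue y \<xi>) = inside \<Delta> y"
  by (auto simp: glue_def inside_def outside_def)

lemma glue_inside_outside: "glue (inside \<Delta> x) (outside \<Delta> x) = x"
  by (auto simp: glue_def inside_def outside_def)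

definition \<rho> :: "'a set set \<Rightarrow> 'a set set \<Rightarrow> ennreal" where
  "\<rho> y \<xi> = ennreal (weight \<tau> \<beta> g \<Delta> (glue y \<xi>)) / (\<integral>\<^sup>+z. ennreal (weight \<tau> \<beta> g \<Delta> (glue z \<xi>)) \<partial>\<Psi>)"

lemma measurable_\<rho> [measurable (raw)]:
  assumes [measurable]: "X \<in> measurable M configs" "Y \<in> measurable M configs"
  shows "(\<lambda>z. \<rho> (X z) (Y z)) \<in> borel_measurable M"
proof -
  note [measurable] = measurable_weight[OF g \<Delta>(1)]
  have "(\<lambda>z. \<integral>\<^sup>+y. ennreal (weight \<tau> \<beta> g \<Delta> (glue y (Y z))) \<partial>\<Psi>) \<in> borel_measurable M"
    by (rule \<Psi>.borel_measurable_nn_integral) (unfold split_beta', measurable)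
  then show ?thesis unfolding \<rho>_def by measurable
qed

lemma gibbs_weight_glue:
  assumes \<xi>: "\<xi> \<in> space configs"
  shows "AE y in \<Psi>. gibbs_weight \<tau> \<beta> g \<Delta> (y \<union> outside \<Delta> \<xi>) = weight \<tau> \<beta> g \<Delta> (glue y \<xi>)"
  using AE_good AE_space
proof eventually_elim
  case (elim y)
  then have eq: "y \<union> outside \<Delta> \<xi> = glue y \<xi>" by (simp add: glue_def)
  have "weight \<tau> \<beta> g \<Delta> (glue y \<xi>) = gibbs_weight \<tau> \<beta> g \<Delta> (glue y \<xi>)"
    by (rule weight_eq_gibbs_weight[OF glue_config _ g \<tau>]) (use elim \<xi> in \<open>auto simp: space_\<Psi> inside_glue\<close>)
  then show ?case by (simp add: eq)
qed

lemma emeasure_gibbs_kernel: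
  assumes \<xi>: "\<xi> \<in> space configs" and A [measurable]: "A \<in> sets configs"
  shows "emeasure (gibbs_kernel \<tau> \<beta> g \<Delta> \<Psi> (outside \<Delta> \<xi>)) A = (\<integral>\<^sup>+y. \<rho> y (outside \<Delta> \<xi>) * indicator A y \<partial>\<Psi>)"
proof -
  have o: "outside \<Delta> \<xi> \<in> space configs" using \<xi> by (rule config_subset) (auto simp: outside_def)
  have oo: "outside \<Delta> (outside \<Delta> \<xi>) = outside \<Delta> \<xi>" by (auto simp: outside_def)
  have Z: "(\<integral>\<^sup>+z. ennreal (gibbs_weight \<tau> \<beta> g \<Delta> (z \<union> outside \<Delta> \<xi>)) \<partial>\<Psi>) = (\<integral>\<^sup>+z. ennreal (weight \<tau> \<beta> g \<Delta> (glue z (outside \<Delta> \<xi>))) \<partial>\<Psi>)"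
    by (rule nn_integral_cong_AE) (use gibbs_weight_glue[OF o] in \<open>eventually_elim, simp add: oo\<close>)
  have eq: "AE y in \<Psi>. ennreal (gibbs_weight \<tau> \<beta> g \<Delta> (y \<union> outside \<Delta> \<xi>)) / (\<integral>\<^sup>+z. ennreal (gibbs_weight \<tau> \<beta> g \<Delta> (z \<union> outside \<Delta> \<xi>)) \<partial>\<Psi>)
      = \<rho> y (outside \<Delta> \<xi>)"
    using gibbs_weight_glue[OF o] by eventually_elim (simp add: Z \<rho>_def oo)
  \<comment> \<open>Measurability is available for \<open>weight\<close> but not established for
    \<open>gibbs_weight\<close>, so the two densities are compared through the set function that
    defines them, where almost sure equality of the integrands is enough.\<close>
  have "gibbs_kernel \<tau> \<beta> g \<Delta> \<Psi> (outside \<Delta> \<xi>) = density \<Psi> (\<lambda>y. \<rho> y (outside \<Delta> \<xi>))"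
    unfolding gibbs_kernel_def density_def
    by (intro arg_cong[where f="measure_of (space \<Psi>) (sets \<Psi>)"] ext nn_integral_cong_AE)
       (use eq in \<open>eventually_elim, simp\<close>)
  then show ?thesis using o by (simp add: emeasure_density)
qed

definition Pout where "Pout = distr P configs (outside \<Delta>)"

lemma sets_Pout [measurable_cong]: "sets Pout = sets configs" by (simp add: Pout_def)

sublocale Pout: prob_space Pout unfolding Pout_def by (rule P.prob_space_distr) measurable

text \<open>On a rectangle A \<times> C, the indicator of C at \<open>outside \<Delta> x\<close> is
  measurable for the conditioning \<sigma>-algebra and can be carried into the conditional
  expectation, which the DLR equation replaces by the kernel. Rectangles determine the joint
  law.\<close>

lemma inside_outside_law:
  "distr P (configs \<Otimes>\<^sub>M configs) (\<lambda>x. (inside \<Delta> x, outside \<Delta> x)) = density (\<Psi> \<Otimes>\<^sub>M Pout) (\<lambda>(y, \<xi>). \<rho> y \<xi>)"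
proof (rule measure_eqI_generator_eq[where \<Omega>="space configs \<times> space configs"
      and E="{a \<times> b | a b. a \<in> sets configs \<and> b \<in> sets configs}" and A="\<lambda>_. space configs \<times> space configs"])
  show "Int_stable {a \<times> b | a b. a \<in> sets (configs :: 'a set set measure) \<and> b \<in> sets (configs :: 'a set set measure)}"
    by (rule Int_stable_pair_measure_generator)
  show "{a \<times> b | a b. a \<in> sets (configs :: 'a set set measure) \<and> b \<in> sets (configs :: 'a set set measure)} \<subseteq> Pow (space configs \<times> space configs)"
    by (rule pair_measure_closed)
  show "sets (distr P (configs \<Otimes>\<^sub>M configs) (\<lambda>x. (inside \<Delta> x, outside \<Delta> x)))
    = sigma_sets (space configs \<times> space configs) {a \<times> b | a b. a \<in> sets configs \<and> b \<in> sets configs}"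
    by (simp add: sets_pair_measure)
  have "sets (\<Psi> \<Otimes>\<^sub>M Pout) = sets (configs \<Otimes>\<^sub>M configs)" by (rule sets_pair_measure_cong[OF sets_\<Psi> sets_Pout])
  then show "sets (density (\<Psi> \<Otimes>\<^sub>M Pout) (\<lambda>(y, \<xi>). \<rho> y \<xi>))
    = sigma_sets (space configs \<times> space configs) {a \<times> b | a b. a \<in> sets configs \<and> b \<in> sets configs}"
    by (simp add: sets_pair_measure)
  show "range (\<lambda>_. space configs \<times> space configs) \<subseteq> {a \<times> b | a b. a \<in> sets configs \<and> b \<in> sets configs}" by auto
  fix X assume "X \<in> {a \<times> b | a b. a \<in> sets (configs :: 'a set set measure) \<and> b \<in> sets (configs :: 'a set set measure)}"
  then obtain A C where X: "X = A \<times> C" and [measurable]: "A \<in> sets configs" "C \<in> sets configs" by auto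
  define F where "F = vimage_algebra (space P) (outside \<Delta>) configs"
  have out: "outside \<Delta> \<in> measurable F configs"
    unfolding F_def by (rule measurable_vimage_algebra1) (use measurable_space[OF measurable_io(2)] in \<open>auto simp: space_P\<close>)
  have sub: "subalgebra P F"
  proof -
    have "sets F \<subseteq> sets P"
      unfolding F_def by (rule sets_image_in_sets) measurable
    then show ?thesis by (auto simp: subalgebra_def F_def)
  qed
  interpret F: finite_measure_subalgebra P F by standard (rule sub)
  have "emeasure (distr P (configs \<Otimes>\<^sub>M configs) (\<lambda>x. (inside \<Delta> x, outside \<Delta> x))) X
      = emeasure P ((\<lambda>x. (inside \<Delta> x, outside \<Delta> x)) -` X \<inter> space P)"
    unfolding X by (rule emeasure_distr) measurable
  also have "\<dots> = (\<integral>\<^sup>+x. indicator ((\<lambda>x. (inside \<Delta> x, outside \<Delta> x)) -` X \<inter> space P) x \<partial>P)"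
    by (rule nn_integral_indicator[symmetric], unfold X, rule measurable_sets[of _ _ "configs \<Otimes>\<^sub>M configs"]) measurable
  also have "\<dots> = (\<integral>\<^sup>+x. indicator C (outside \<Delta> x) * indicator {y\<in>space P. inside \<Delta> y \<in> A} x \<partial>P)"
    by (intro nn_integral_cong) (auto simp: X indicator_def)
  also have "\<dots> = (\<integral>\<^sup>+x. indicator C (outside \<Delta> x) * nn_cond_exp P F (indicator {y\<in>space P. inside \<Delta> y \<in> A}) x \<partial>P)"
    by (rule F.nn_cond_exp_intg[symmetric]) (use out in measurable)
  also have "\<dots> = (\<integral>\<^sup>+x. indicator C (outside \<Delta> x) * (\<integral>\<^sup>+y. \<rho> y (outside \<Delta> x) * indicator A y \<partial>\<Psi>) \<partial>P)"
  proof (rule nn_integral_cong_AE)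
    show "AE x in P. indicator C (outside \<Delta> x) * nn_cond_exp P F (indicator {y\<in>space P. inside \<Delta> y \<in> A}) x
      = indicator C (outside \<Delta> x) * (\<integral>\<^sup>+y. \<rho> y (outside \<Delta> x) * indicator A y \<partial>\<Psi>)"
      using dlr[OF \<open>A \<in> sets configs\<close>] AE_space
      by eventually_elim (simp add: F_def emeasure_gibbs_kernel space_P)
  qed
  also have "\<dots> = (\<integral>\<^sup>+\<xi>. indicator C \<xi> * (\<integral>\<^sup>+y. \<rho> y \<xi> * indicator A y \<partial>\<Psi>) \<partial>Pout)"
    unfolding Pout_def by (rule nn_integral_distr[symmetric]) measurable
  also have "\<dots> = (\<integral>\<^sup>+\<xi>. (\<integral>\<^sup>+y. \<rho> y \<xi> * indicator X (y, \<xi>) \<partial>\<Psi>) \<partial>Pout)"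
  proof (rule nn_integral_cong)
    fix \<xi> assume "\<xi> \<in> space Pout"
    then have [simp]: "\<xi> \<in> space configs" by (simp add: Pout_def)
    show "indicator C \<xi> * (\<integral>\<^sup>+y. \<rho> y \<xi> * indicator A y \<partial>\<Psi>) = (\<integral>\<^sup>+y. \<rho> y \<xi> * indicator X (y, \<xi>) \<partial>\<Psi>)"
      by (subst nn_integral_cmult[symmetric], measurable)
         (auto intro!: nn_integral_cong simp: X indicator_def)
  qed
  also have "\<dots> = (\<integral>\<^sup>+p. (case p of (y, \<xi>) \<Rightarrow> \<rho> y \<xi>) * indicator X p \<partial>(\<Psi> \<Otimes>\<^sub>M Pout))"
  proof -
    interpret pair_sigma_finite \<Psi> Pout ..
    have "(\<lambda>(y, \<xi>). \<rho> y \<xi> * indicator X (y, \<xi>)) \<in> borel_measurable (\<Psi> \<Otimes>\<^sub>M Pout)"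
      unfolding X split_beta' by measurable
    from nn_integral_snd[OF this] show ?thesis by (simp add: split_beta')
  qed
  also have "\<dots> = emeasure (density (\<Psi> \<Otimes>\<^sub>M Pout) (\<lambda>(y, \<xi>). \<rho> y \<xi>)) X"
    by (rule emeasure_density[symmetric]) (unfold X split_beta', measurable)
  finally show "emeasure (distr P (configs \<Otimes>\<^sub>M configs) (\<lambda>x. (inside \<Delta> x, outside \<Delta> x))) X
    = emeasure (density (\<Psi> \<Otimes>\<^sub>M Pout) (\<lambda>(y, \<xi>). \<rho> y \<xi>)) X" .
next
  fix i :: nat
  have "prob_space (distr P (configs \<Otimes>\<^sub>M configs) (\<lambda>x. (inside \<Delta> x, outside \<Delta> x)))"
    by (rule P.prob_space_distr) measurable
  then interpret J: prob_space "distr P (configs \<Otimes>\<^sub>M configs) (\<lambda>x. (inside \<Delta> x, outside \<Delta> x))" .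
  show "emeasure (distr P (configs \<Otimes>\<^sub>M configs) (\<lambda>x. (inside \<Delta> x, outside \<Delta> x))) (space configs \<times> space configs) \<noteq> \<infinity>"
    by (rule J.emeasure_finite[unfolded infinity_ennreal_def[symmetric]])
qed auto

lemma nn_integral_P:
  assumes h: "(\<lambda>(y, \<xi>). h y \<xi>) \<in> borel_measurable (configs \<Otimes>\<^sub>M configs)"
  shows "(\<integral>\<^sup>+x. h (inside \<Delta> x) (outside \<Delta> x) \<partial>P) = (\<integral>\<^sup>+\<xi>. (\<integral>\<^sup>+y. \<rho> y \<xi> * h y \<xi> \<partial>\<Psi>) \<partial>Pout)"
proof -
  interpret pair_sigma_finite \<Psi> Pout ..
  note [measurable] = h
  have "(\<integral>\<^sup>+x. h (inside \<Delta> x) (outside \<Delta> x) \<partial>P)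
    = (\<integral>\<^sup>+p. (case p of (y, \<xi>) \<Rightarrow> h y \<xi>) \<partial>distr P (configs \<Otimes>\<^sub>M configs) (\<lambda>x. (inside \<Delta> x, outside \<Delta> x)))"
    by (subst nn_integral_distr) (auto, measurable)
  also have "\<dots> = (\<integral>\<^sup>+p. (case p of (y, \<xi>) \<Rightarrow> \<rho> y \<xi>) * (case p of (y, \<xi>) \<Rightarrow> h y \<xi>) \<partial>(\<Psi> \<Otimes>\<^sub>M Pout))"
    unfolding inside_outside_law by (rule nn_integral_density) measurable
  also have "\<dots> = (\<integral>\<^sup>+\<xi>. (\<integral>\<^sup>+y. \<rho> y \<xi> * h y \<xi> \<partial>\<Psi>) \<partial>Pout)"
  proof -
    have "(\<lambda>(y, \<xi>). \<rho> y \<xi> * h y \<xi>) \<in> borel_measurable (\<Psi> \<Otimes>\<^sub>M Pout)"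
      using h unfolding split_beta' by measurable
    from nn_integral_snd[OF this] show ?thesis by (simp add: split_beta')
  qed
  finally show ?thesis .
qed

text \<open>In the Mecke equation for the indicator of K \<in> y, the particle has been removed on
  the left, so that side is 0. The inserted particle is therefore new, as
  \<open>\<rho>_insert\<close> requires.\<close>

lemma AE_not_mem: "AE K in D. AE y in \<Psi>. K \<notin> y"
proof -
  have [measurable]: "Measurable.pred (particles \<Otimes>\<^sub>M configs) (\<lambda>p :: 'a set \<times> 'a set set. fst p \<in> snd p)"
    by (rule pred_mem_config[of fst _ snd]) measurable
  have m: "(\<lambda>p :: 'a set \<times> 'a set set. if fst p \<in> snd p then 1 else 0 :: ennreal) \<in> borel_measurable (particles \<Otimes>\<^sub>M configs)"
    by measurable
  from mecke[OF m] have "(\<integral>\<^sup>+K. (\<integral>\<^sup>+y. (if K \<in> y then 1 else 0) \<partial>\<Psi>) \<partial>D) = 0" by simp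
  moreover have "(\<lambda>K. \<integral>\<^sup>+y. (if K \<in> y then 1 else 0 :: ennreal) \<partial>\<Psi>) \<in> borel_measurable D"
    by (rule \<Psi>.borel_measurable_nn_integral) (use m in \<open>simp add: split_beta' cong: measurable_cong_sets sets_pair_measure_cong add: sets_D sets_\<Psi>\<close>)
  ultimately have "AE K in D. (\<integral>\<^sup>+y. (if K \<in> y then 1 else 0 :: ennreal) \<partial>\<Psi>) = 0"
    by (simp add: nn_integral_0_iff_AE)
  then show ?thesis
    using AE_space
  proof eventually_elim
    case (elim K)
    then have K [simp]: "K \<in> space particles" using sets_eq_imp_space_eq[OF sets_D] by simp
    have "Measurable.pred \<Psi> (\<lambda>y. K \<in> y)"
      by (rule pred_mem_config[of "\<lambda>_. K" _ "\<lambda>y. y"]) measurable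
    then have "(\<lambda>y. if K \<in> y then 1 else 0 :: ennreal) \<in> borel_measurable \<Psi>" by measurable
    with elim(1) have "AE y in \<Psi>. (if K \<in> y then 1 else 0 :: ennreal) = 0"
      by (simp add: nn_integral_0_iff_AE)
    then show ?case by eventually_elim (auto split: if_splits)
  qed
qed

text \<open>Only the numerator of \<rho> involves y, and \<open>gibbs_weight_insert\<close> gives
  its new factor; the normalising integral depends on \<xi> alone and is carried along.\<close>

lemma \<rho>_insert:
  assumes \<xi>: "\<xi> \<in> space configs" and K: "K \<in> space particles" "circumcentre K \<in> \<Delta>" "K \<notin> y"
    and y: "y \<in> space configs" "inside \<Delta> y = y" "finite y"
  shows "\<rho> (insert K y) \<xi> = \<rho> y \<xi> * ennreal (cond_intensity \<tau> \<beta> g K (glue y \<xi>))"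
proof -
  have gl: "glue (insert K y) \<xi> = insert K (glue y \<xi>)" using K by (auto simp: glue_def inside_def)
  have c: "glue y \<xi> \<in> space configs" by (rule glue_config[OF y(1) \<xi>])
  have fin: "finite (inside \<Delta> (glue y \<xi>))" using y by (simp add: inside_glue)
  have fin': "finite (inside \<Delta> (insert K (glue y \<xi>)))"
    using fin by (rule finite_subset[rotated, of "insert K (inside \<Delta> (glue y \<xi>))", OF finite_insert[THEN iffD2]]) (auto simp: inside_def)
  have nK: "K \<notin> glue y \<xi>" using K by (auto simp: glue_def inside_def outside_def)
  have "weight \<tau> \<beta> g \<Delta> (glue (insert K y) \<xi>) = weight \<tau> \<beta> g \<Delta> (glue y \<xi>) * cond_intensity \<tau> \<beta> g K (glue y \<xi>)"
    unfolding gl weight_eq_gibbs_weight[OF config_insert[OF c K(1)] fin' g \<tau>] weight_eq_gibbs_weight[OF c fin g \<tau>]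
    by (rule gibbs_weight_insert[OF c fin g K(1,2) nK])
  then show ?thesis
    using \<tau> by (simp add: \<rho>_def weight_def cond_intensity_def ennreal_mult divide_ennreal_def mult_ac)
qed

text \<open>For a fixed outside configuration \<xi>, the Mecke equation is applied with the density
  \<rho> as part of the integrand; inserting K multiplies \<rho> by the conditional intensity.
  Integration over \<xi> then recovers P on both sides.\<close>

theorem gnz_local:
  assumes f: "f \<in> borel_measurable (particles \<Otimes>\<^sub>M configs)"
  shows "(\<integral>\<^sup>+x. (\<integral>\<^sup>+K. indicator \<Delta> (circumcentre K) * f (K, x - {K}) \<partial>count_space x) \<partial>P)
    = (\<integral>\<^sup>+x. (\<integral>\<^sup>+K. indicator \<Delta> (circumcentre K) * (ennreal (cond_intensity \<tau> \<beta> g K x) * f (K, x)) \<partial>\<Lambda>) \<partial>P)"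
proof -
  note [measurable] = f
  define h1 where "h1 y \<xi> = (\<integral>\<^sup>+K. indicator \<Delta> (circumcentre K) * f (K, glue y \<xi> - {K}) \<partial>count_space (glue y \<xi>))" for y \<xi>
  define h2 where "h2 y \<xi> = (\<integral>\<^sup>+K. indicator \<Delta> (circumcentre K) * (ennreal (cond_intensity \<tau> \<beta> g K (glue y \<xi>)) * f (K, glue y \<xi>)) \<partial>\<Lambda>)" for y \<xi>
  have m1: "(\<lambda>(y, \<xi>). h1 y \<xi>) \<in> borel_measurable (configs \<Otimes>\<^sub>M configs)"
  proof -
    have "(\<lambda>p. indicator \<Delta> (circumcentre (fst p)) * f p) \<in> borel_measurable (particles \<Otimes>\<^sub>M configs)" by measurable
    from measurable_compose[OF _ measurable_removed[OF this], of "\<lambda>p. glue (fst p) (snd p)" "configs \<Otimes>\<^sub>M configs"]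
    show ?thesis by (simp add: h1_def split_beta')
  qed
  have mc: "(\<lambda>z. cond_intensity \<tau> \<beta> g (snd z) (glue (fst (fst z)) (snd (fst z)))) \<in> borel_measurable ((configs \<Otimes>\<^sub>M configs) \<Otimes>\<^sub>M particles)"
    by (rule measurable_cond_intensity[OF g]) measurable
  have m2: "(\<lambda>(y, \<xi>). h2 y \<xi>) \<in> borel_measurable (configs \<Otimes>\<^sub>M configs)"
    unfolding h2_def split_beta'
    by (rule \<Lambda>.borel_measurable_nn_integral) (use mc in \<open>unfold split_beta', measurable\<close>)
  have key: "(\<integral>\<^sup>+y. \<rho> y \<xi> * h1 y \<xi> \<partial>\<Psi>) = (\<integral>\<^sup>+y. \<rho> y \<xi> * h2 y \<xi> \<partial>\<Psi>)" if \<xi>: "\<xi> \<in> space configs" for \<xi>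
  proof -
    \<comment> \<open>\<rho> is evaluated with the particle inserted, so that at (K, y - {K}) with K
      in y it is \<rho> y \<xi>.\<close>
    define G where "G p = indicator \<Delta> (circumcentre (fst p)) * f (fst p, glue (snd p) \<xi>) * \<rho> (insert (fst p) (snd p)) \<xi>" for p
    have \<xi>' [measurable]: "(\<lambda>_. \<xi>) \<in> measurable M configs" for M :: "'x measure" using \<xi> by simp
    have "(\<lambda>p. insert (fst p) (snd p)) \<in> measurable (particles \<Otimes>\<^sub>M configs) (configs :: 'a set set measure)"
      by (rule measurable_insert_config) measurable
    note [measurable] = this
    have mG: "G \<in> borel_measurable (particles \<Otimes>\<^sub>M configs)"
      unfolding G_def[abs_def] by measurable
    have "\<rho> y \<xi> * h1 y \<xi> = (\<integral>\<^sup>+K. G (K, y - {K}) \<partial>count_space y)" for y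
    proof -
      have "\<rho> y \<xi> * h1 y \<xi> = (\<integral>\<^sup>+K. \<rho> y \<xi> * (indicator \<Delta> (circumcentre K) * f (K, glue y \<xi> - {K})) \<partial>count_space (glue y \<xi>))"
        unfolding h1_def by (rule nn_integral_cmult[symmetric]) simp
      \<comment> \<open>Only particles with centre in \<Delta> contribute, and the glued
        configuration shares exactly these with y.\<close>
      also have "\<dots> = (\<integral>\<^sup>+K. \<rho> y \<xi> * (indicator \<Delta> (circumcentre K) * f (K, glue y \<xi> - {K})) \<partial>count_space y)"
        by (rule nn_integral_count_space_eq) (auto simp: glue_def inside_def outside_def indicator_def)
      also have "\<dots> = (\<integral>\<^sup>+K. G (K, y - {K}) \<partial>count_space y)"
      proof (rule nn_integral_cong)
        fix K assume "K \<in> space (count_space y)"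
        then have K: "K \<in> y" by simp
        show "\<rho> y \<xi> * (indicator \<Delta> (circumcentre K) * f (K, glue y \<xi> - {K})) = G (K, y - {K})"
        proof (cases "circumcentre K \<in> \<Delta>")
          case True
          have "glue (y - {K}) \<xi> = glue y \<xi> - {K}" using True by (auto simp: glue_def inside_def outside_def)
          then show ?thesis using K by (simp add: G_def insert_absorb mult_ac)
        qed (simp add: G_def)
      qed
      finally show ?thesis .
    qed
    then have "(\<integral>\<^sup>+y. \<rho> y \<xi> * h1 y \<xi> \<partial>\<Psi>) = (\<integral>\<^sup>+K. (\<integral>\<^sup>+y. G (K, y) \<partial>\<Psi>) \<partial>D)"
      using mecke[OF mG] by simp
    also have "\<dots> = (\<integral>\<^sup>+K. (\<integral>\<^sup>+y. \<rho> y \<xi> * (indicator \<Delta> (circumcentre K) * (ennreal (cond_intensity \<tau> \<beta> g K (glue y \<xi>)) * f (K, glue y \<xi>))) \<partial>\<Psi>) \<partial>D)"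
    proof (rule nn_integral_cong_AE)
      show "AE K in D. (\<integral>\<^sup>+y. G (K, y) \<partial>\<Psi>)
        = (\<integral>\<^sup>+y. \<rho> y \<xi> * (indicator \<Delta> (circumcentre K) * (ennreal (cond_intensity \<tau> \<beta> g K (glue y \<xi>)) * f (K, glue y \<xi>))) \<partial>\<Psi>)"
        using AE_not_mem AE_D AE_space
      proof eventually_elim
        case (elim K)
        then have K: "K \<in> space particles" "circumcentre K \<in> \<Delta>" using sets_eq_imp_space_eq[OF sets_D] by auto
        show ?case
        proof (rule nn_integral_cong_AE)
          show "AE y in \<Psi>. G (K, y) = \<rho> y \<xi> * (indicator \<Delta> (circumcentre K) * (ennreal (cond_intensity \<tau> \<beta> g K (glue y \<xi>)) * f (K, glue y \<xi>)))"
            using elim(1) AE_good AE_space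
            by eventually_elim (use K \<xi> in \<open>simp add: G_def \<rho>_insert space_\<Psi> mult_ac\<close>)
        qed
      qed
    qed
    also have "\<dots> = (\<integral>\<^sup>+y. (\<integral>\<^sup>+K. \<rho> y \<xi> * (indicator \<Delta> (circumcentre K) * (ennreal (cond_intensity \<tau> \<beta> g K (glue y \<xi>)) * f (K, glue y \<xi>))) \<partial>D) \<partial>\<Psi>)"
    proof -
      interpret D: sigma_finite_measure D by (rule sigma_finite_D)
      interpret pair_sigma_finite D \<Psi> ..
      have [measurable]: "(\<lambda>z. cond_intensity \<tau> \<beta> g (fst z) (glue (snd z) \<xi>)) \<in> borel_measurable (D \<Otimes>\<^sub>M \<Psi>)"
        by (rule measurable_cond_intensity[OF g]) measurable
      show ?thesis by (rule Fubini'[symmetric]) (unfold split_beta', measurable)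
    qed
    also have "\<dots> = (\<integral>\<^sup>+y. \<rho> y \<xi> * h2 y \<xi> \<partial>\<Psi>)"
    proof (rule nn_integral_cong)
      fix y assume "y \<in> space \<Psi>"
      then have y: "y \<in> space configs" by (simp add: space_\<Psi>)
      have gl [simp]: "glue y \<xi> \<in> space configs" by (rule glue_config[OF y \<xi>])
      have [measurable]: "(\<lambda>K. cond_intensity \<tau> \<beta> g K (glue y \<xi>)) \<in> borel_measurable particles"
        by (rule measurable_cond_intensity[OF g]) measurable
      have [measurable]: "(\<lambda>K. f (K, glue y \<xi>)) \<in> borel_measurable particles" by measurable
      have "(\<integral>\<^sup>+K. \<rho> y \<xi> * (indicator \<Delta> (circumcentre K) * (ennreal (cond_intensity \<tau> \<beta> g K (glue y \<xi>)) * f (K, glue y \<xi>))) \<partial>D)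
        = (\<integral>\<^sup>+K. indicator \<Delta> (circumcentre K) * (\<rho> y \<xi> * (indicator \<Delta> (circumcentre K) * (ennreal (cond_intensity \<tau> \<beta> g K (glue y \<xi>)) * f (K, glue y \<xi>)))) \<partial>\<Lambda>)"
        by (rule nn_integral_D) measurable
      also have "\<dots> = (\<integral>\<^sup>+K. \<rho> y \<xi> * (indicator \<Delta> (circumcentre K) * (ennreal (cond_intensity \<tau> \<beta> g K (glue y \<xi>)) * f (K, glue y \<xi>))) \<partial>\<Lambda>)"
        by (intro nn_integral_cong) (auto simp: indicator_def)
      also have "\<dots> = \<rho> y \<xi> * h2 y \<xi>" unfolding h2_def by (rule nn_integral_cmult) measurable
      finally show "(\<integral>\<^sup>+K. \<rho> y \<xi> * (indicator \<Delta> (circumcentre K) * (ennreal (cond_intensity \<tau> \<beta> g K (glue y \<xi>)) * f (K, glue y \<xi>))) \<partial>D)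
        = \<rho> y \<xi> * h2 y \<xi>" .
    qed
    finally show ?thesis .
  qed
  have "(\<integral>\<^sup>+x. (\<integral>\<^sup>+K. indicator \<Delta> (circumcentre K) * f (K, x - {K}) \<partial>count_space x) \<partial>P)
    = (\<integral>\<^sup>+x. h1 (inside \<Delta> x) (outside \<Delta> x) \<partial>P)" by (simp add: h1_def glue_inside_outside)
  also have "\<dots> = (\<integral>\<^sup>+\<xi>. (\<integral>\<^sup>+y. \<rho> y \<xi> * h1 y \<xi> \<partial>\<Psi>) \<partial>Pout)" by (rule nn_integral_P[OF m1])
  also have "\<dots> = (\<integral>\<^sup>+\<xi>. (\<integral>\<^sup>+y. \<rho> y \<xi> * h2 y \<xi> \<partial>\<Psi>) \<partial>Pout)"
    by (intro nn_integral_cong key) (simp add: Pout_def)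
  also have "\<dots> = (\<integral>\<^sup>+x. h2 (inside \<Delta> x) (outside \<Delta> x) \<partial>P)" by (rule nn_integral_P[OF m2, symmetric])
  finally show ?thesis by (simp add: h2_def glue_inside_outside)
qed

end

text \<open>Centred balls exhaust the space of centres, and both sides of the local equations
  increase to the global ones by monotone convergence.\<close>

theorem gnz:
  fixes Q :: "'a::euclidean_space set measure"
  assumes Q: "prob_space Q" "sets Q = sets particles"
    and QR: "AE K in Q. circumcentre K = 0" "AE K in Q. circumball K \<subseteq> cball 0 R"
    and g: "pair_potential g" and \<tau>: "\<tau> > 0"
    and P: "prob_space P" "sets P = sets configs" and dlr: "dlr_equations Q \<tau> \<beta> g P"
    and f: "f \<in> borel_measurable (particles \<Otimes>\<^sub>M configs)"
  shows "(\<integral>\<^sup>+x. (\<integral>\<^sup>+K. f (K, x - {K}) \<partial>count_space x) \<partial>P)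
    = (\<integral>\<^sup>+x. (\<integral>\<^sup>+K. ennreal (cond_intensity \<tau> \<beta> g K x) * f (K, x) \<partial>reference_measure Q) \<partial>P)"
proof -
  interpret P: prob_space P by (rule P)
  interpret \<Lambda>: sigma_finite_measure "reference_measure Q"
    by (rule sigma_finite_reference_measure[OF Q QR])
  note [measurable_cong] = P(2)
  have spP: "space P = space configs" by (rule sets_eq_imp_space_eq[OF P(2)])
  \<comment> \<open>The radius n + 1 keeps the Lebesgue measure positive also for n = 0, as the DLR
    equations demand.\<close>
  define \<Delta> where "\<Delta> n = (ball 0 (real (Suc n)) :: 'a set)" for n
  have [measurable]: "\<Delta> n \<in> sets borel" for n by (simp add: \<Delta>_def)
  have le: "indicator (\<Delta> n) v \<le> (indicator (\<Delta> (Suc n)) v :: ennreal)" for n v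
    by (auto simp: \<Delta>_def indicator_def)
  have SUP1: "(SUP n. indicator (\<Delta> n) v * a) = (a :: ennreal)" for v a
  proof -
    obtain n where "norm v \<le> real n" using real_arch_simple by blast
    then have "a \<le> (SUP n. indicator (\<Delta> n) v * a)" by (intro SUP_upper2[of n]) (auto simp: \<Delta>_def)
    moreover have "(SUP n. indicator (\<Delta> n) v * a) \<le> a" by (intro SUP_least) (auto simp: indicator_def)
    ultimately show ?thesis by (rule antisym[rotated])
  qed
  have loc: "(\<integral>\<^sup>+x. (\<integral>\<^sup>+K. indicator (\<Delta> n) (circumcentre K) * f (K, x - {K}) \<partial>count_space x) \<partial>P)
    = (\<integral>\<^sup>+x. (\<integral>\<^sup>+K. indicator (\<Delta> n) (circumcentre K) * (ennreal (cond_intensity \<tau> \<beta> g K x) * f (K, x)) \<partial>reference_measure Q) \<partial>P)" for n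
  proof -
    have "0 < emeasure lborel (\<Delta> n)"
      using content_ball_pos[of "real (Suc n)" "0::'a"] by (simp add: \<Delta>_def measure_def enn2real_positive_iff)
    then have D: "\<Delta> n \<in> sets borel \<and> bounded (\<Delta> n) \<and> 0 < emeasure lborel (\<Delta> n)" by (simp add: \<Delta>_def)
    obtain \<Psi> where \<Psi>: "poisson_law (density (reference_measure Q) (indicator {K. circumcentre K \<in> \<Delta> n})) \<Psi>"
      "\<forall>A\<in>sets configs. AE x in P.
            nn_cond_exp P (vimage_algebra (space P) (outside (\<Delta> n)) configs)
              (indicator {y\<in>space P. inside (\<Delta> n) y \<in> A}) x =
            emeasure (gibbs_kernel \<tau> \<beta> g (\<Delta> n) \<Psi> (outside (\<Delta> n) x)) A"
      using mp[OF spec[OF dlr[unfolded dlr_equations_def]] D] by blast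
    interpret gibbs_window "reference_measure Q" P \<Psi> "\<Delta> n" g R \<tau> \<beta>
      by (unfold_locales, simp, rule AE_reference_subset_cball[OF Q(2) QR], rule g, rule \<tau>, rule P(2), simp,
          simp add: \<Delta>_def, rule \<Psi>(1), rule bspec[OF \<Psi>(2)])
    show ?thesis by (rule gnz_local[OF f])
  qed
  have m1: "(\<lambda>x. \<integral>\<^sup>+K. indicator (\<Delta> n) (circumcentre K) * f (K, x - {K}) \<partial>count_space x) \<in> borel_measurable P" for n
  proof -
    have "(\<lambda>p. indicator (\<Delta> n) (circumcentre (fst p)) * f p) \<in> borel_measurable (particles \<Otimes>\<^sub>M configs)"
      using f by measurable
    from measurable_removed[OF this] show ?thesis by simp
  qed
  have mc [measurable]: "(\<lambda>p. cond_intensity \<tau> \<beta> g (snd p) (fst p)) \<in> borel_measurable (configs \<Otimes>\<^sub>M particles)"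
    by (rule measurable_cond_intensity[OF g]) measurable
  have [measurable]: "(\<lambda>p. f (snd p, fst p)) \<in> borel_measurable (configs \<Otimes>\<^sub>M particles)"
    using f by measurable
  have m2: "(\<lambda>x. \<integral>\<^sup>+K. indicator (\<Delta> n) (circumcentre K) * (ennreal (cond_intensity \<tau> \<beta> g K x) * f (K, x)) \<partial>reference_measure Q) \<in> borel_measurable P" for n
    by (rule \<Lambda>.borel_measurable_nn_integral) (unfold split_beta', measurable)
  have "(\<integral>\<^sup>+x. (\<integral>\<^sup>+K. f (K, x - {K}) \<partial>count_space x) \<partial>P)
    = (\<integral>\<^sup>+x. (\<integral>\<^sup>+K. (SUP n. indicator (\<Delta> n) (circumcentre K) * f (K, x - {K})) \<partial>count_space x) \<partial>P)"
    by (simp only: SUP1)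
  also have "\<dots> = (\<integral>\<^sup>+x. (SUP n. \<integral>\<^sup>+K. indicator (\<Delta> n) (circumcentre K) * f (K, x - {K}) \<partial>count_space x) \<partial>P)"
    by (intro nn_integral_cong nn_integral_monotone_convergence_SUP incseq_SucI le_funI mult_right_mono le) auto
  also have "\<dots> = (SUP n. \<integral>\<^sup>+x. (\<integral>\<^sup>+K. indicator (\<Delta> n) (circumcentre K) * f (K, x - {K}) \<partial>count_space x) \<partial>P)"
    by (intro nn_integral_monotone_convergence_SUP incseq_SucI le_funI nn_integral_mono mult_right_mono le m1) auto
  also have "\<dots> = (SUP n. \<integral>\<^sup>+x. (\<integral>\<^sup>+K. indicator (\<Delta> n) (circumcentre K) * (ennreal (cond_intensity \<tau> \<beta> g K x) * f (K, x)) \<partial>reference_measure Q) \<partial>P)"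
    by (simp only: loc)
  also have "\<dots> = (\<integral>\<^sup>+x. (SUP n. \<integral>\<^sup>+K. indicator (\<Delta> n) (circumcentre K) * (ennreal (cond_intensity \<tau> \<beta> g K x) * f (K, x)) \<partial>reference_measure Q) \<partial>P)"
    by (intro nn_integral_monotone_convergence_SUP[symmetric] incseq_SucI le_funI nn_integral_mono mult_right_mono le m2) auto
  also have "\<dots> = (\<integral>\<^sup>+x. (\<integral>\<^sup>+K. (SUP n. indicator (\<Delta> n) (circumcentre K) * (ennreal (cond_intensity \<tau> \<beta> g K x) * f (K, x))) \<partial>reference_measure Q) \<partial>P)"
  proof (intro nn_integral_cong nn_integral_monotone_convergence_SUP[symmetric] incseq_SucI le_funI mult_right_mono le)
    fix n x assume "x \<in> space P"
    then have [simp]: "x \<in> space configs" by (simp add: spP)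
    have [measurable]: "(\<lambda>K. cond_intensity \<tau> \<beta> g K x) \<in> borel_measurable particles"
      by (rule measurable_cond_intensity[OF g]) measurable
    have [measurable]: "(\<lambda>K. f (K, x)) \<in> borel_measurable particles" using f by measurable
    show "(\<lambda>K. indicator (\<Delta> n) (circumcentre K) * (ennreal (cond_intensity \<tau> \<beta> g K x) * f (K, x))) \<in> borel_measurable (reference_measure Q)"
      by measurable
  qed auto
  also have "\<dots> = (\<integral>\<^sup>+x. (\<integral>\<^sup>+K. ennreal (cond_intensity \<tau> \<beta> g K x) * f (K, x) \<partial>reference_measure Q) \<partial>P)"
    by (simp only: SUP1)
  finally show ?thesis .
qed

subsection \<open>Stein's equation for the normal distribution\<close>

abbreviation \<gamma> :: "real \<Rightarrow> real" where "\<gamma> \<equiv> std_normal_density"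

definition \<Phi> :: "real \<Rightarrow> real" where "\<Phi> = cdf std_normal_distribution"

lemma normal_density_deriv [derivative_intros]:
  assumes "(f has_real_derivative f') (at x within s)"
  shows "((\<lambda>x. \<gamma> (f x)) has_real_derivative - f x * \<gamma> (f x) * f') (at x within s)"
  unfolding std_normal_density_def by (rule derivative_eq_intros assms refl | simp)+

text \<open>F is nondecreasing up to w and starts from the limit 0. The normal tail inequalities
  below follow from this by a choice of auxiliary function, without estimating integrals.\<close>

lemma deriv_from_zero_at_bot:
  fixes F f :: "real \<Rightarrow> real"
  assumes "\<And>x. x \<le> w \<Longrightarrow> (F has_real_derivative f x) (at x)" "\<And>x. x \<le> w \<Longrightarrow> 0 \<le> f x" "(F \<longlongrightarrow> 0) at_bot"
  shows "0 \<le> F w"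
proof (rule tendsto_upperbound[OF assms(3)])
  show "\<forall>\<^sub>F x in at_bot. F x \<le> F w"
    using eventually_le_at_bot[of w]
  proof eventually_elim
    case (elim x)
    show ?case by (rule DERIV_nonneg_imp_nondecreasing[OF elim]) (use assms in blast)
  qed
qed simp

text \<open>The continuous density has some antiderivative F, and the fundamental theorem of
  calculus identifies the mass of {a<..b} with F b - F a; so \<Phi> and F differ by a
  constant.\<close>

lemma \<Phi>_deriv: "(\<Phi> has_real_derivative \<gamma> x) (at x)"
proof -
  interpret real_distribution std_normal_distribution by (rule real_dist_normal_dist)
  have c: "isCont \<gamma> x" for x by (rule DERIV_isCont[OF normal_density_deriv[OF DERIV_ident]])
  obtain F where F: "\<And>x. (F has_vector_derivative \<gamma> x) (at x)"
    using einterval_antiderivative[of "-\<infinity>" "\<infinity>" \<gamma>] c by auto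
  have F': "(F has_real_derivative \<gamma> x) (at x)" for x using F by (simp add: has_real_derivative_iff_has_vector_derivative)
  have diff: "\<Phi> b - \<Phi> a = F b - F a" if ab: "a < b" for a b
  proof -
    have mono: "F a \<le> F b" 
    proof (rule DERIV_nonneg_imp_nondecreasing[of a b F])
      fix x show "\<exists>y. (F has_real_derivative y) (at x) \<and> 0 \<le> y" using F'[of x] by (intro exI[of _ "\<gamma> x"]) simp
    qed (use ab in simp)
    have "emeasure std_normal_distribution {a<..b} = (\<integral>\<^sup>+x. ennreal (\<gamma> x) * indicator {a<..b} x \<partial>lborel)"
      by (rule emeasure_density) auto
    also have "\<dots> = (\<integral>\<^sup>+x. ennreal (\<gamma> x) * indicator {a..b} x \<partial>lborel)"
      by (rule nn_integral_cong_AE, rule AE_I[of _ _ "{a}"]) (auto simp: indicator_def)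
    also have "\<dots> = ennreal (F b - F a)"
      using ab F' by (intro nn_integral_FTC_Icc) (auto intro: DERIV_subset has_field_derivative_at_within)
    finally have "measure std_normal_distribution {a<..b} = F b - F a"
      using mono by (simp add: measure_def)
    then show ?thesis unfolding \<Phi>_def using cdf_diff_eq[OF ab] by simp
  qed
  have "\<Phi> x = F x + (\<Phi> 0 - F 0)" for x
    using diff[of x 0] diff[of 0 x] by (cases x "0::real" rule: linorder_cases) auto
  then have "\<Phi> = (\<lambda>x. F x + (\<Phi> 0 - F 0))" by blast
  moreover have "((\<lambda>x. F x + (\<Phi> 0 - F 0)) has_real_derivative \<gamma> x) (at x)"
    using F' by (auto intro!: derivative_eq_intros)
  ultimately show ?thesis by simp
qed

lemma \<Phi>_deriv' [derivative_intros]: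
  assumes "(f has_real_derivative f') (at x within s)"
  shows "((\<lambda>x. \<Phi> (f x)) has_real_derivative \<gamma> (f x) * f') (at x within s)"
  using DERIV_chain2[OF \<Phi>_deriv assms] .

lemma \<Phi>_lim_top: "(\<Phi> \<longlongrightarrow> 1) at_top" and \<Phi>_lim_bot: "(\<Phi> \<longlongrightarrow> 0) at_bot"
proof -
  interpret real_distribution std_normal_distribution by (rule real_dist_normal_dist)
  show "(\<Phi> \<longlongrightarrow> 1) at_top" "(\<Phi> \<longlongrightarrow> 0) at_bot"
    unfolding \<Phi>_def by (rule cdf_lim_at_top_prob, rule cdf_lim_at_bot)
qed

lemma \<Phi>_nonneg: "0 \<le> \<Phi> x" by (simp add: \<Phi>_def cdf_def)

text \<open>The sum \<Phi> x + \<Phi> (- x) has derivative 0 because the density is even, and its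
  limit at infinity is 1.\<close>

lemma \<Phi>_minus: "\<Phi> (- x) = 1 - \<Phi> x"
proof -
  have "((\<lambda>x. \<Phi> x + \<Phi> (- x)) has_real_derivative 0) (at x)" for x
    by (rule derivative_eq_intros refl | simp add: std_normal_density_def)+
  then have "\<Phi> x + \<Phi> (- x) = \<Phi> 0 + \<Phi> (- 0)" for x by (intro DERIV_isconst_all allI)
  then obtain c where c: "\<And>x. \<Phi> x + \<Phi> (- x) = c" by blast
  have "((\<lambda>x. \<Phi> x + \<Phi> (- x)) \<longlongrightarrow> 1 + 0) at_top"
    by (intro tendsto_add \<Phi>_lim_top filterlim_compose[OF \<Phi>_lim_bot] filterlim_uminus_at_bot_at_top)
  then have "c = 1" unfolding c by (simp add: tendsto_const_iff)
  then show ?thesis using c[of x] by simp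
qed

lemma \<Phi>_le_1: "\<Phi> x \<le> 1" using \<Phi>_nonneg[of "-x"] by (simp add: \<Phi>_minus)

lemma \<Phi>_0: "\<Phi> 0 = 1/2" using \<Phi>_minus[of 0] by simp

lemma \<gamma>_minus: "\<gamma> (- x) = \<gamma> x" by (simp add: std_normal_density_def)
lemma \<gamma>_pos [simp]: "0 < \<gamma> x" by (simp add: std_normal_density_def)

lemma \<gamma>_lim: "(\<gamma> \<longlongrightarrow> 0) at_bot" "((\<lambda>x. x * \<gamma> x) \<longlongrightarrow> 0) at_bot" "(\<gamma> \<longlongrightarrow> 0) at_top"
  unfolding std_normal_density_def by real_asymp+

text \<open>The integral of \<Phi> over the half-line up to w, in closed form.\<close>

definition \<A> :: "real \<Rightarrow> real" where "\<A> w = w * \<Phi> w + \<gamma> w"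

lemma \<A>_deriv [derivative_intros]:
  assumes "(f has_real_derivative f') (at x within s)"
  shows "((\<lambda>x. \<A> (f x)) has_real_derivative \<Phi> (f x) * f') (at x within s)"
  unfolding \<A>_def by (rule derivative_eq_intros assms refl | simp add: algebra_simps)+

text \<open>The factor w is frozen in the auxiliary function, whose derivative (w - x) \<gamma> x is
  nonnegative up to w. Nonpositive w suffice to squeeze \<open>\<A>\<close> to 0 at minus infinity,
  after which \<open>\<A>_nonneg\<close> covers all w.\<close>

lemma \<A>_nonneg_le: "w \<le> 0 \<Longrightarrow> 0 \<le> \<A> w"
proof -
  assume w: "w \<le> 0"
  have "0 \<le> \<gamma> w + w * \<Phi> w"
  proof (rule deriv_from_zero_at_bot[where F="\<lambda>x. \<gamma> x + w * \<Phi> x" and w=w and f="\<lambda>x. (w - x) * \<gamma> x"])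
    show "((\<lambda>x. \<gamma> x + w * \<Phi> x) has_real_derivative (w - x) * \<gamma> x) (at x)" for x
      by (rule derivative_eq_intros refl | simp add: algebra_simps)+
    have "((\<lambda>x. \<gamma> x + w * \<Phi> x) \<longlongrightarrow> 0 + w * 0) at_bot" by (intro tendsto_intros \<gamma>_lim \<Phi>_lim_bot)
    then show "((\<lambda>x. \<gamma> x + w * \<Phi> x) \<longlongrightarrow> 0) at_bot" by simp
  qed simp
  then show ?thesis by (simp add: \<A>_def add.commute)
qed

lemma \<A>_lim_bot: "(\<A> \<longlongrightarrow> 0) at_bot"
proof (rule tendsto_sandwich[OF _ _ tendsto_const \<gamma>_lim(1)])
  show "\<forall>\<^sub>F x in at_bot. 0 \<le> \<A> x" using eventually_le_at_bot[of 0] by eventually_elim (rule \<A>_nonneg_le)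
  show "\<forall>\<^sub>F x in at_bot. \<A> x \<le> \<gamma> x"
    using eventually_le_at_bot[of 0] by eventually_elim (simp add: \<A>_def mult_nonpos_nonneg \<Phi>_nonneg)
qed

lemma \<A>_nonneg: "0 \<le> \<A> w"
  by (rule deriv_from_zero_at_bot[where f=\<Phi>]) (auto intro!: derivative_eq_intros \<Phi>_nonneg \<A>_lim_bot)

text \<open>The expression equals (1 + w^2) \<Phi> w + w \<gamma> w, so for negative w this is the
  classical lower bound on the Mills ratio; its derivative is 2 \<A> w. It fixes the signs of the
  coefficients in the second derivative of the Stein solution.\<close>

lemma mills: "0 \<le> w * \<A> w + \<Phi> w"
proof (rule deriv_from_zero_at_bot[where F="\<lambda>x. x * \<A> x + \<Phi> x" and w=w and f="\<lambda>x. 2 * \<A> x"])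
  show "((\<lambda>x. x * \<A> x + \<Phi> x) has_real_derivative 2 * \<A> x) (at x)" for x
    by (rule derivative_eq_intros refl | simp add: \<A>_def algebra_simps)+
  have "((\<lambda>x. x * \<A> x) \<longlongrightarrow> 0) at_bot"
  proof (rule tendsto_sandwich[OF _ _ \<gamma>_lim(2) tendsto_const])
    show "\<forall>\<^sub>F x in at_bot. x * \<gamma> x \<le> x * \<A> x"
      using eventually_le_at_bot[of 0]
      by eventually_elim (intro mult_left_mono_neg, simp_all add: \<A>_def mult_nonpos_nonneg \<Phi>_nonneg)
    show "\<forall>\<^sub>F x in at_bot. x * \<A> x \<le> 0"
      using eventually_le_at_bot[of 0] by eventually_elim (simp add: mult_nonpos_nonneg \<A>_nonneg)
  qed
  from tendsto_add[OF this \<Phi>_lim_bot] show "((\<lambda>x. x * \<A> x + \<Phi> x) \<longlongrightarrow> 0) at_bot" by simp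
qed (simp add: \<A>_nonneg)

text \<open>This exact value yields the bound 1 both for the Stein solution f and for the part f x +
  x f' x of its second derivative.\<close>

lemma \<A>_\<Phi>: "(1 - \<Phi> w) * \<A> w + \<Phi> w * \<A> (- w) = \<gamma> w"
  by (simp add: \<A>_def \<Phi>_minus \<gamma>_minus algebra_simps)

text \<open>The bound \<open>4 \<A>(w) \<A>(-w) \<le> 4 \<gamma>(0) \<gamma>(w)\<close> is \<open>S\<^sup>2 \<le> T\<close> for \<open>S = \<A>(w) + \<A>(-w) = w (2 \<Phi>(w) - 1) + 2 \<gamma>(w)\<close>,
  as \<open>\<A>(w) - \<A>(-w) = w\<close>. The difference \<open>(sqrt T - 2 \<gamma>) / w - (2 \<Phi> - 1)\<close> vanishes at \<open>0\<close> and at infinity,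
  and the sign of its derivative is opposite to that of the convex function \<open>convex_aux\<close> at \<open>w\<^sup>2\<close>.\<close>

definition convex_aux :: "real \<Rightarrow> real" where
  "convex_aux y = (2 + y)\<^sup>2 - 4 * exp (- y / 2) - 2 * pi * y"

text \<open>Convexity together with the value 0 at 0. Consequently the function changes sign at most
  once on the positive axis, from nonpositive to positive, and this is how it is used.\<close>

lemma convex_aux_scale: "0 \<le> t \<Longrightarrow> t \<le> 1 \<Longrightarrow> 0 \<le> y \<Longrightarrow> convex_aux (t * y) \<le> t * convex_aux y"
proof -
  assume t: "0 \<le> t" "t \<le> 1" "0 \<le> y"
  have "convex_on {0..} convex_aux"
  proof (rule f''_ge0_imp_convex[where f'="\<lambda>y. 2 * (2 + y) + 2 * exp (- y / 2) - 2 * pi" and f''="\<lambda>y. 2 - exp (- y / 2)"])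
    show "(convex_aux has_real_derivative 2 * (2 + x) + 2 * exp (- x / 2) - 2 * pi) (at x)" for x
      unfolding convex_aux_def[abs_def] by (rule derivative_eq_intros refl | simp)+
    show "((\<lambda>y. 2 * (2 + y) + 2 * exp (- y / 2) - 2 * pi) has_real_derivative 2 - exp (- x / 2)) (at x)" for x
      by (rule derivative_eq_intros refl | simp)+
    show "0 \<le> 2 - exp (- x / 2)" if "x \<in> {0..}" for x :: real
    proof -
      have "exp (- x / 2) \<le> 1" using that by simp
      then show ?thesis by linarith
    qed
  qed simp
  from convex_onD[OF this t(1,2), of 0 y] t(3) show ?thesis by (simp add: convex_aux_def)
qed

lemma T_bound_pos:
  assumes w: "0 < w"
  shows "(w * (2 * \<Phi> w - 1) + 2 * \<gamma> w)\<^sup>2 \<le> w\<^sup>2 + 4 * \<gamma> 0 * \<gamma> w"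
proof -
  \<comment> \<open>c is sqrt (2 / pi); with it, 2 \<gamma> v = c * x v, and the right-hand side of
    the claim is T w.\<close>
  define c where "c = 2 * \<gamma> 0"
  have c: "c > 0" by (simp add: c_def)
  have c2: "2 * pi * c\<^sup>2 = 4" by (simp add: c_def std_normal_density_def power_mult_distrib power_divide field_simps)
  define x where "x v = exp (- v\<^sup>2 / 2)" for v :: real
  have \<gamma>x: "2 * \<gamma> v = c * x v" for v by (simp add: c_def x_def std_normal_density_def)
  define T where "T v = v\<^sup>2 + c\<^sup>2 * x v" for v
  have Tpos: "T v > 0" for v unfolding T_def x_def using c by (intro add_nonneg_pos) auto
  have x': "(x has_real_derivative - v * x v) (at v)" for v
    unfolding x_def by (rule derivative_eq_intros refl | simp)+
  define r where "r v = sqrt (T v) - c * x v" for v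
  have T': "(T has_real_derivative 2 * v - c\<^sup>2 * v * x v) (at v)" for v
    unfolding T_def by (rule derivative_eq_intros x' refl | simp)+
  have r': "(r has_real_derivative (2 * v - c\<^sup>2 * v * x v) / (2 * sqrt (T v)) + c * v * x v) (at v)" for v
  proof -
    have "((\<lambda>v. sqrt (T v)) has_real_derivative inverse (sqrt (T v)) / 2 * (2 * v - c\<^sup>2 * v * x v)) (at v)"
      by (rule DERIV_chain2[OF DERIV_real_sqrt[OF Tpos] T'])
    from DERIV_diff[OF this DERIV_cmult[OF x', of c]] show ?thesis
      unfolding r_def using Tpos[of v] by (simp add: field_simps)
  qed
  define Y where "Y v = r v / v - (2 * \<Phi> v - 1)" for v
  \<comment> \<open>The derivative of Y, arranged so that for v > 0 its sign is that of sqrt (T v) -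
    c / 2 * (2 + v^2); \<open>sgn\<close> compares the squares of the two terms.\<close>
  define Y' where "Y' v = c * x v * (sqrt (T v) - c / 2 * (2 + v\<^sup>2)) / (v\<^sup>2 * sqrt (T v))" for v
  have Yd: "(Y has_real_derivative Y' v) (at v)" if v: "v > 0" for v
  proof -
    have "(Y has_real_derivative ((2 * v - c\<^sup>2 * v * x v) / (2 * sqrt (T v)) + c * v * x v) / v - r v / v\<^sup>2 - 2 * \<gamma> v) (at v)"
      unfolding Y_def using v
      by (auto intro!: derivative_eq_intros r' simp: field_simps power2_eq_square)
    also have "((2 * v - c\<^sup>2 * v * x v) / (2 * sqrt (T v)) + c * v * x v) / v - r v / v\<^sup>2 - 2 * \<gamma> v = Y' v"
    proof -
      define s where "s = sqrt (T v)"
      have s: "s > 0" "s\<^sup>2 = v\<^sup>2 + c\<^sup>2 * x v" using Tpos[of v] by (auto simp: s_def T_def)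
      have "((2 * v - c\<^sup>2 * v * x v) / (2 * s) + c * v * x v) / v - (s - c * x v) / v\<^sup>2 - c * x v
          = (v\<^sup>2 - c\<^sup>2 * v\<^sup>2 * x v / 2 - s\<^sup>2 + c * x v * s) / (v\<^sup>2 * s)"
        using v s(1) by (simp add: field_simps power2_eq_square)
      also have "\<dots> = c * x v * (s - c / 2 * (2 + v\<^sup>2)) / (v\<^sup>2 * s)"
        unfolding s(2) by (simp add: field_simps power2_eq_square)
      finally show ?thesis by (simp add: Y'_def r_def s_def \<gamma>x)
    qed
    finally show ?thesis .
  qed
  have sgn: "T v - (c / 2 * (2 + v\<^sup>2))\<^sup>2 = - c\<^sup>2 / 4 * convex_aux (v\<^sup>2)" for v
  proof -
    have "v\<^sup>2 = c\<^sup>2 / 4 * (2 * pi * v\<^sup>2)" using c2 by (simp add: field_simps)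
    then have "T v = c\<^sup>2 / 4 * (2 * pi * v\<^sup>2 + 4 * x v)" unfolding T_def by (simp add: distrib_left)
    then show ?thesis by (simp add: convex_aux_def x_def power_mult_distrib field_simps power2_eq_square)
  qed
  have "0 \<le> Y w"
  \<comment> \<open>If \<open>convex_aux\<close> is nonpositive at w^2, it is so before, and Y
    increases on the way from its limit 0 at 0 up to w. Otherwise it stays positive, and Y decreases
    from w on towards its limit 0 at infinity.\<close>
  proof (cases "convex_aux (w\<^sup>2) \<le> 0")
    case True
    have Y': "0 \<le> Y' v" if v: "0 < v" "v \<le> w" for v
    proof -
      have "convex_aux (v\<^sup>2 / w\<^sup>2 * w\<^sup>2) \<le> v\<^sup>2 / w\<^sup>2 * convex_aux (w\<^sup>2)"
        using v by (intro convex_aux_scale) (auto simp: divide_le_eq power_mono)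
      also have "\<dots> \<le> 0" using True by (intro mult_nonneg_nonpos) auto
      finally have "convex_aux (v\<^sup>2) \<le> 0" using w by simp
      then have "0 \<le> - c\<^sup>2 / 4 * convex_aux (v\<^sup>2)" by (intro mult_nonpos_nonpos) auto
      then have "(c / 2 * (2 + v\<^sup>2))\<^sup>2 \<le> T v" using sgn[of v] by linarith
      then have "c / 2 * (2 + v\<^sup>2) \<le> sqrt (T v)" by (rule real_le_rsqrt)
      then show ?thesis unfolding Y'_def using c v Tpos[of v] by (auto intro!: divide_nonneg_pos mult_nonneg_nonneg simp: x_def)
    qed
    have "\<forall>\<^sub>F v in at_right 0. Y v \<le> Y w"
      using eventually_at_right_less[of "0::real"] eventually_at_right_real[OF w]
    proof (eventually_elim)
      case (elim v)
      show ?case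
      proof (rule DERIV_nonneg_imp_nondecreasing[of v w Y])
        fix z assume "v \<le> z" "z \<le> w"
        then show "\<exists>y. (Y has_real_derivative y) (at z) \<and> 0 \<le> y"
          using elim Yd[of z] Y'[of z] by (intro exI[of _ "Y' z"]) auto
      qed (use elim in simp)
    qed
    moreover have "(Y \<longlongrightarrow> 0) (at_right 0)"
    proof -
      \<comment> \<open>\<open>r\<close> vanishes at 0 together with its derivative, so r v / v
        tends to 0.\<close>
      have r0: "r 0 = 0" using c by (simp add: r_def T_def x_def)
      have "((\<lambda>v. (r (0 + v) - r 0) / v) \<longlongrightarrow> 0) (at 0)"
        using r'[of 0] by (simp add: DERIV_def)
      then have "((\<lambda>v. r v / v) \<longlongrightarrow> 0) (at_right 0)" by (simp add: r0 filterlim_at_split)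
      moreover have "(\<Phi> \<longlongrightarrow> \<Phi> 0) (at_right 0)"
        using DERIV_isCont[OF \<Phi>_deriv[of 0]] by (simp add: isCont_def filterlim_at_split)
      ultimately have "(Y \<longlongrightarrow> 0 - (2 * \<Phi> 0 - 1)) (at_right 0)" unfolding Y_def by (intro tendsto_intros)
      then show ?thesis by (simp add: \<Phi>_0)
    qed
    ultimately show ?thesis by (intro tendsto_upperbound) auto
  next
    case False
    have Y': "Y' v \<le> 0" if v: "w \<le> v" for v
    proof -
      have "convex_aux (w\<^sup>2 / v\<^sup>2 * v\<^sup>2) \<le> w\<^sup>2 / v\<^sup>2 * convex_aux (v\<^sup>2)"
        using v w by (intro convex_aux_scale) (auto simp: divide_le_eq power_mono)
      then have "0 < w\<^sup>2 / v\<^sup>2 * convex_aux (v\<^sup>2)" using False w v by simp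
      then have "0 < convex_aux (v\<^sup>2)" using w v by (simp add: zero_less_mult_iff zero_less_divide_iff)
      then have "- c\<^sup>2 / 4 * convex_aux (v\<^sup>2) \<le> 0" by simp
      then have "T v \<le> (c / 2 * (2 + v\<^sup>2))\<^sup>2" using sgn[of v] by linarith
      then have "sqrt (T v) \<le> c / 2 * (2 + v\<^sup>2)" using c by (intro real_le_lsqrt) auto
      then show ?thesis unfolding Y'_def using c v w Tpos[of v] by (auto intro!: divide_nonpos_pos mult_nonneg_nonpos simp: x_def)
    qed
    have "\<forall>\<^sub>F v in at_top. Y v \<le> Y w"
      using eventually_ge_at_top[of w]
    proof eventually_elim
      case (elim v)
      show ?case
      proof (rule DERIV_nonpos_imp_nonincreasing[of w v Y])
        fix z assume "w \<le> z" "z \<le> v"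
        then show "\<exists>y. (Y has_real_derivative y) (at z) \<and> y \<le> 0"
          using w Yd[of z] Y'[of z] by (intro exI[of _ "Y' z"]) auto
      qed (use elim in simp)
    qed
    moreover have "(Y \<longlongrightarrow> 0) at_top"
    proof -
      have "((\<lambda>v. r v / v) \<longlongrightarrow> 1) at_top" unfolding r_def T_def x_def by real_asymp
      then have "(Y \<longlongrightarrow> 1 - (2 * 1 - 1)) at_top" unfolding Y_def by (intro tendsto_intros \<Phi>_lim_top)
      then show ?thesis by simp
    qed
    ultimately show ?thesis by (intro tendsto_upperbound) auto
  qed
  then have "w * (2 * \<Phi> w - 1) + 2 * \<gamma> w \<le> sqrt (T w)"
    using w by (simp add: Y_def r_def \<gamma>x field_simps)
  moreover have "0 \<le> w * (2 * \<Phi> w - 1) + 2 * \<gamma> w"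
    using \<A>_nonneg[of w] \<A>_nonneg[of "-w"] by (simp add: \<A>_def \<Phi>_minus \<gamma>_minus algebra_simps)
  ultimately have "(w * (2 * \<Phi> w - 1) + 2 * \<gamma> w)\<^sup>2 \<le> (sqrt (T w))\<^sup>2" by (rule power_mono)
  also have "\<dots> = w\<^sup>2 + 4 * \<gamma> 0 * \<gamma> w"
    using Tpos[of w] \<gamma>x[of w] by (simp add: T_def c_def power2_eq_square)
  finally show ?thesis .
qed

lemma \<A>_product: "\<A> w * \<A> (- w) \<le> \<gamma> 0 * \<gamma> w"
proof -
  have sq: "(v * (2 * \<Phi> v - 1) + 2 * \<gamma> v)\<^sup>2 \<le> v\<^sup>2 + 4 * \<gamma> 0 * \<gamma> v" for v
  proof (cases v "0::real" rule: linorder_cases)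
    case less
    then show ?thesis using T_bound_pos[of "-v"] by (simp add: \<Phi>_minus \<gamma>_minus algebra_simps)
  next
    case equal then show ?thesis by (simp add: power2_eq_square)
  qed (rule T_bound_pos)
  have "4 * (\<A> w * \<A> (- w)) = (w * (2 * \<Phi> w - 1) + 2 * \<gamma> w)\<^sup>2 - w\<^sup>2"
    by (simp add: \<A>_def \<Phi>_minus \<gamma>_minus power2_eq_square algebra_simps)
  then show ?thesis using sq[of w] by linarith
qed

text \<open>This constructs the integral of k over the half-line up to x. As |k| is at most the
  derivative \<Phi> of \<open>\<A>\<close>, the increments of any antiderivative p are bounded by
  those of \<open>\<A>\<close>; so p has a limit l along the negative integers, and p - l is
  dominated by \<open>\<A>\<close>.\<close>

lemma dominated_antiderivative:
  fixes k :: "real \<Rightarrow> real"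
  assumes k: "\<And>x. isCont k x" "\<And>x. \<bar>k x\<bar> \<le> \<Phi> x"
  obtains H where "\<And>x. (H has_real_derivative k x) (at x)" "\<And>x. \<bar>H x\<bar> \<le> \<A> x"
proof -
  obtain p where p: "\<And>x. (p has_real_derivative k x) (at x)"
    using einterval_antiderivative[of "-\<infinity>" "\<infinity>" k] k(1)
    by (auto simp: has_real_derivative_iff_has_vector_derivative)
  have diff: "\<bar>p y - p x\<bar> \<le> \<A> y - \<A> x" if "x \<le> y" for x y
  proof -
    have "((\<lambda>z. \<A> z + p z) has_real_derivative \<Phi> z + k z) (at z)" "((\<lambda>z. \<A> z - p z) has_real_derivative \<Phi> z - k z) (at z)" for z
      by (auto intro!: derivative_eq_intros p)
    moreover have "0 \<le> \<Phi> z + k z" "0 \<le> \<Phi> z - k z" for z using k(2)[of z] by auto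
    ultimately have "\<A> x + p x \<le> \<A> y + p y" "\<A> x - p x \<le> \<A> y - p y"
      by (intro DERIV_nonneg_imp_nondecreasing[OF that]; blast)+
    then show ?thesis by linarith
  qed
  have A_n: "(\<lambda>n. \<A> (- real n)) \<longlonglongrightarrow> 0"
    by (rule filterlim_compose[OF \<A>_lim_bot]) real_asymp
  have "Cauchy (\<lambda>n. p (- real n))"
  proof (rule metric_CauchyI)
    fix e :: real assume e: "e > 0"
    obtain N where N: "\<And>n. n \<ge> N \<Longrightarrow> \<A> (- real n) < e / 2"
      using order_tendstoD(2)[OF A_n, of "e/2"] e by (auto simp: eventually_sequentially)
    have "dist (p (- real m)) (p (- real n)) < e" if "m \<ge> N" "n \<ge> N" for m n
    proof -
      have "\<bar>p (- real N) - p (- real j)\<bar> \<le> \<A> (- real N)" if "j \<ge> N" for j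
        using diff[of "- real j" "- real N"] \<A>_nonneg[of "- real j"] that by simp
      from this[OF that(1)] this[OF that(2)] N[of N] show ?thesis by (simp add: dist_real_def)
    qed
    then show "\<exists>M. \<forall>m\<ge>M. \<forall>n\<ge>M. dist (p (- real m)) (p (- real n)) < e" by blast
  qed
  then obtain l where l: "(\<lambda>n. p (- real n)) \<longlonglongrightarrow> l" by (auto simp: Cauchy_convergent_iff convergent_def)
  show ?thesis
  proof (rule that[of "\<lambda>x. p x - l"])
    show "((\<lambda>x. p x - l) has_real_derivative k x) (at x)" for x by (auto intro!: derivative_eq_intros p)
    show "\<bar>p x - l\<bar> \<le> \<A> x" for x
    proof (rule tendsto_upperbound)
      show "(\<lambda>n. \<bar>p x - p (- real n)\<bar>) \<longlonglongrightarrow> \<bar>p x - l\<bar>" by (intro tendsto_intros l)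
      obtain N where N: "- x \<le> real N" using real_arch_simple by blast
      show "\<forall>\<^sub>F n in sequentially. \<bar>p x - p (- real n)\<bar> \<le> \<A> x"
        using eventually_ge_at_top[of N]
      proof eventually_elim
        case (elim n)
        then have "- real n \<le> x" using N by simp
        from diff[OF this] \<A>_nonneg[of "- real n"] show ?case by simp
      qed
    qed simp
  qed
qed

section \<open>The solution of Stein's equation and its derivatives\<close>

lemma integrable_normal_abs: "integrable lborel (\<lambda>x. \<gamma> x * \<bar>x\<bar>)"
  using integrable_std_normal_moment_abs[of 1] by simp

lemma integrable_normal_bound:
  assumes "h \<in> borel_measurable borel" "\<And>x. \<bar>h x\<bar> \<le> C + \<bar>x\<bar>"
  shows "integrable lborel (\<lambda>x. h x * \<gamma> x)"
proof (rule Bochner_Integration.integrable_bound)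
  show "integrable lborel (\<lambda>x. C * \<gamma> x + \<gamma> x * \<bar>x\<bar>)"
    by (intro Bochner_Integration.integrable_add integrable_mult_right integrable_normal_abs) simp
  show "AE x in lborel. norm (h x * \<gamma> x) \<le> norm (C * \<gamma> x + \<gamma> x * \<bar>x\<bar>)"
  proof (rule AE_I2)
    fix x
    have "\<bar>h x\<bar> * \<gamma> x \<le> (C + \<bar>x\<bar>) * \<gamma> x" by (rule mult_right_mono[OF assms(2)]) simp
    then show "norm (h x * \<gamma> x) \<le> norm (C * \<gamma> x + \<gamma> x * \<bar>x\<bar>)" by (simp add: abs_mult algebra_simps)
  qed
qed (use assms(1) in measurable)

text \<open>With H x and K x the integrals of h' \<Phi> up to x and of h' (1 - \<Phi>) from x on, h
  x - E h(Z) = H x - K x. The kernels are nonnegative, so |h'| \<le> 1 bounds H and K by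
  \<open>\<A> x\<close> and \<open>\<A> (- x)\<close>; f, f' and f + x f' are combinations of H and
  K with coefficients of known sign.\<close>

theorem stein_equation_C1:
  fixes h h' :: "real \<Rightarrow> real"
  assumes h: "\<And>x. (h has_real_derivative h' x) (at x)" and h': "\<And>x. isCont h' x" "\<And>x. \<bar>h' x\<bar> \<le> 1"
  obtains f f' where "\<And>x. (f has_real_derivative f' x) (at x)" "\<And>x. \<bar>f x\<bar> \<le> 1"
    "\<And>x. \<bar>f' x\<bar> \<le> sqrt (2 / pi)" "\<And>x y. \<bar>f' x - f' y\<bar> \<le> 2 * \<bar>x - y\<bar>"
    "\<And>x. f' x - x * f x = h x - (\<integral>y. h y * \<gamma> y \<partial>lborel)"
proof -
  have c\<Phi>: "isCont \<Phi> x" for x by (rule DERIV_isCont[OF \<Phi>_deriv])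
  have le: "\<bar>h' y * \<Phi> x\<bar> \<le> \<Phi> x" for x y
    using mult_right_mono[OF h'(2)[of y] \<Phi>_nonneg[of x]] by (simp add: abs_mult \<Phi>_nonneg)
  obtain H where H: "\<And>x. (H has_real_derivative h' x * \<Phi> x) (at x)" "\<And>x. \<bar>H x\<bar> \<le> \<A> x"
    by (rule dominated_antiderivative[of "\<lambda>x. h' x * \<Phi> x"]) (auto intro!: continuous_intros h' c\<Phi> le)
  have c': "isCont (\<lambda>x. h' (- x)) x" for x
    by (rule isCont_o2[of x uminus h']) (auto intro!: continuous_intros h')
  obtain J where J: "\<And>x. (J has_real_derivative h' (- x) * \<Phi> x) (at x)" "\<And>x. \<bar>J x\<bar> \<le> \<A> x"
    by (rule dominated_antiderivative[of "\<lambda>x. h' (- x) * \<Phi> x"]) (auto intro!: continuous_intros c' c\<Phi> le)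
  \<comment> \<open>1 - \<Phi> x = \<Phi> (- x) turns the right tail integral of h' (1 - \<Phi>)
    into a left tail integral for the reflected h'.\<close>
  define K where "K x = J (- x)" for x
  have K: "(K has_real_derivative - (h' x * (1 - \<Phi> x))) (at x)" "\<bar>K x\<bar> \<le> \<A> (- x)" for x
  proof -
    have "(K has_real_derivative h' (- (- x)) * \<Phi> (- x) * (- 1)) (at x)"
      unfolding K_def by (rule DERIV_chain2[OF J(1)]) (auto intro!: derivative_eq_intros)
    then show "(K has_real_derivative - (h' x * (1 - \<Phi> x))) (at x)" by (simp add: \<Phi>_minus)
    show "\<bar>K x\<bar> \<le> \<A> (- x)" unfolding K_def by (rule J(2))
  qed
  \<comment> \<open>The usual integral formula for the Stein solution after integration by parts,
    which replaces h - E h(Z) by h'.\<close>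
  define f where "f x = - ((1 - \<Phi> x) * H x + \<Phi> x * K x) / \<gamma> x" for x
  define f' where "f' x = x * f x + H x - K x" for x
  have nz: "\<gamma> x \<noteq> 0" for x using \<gamma>_pos[of x] by linarith
  have f: "(f has_real_derivative f' x) (at x)" for x
  proof -
    have "(f has_real_derivative
      (- ((- \<gamma> x) * H x + h' x * \<Phi> x * (1 - \<Phi> x) + (\<gamma> x * K x + - (h' x * (1 - \<Phi> x)) * \<Phi> x)) * \<gamma> x
        - - ((1 - \<Phi> x) * H x + \<Phi> x * K x) * (- x * \<gamma> x)) / (\<gamma> x * \<gamma> x)) (at x)"
      unfolding f_def by (rule derivative_eq_intros H(1) K(1) \<Phi>_deriv refl nz | simp)+
    also have "(- ((- \<gamma> x) * H x + h' x * \<Phi> x * (1 - \<Phi> x) + (\<gamma> x * K x + - (h' x * (1 - \<Phi> x)) * \<Phi> x)) * \<gamma> x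
        - - ((1 - \<Phi> x) * H x + \<Phi> x * K x) * (- x * \<gamma> x)) / (\<gamma> x * \<gamma> x) = f' x"
      unfolding f'_def f_def using nz[of x] by (simp add: field_simps)
    finally show ?thesis .
  qed
  have f'_deriv: "(f' has_real_derivative f x + x * f' x + h' x) (at x)" for x
    unfolding f'_def[abs_def]
    by (rule derivative_eq_intros H(1) K(1) f refl | simp add: f'_def algebra_simps)+
  have comb: "\<bar>(a * H x + b * K x) / \<gamma> x\<bar> \<le> (\<bar>a\<bar> * \<A> x + \<bar>b\<bar> * \<A> (- x)) / \<gamma> x" for a b x
  proof -
    have "\<bar>a * H x + b * K x\<bar> \<le> \<bar>a\<bar> * \<bar>H x\<bar> + \<bar>b\<bar> * \<bar>K x\<bar>" using abs_triangle_ineq[of "a * H x" "b * K x"] by (simp add: abs_mult)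
    also have "\<dots> \<le> \<bar>a\<bar> * \<A> x + \<bar>b\<bar> * \<A> (- x)" by (intro add_mono mult_left_mono H K) auto
    finally show ?thesis using \<gamma>_pos[of x] by (simp add: divide_right_mono)
  qed
  have f_le: "\<bar>f x\<bar> \<le> 1" for x
  proof -
    have "\<bar>f x\<bar> \<le> ((1 - \<Phi> x) * \<A> x + \<Phi> x * \<A> (- x)) / \<gamma> x"
    proof -
      have "f x = ((- (1 - \<Phi> x)) * H x + (- \<Phi> x) * K x) / \<gamma> x" unfolding f_def by (simp add: algebra_simps)
      moreover have "\<bar>- (1 - \<Phi> x)\<bar> = 1 - \<Phi> x" "\<bar>- \<Phi> x\<bar> = \<Phi> x" using \<Phi>_nonneg[of x] \<Phi>_le_1[of x] by auto
      ultimately show ?thesis using comb[of "- (1 - \<Phi> x)" x "- \<Phi> x"] by simp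
    qed
    then show ?thesis using nz[of x] by (simp add: \<A>_\<Phi>)
  qed
  have f'_eq: "f' x = (\<A> (- x) * H x + (- \<A> x) * K x) / \<gamma> x" for x
    unfolding f'_def f_def using nz[of x] by (simp add: \<A>_def \<Phi>_minus \<gamma>_minus field_simps)
  \<comment> \<open>Both products are \<A> x * \<A> (- x), so the bound is twice this over \<gamma>
    x, and \<open>\<A>_product\<close> reduces it to 2 \<gamma> 0 = sqrt (2 / pi).\<close>
  have f'_le: "\<bar>f' x\<bar> \<le> sqrt (2 / pi)" for x
  proof -
    have "\<bar>f' x\<bar> \<le> (\<A> (- x) * \<A> x + \<A> x * \<A> (- x)) / \<gamma> x"
      using comb[of "\<A> (- x)" x "- \<A> x"] \<A>_nonneg[of x] \<A>_nonneg[of "-x"] by (simp add: f'_eq)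
    also have "\<dots> \<le> 2 * \<gamma> 0"
      using \<A>_product[of x] \<gamma>_pos[of x] by (simp add: divide_le_eq mult.commute)
    also have "2 * \<gamma> 0 = sqrt (2 / pi)"
    proof -
      have "2 * \<gamma> 0 = 2 / (sqrt 2 * sqrt pi)" by (simp add: std_normal_density_def real_sqrt_mult)
      also have "\<dots> = sqrt 2 / sqrt pi" by (simp add: real_div_sqrt field_simps)
      finally show ?thesis by (simp add: real_sqrt_divide)
    qed
    finally show ?thesis .
  qed
  have f''_eq: "f x + x * f' x = ((x * \<A> (- x) - (1 - \<Phi> x)) * H x + (- (x * \<A> x + \<Phi> x)) * K x) / \<gamma> x" for x
    unfolding f'_eq f_def using nz[of x] by (simp add: field_simps)
  \<comment> \<open>By \<open>mills\<close> the coefficients of H and K are both nonpositive, so f +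
    x f' is at most 1 in absolute value by \<open>\<A>_\<Phi>\<close>; h' contributes another 1,
    which makes the Lipschitz constant 2.\<close>
  have f''_le: "\<bar>f x + x * f' x + h' x\<bar> \<le> 2" for x
  proof -
    have m: "0 \<le> (1 - \<Phi> x) - x * \<A> (- x)" "0 \<le> x * \<A> x + \<Phi> x"
      using mills[of "-x"] mills[of x] by (auto simp: \<Phi>_minus)
    have "\<bar>f x + x * f' x\<bar> \<le> (((1 - \<Phi> x) - x * \<A> (- x)) * \<A> x + (x * \<A> x + \<Phi> x) * \<A> (- x)) / \<gamma> x"
    proof -
      have "\<bar>x * \<A> (- x) - (1 - \<Phi> x)\<bar> = (1 - \<Phi> x) - x * \<A> (- x)" "\<bar>- (x * \<A> x + \<Phi> x)\<bar> = x * \<A> x + \<Phi> x"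
        using m by auto
      then show ?thesis unfolding f''_eq using comb[of "x * \<A> (- x) - (1 - \<Phi> x)" x "- (x * \<A> x + \<Phi> x)"] by (simp only:)
    qed
    also have "((1 - \<Phi> x) - x * \<A> (- x)) * \<A> x + (x * \<A> x + \<Phi> x) * \<A> (- x) = \<gamma> x"
      using \<A>_\<Phi>[of x] by (simp add: algebra_simps)
    finally have "\<bar>f x + x * f' x\<bar> \<le> 1" using nz[of x] by simp
    then show ?thesis using h'(2)[of x] by linarith
  qed
  have lip: "\<bar>f' x - f' y\<bar> \<le> 2 * \<bar>x - y\<bar>" for x y
    using field_differentiable_bound[of UNIV f' "\<lambda>x. f x + x * f' x + h' x" 2 x y] f'_deriv f''_le
    by (auto simp: dist_norm)
  have "((\<lambda>x. H x - K x - h x) has_real_derivative 0) (at x)" for x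
    by (rule derivative_eq_intros H(1) K(1) h refl | simp add: algebra_simps)+
  then have "H x - K x - h x = H 0 - K 0 - h 0" for x by (intro DERIV_isconst_all[of "\<lambda>x. H x - K x - h x"] allI)
  then obtain c where c: "\<And>x. H x - K x = h x - c" by (metis add.commute diff_add_cancel minus_diff_eq diff_minus_eq_add)
  \<comment> \<open>The constant is identified by integrating (h - c) \<gamma>, the derivative of f
    \<gamma>, over the line, where f \<gamma> vanishes at both ends.\<close>
  have "c = (\<integral>y. h y * \<gamma> y \<partial>lborel)"
  proof -
    have ch: "isCont h x" for x by (rule DERIV_isCont[OF h])
    have mh: "h \<in> borel_measurable borel" using ch by (intro borel_measurable_continuous_onI continuous_at_imp_continuous_on) auto
    have hb: "\<bar>h x\<bar> \<le> \<bar>h 0\<bar> + \<bar>x\<bar>" for x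
    proof -
      have "\<bar>h x - h 0\<bar> \<le> 1 * \<bar>x - 0\<bar>"
        using field_differentiable_bound[of UNIV h h' 1 x 0] h h'(2) by (auto simp: dist_norm)
      then have "\<bar>h x - h 0\<bar> \<le> \<bar>x\<bar>" by simp
      then show ?thesis by linarith
    qed
    have int: "integrable lborel (\<lambda>x. h x * \<gamma> x)" by (rule integrable_normal_bound[OF mh hb])
    have int': "integrable lborel (\<lambda>x. (h x - c) * \<gamma> x)"
      unfolding left_diff_distrib by (intro Bochner_Integration.integrable_diff int integrable_mult_right) simp
    have d: "((\<lambda>x. f x * \<gamma> x) has_real_derivative (h x - c) * \<gamma> x) (at x)" for x
      by (rule derivative_eq_intros f refl | simp add: f'_def c[symmetric] algebra_simps)+
    have b: "\<bar>f x * \<gamma> x\<bar> \<le> \<gamma> x" for x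
      using mult_right_mono[OF f_le[of x], of "\<gamma> x"] by (simp add: abs_mult)
    have lim: "((\<lambda>x. f x * \<gamma> x) \<longlongrightarrow> 0) at_top" "((\<lambda>x. f x * \<gamma> x) \<longlongrightarrow> 0) at_bot"
      using b by (auto intro!: Lim_null_comparison[OF _ \<gamma>_lim(3)] Lim_null_comparison[OF _ \<gamma>_lim(1)])
    have "(LBINT x=-\<infinity>..\<infinity>. (h x - c) * \<gamma> x) = 0 - 0"
    proof (rule interval_integral_FTC_integrable[where F="\<lambda>x. f x * \<gamma> x"])
      show "((\<lambda>x. f x * \<gamma> x) has_vector_derivative (h x - c) * \<gamma> x) (at x)" for x
        using d by (simp add: has_real_derivative_iff_has_vector_derivative)
      show "isCont (\<lambda>x. (h x - c) * \<gamma> x) x" for x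
        by (intro continuous_intros ch DERIV_isCont[OF normal_density_deriv[OF DERIV_ident]])
      show "set_integrable lborel (einterval (-\<infinity>) \<infinity>) (\<lambda>x. (h x - c) * \<gamma> x)" using int' by (simp add: set_integrable_def)
    qed (use lim in \<open>simp_all add: ereal_tendsto_simps\<close>)
    then have "(\<integral>x. (h x - c) * \<gamma> x \<partial>lborel) = 0"
      by (simp add: interval_lebesgue_integral_def set_lebesgue_integral_def)
    then have "(\<integral>x. h x * \<gamma> x \<partial>lborel) - c * (\<integral>x. \<gamma> x \<partial>lborel) = 0"
      using int unfolding left_diff_distrib by (subst (asm) Bochner_Integration.integral_diff) auto
    then show ?thesis by simp
  qed
  then have "f' x - x * f x = h x - (\<integral>y. h y * \<gamma> y \<partial>lborel)" for x using c[of x] by (simp add: f'_def)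
  with f f_le f'_le lip show ?thesis by (rule that)
qed

text \<open>k is the mean of h over the interval from x to x + e. Its derivative is the difference
  quotient of h, which is continuous and bounded by the Lipschitz constant.\<close>

lemma lipschitz_smoothing:
  fixes h :: "real \<Rightarrow> real"
  assumes h: "1-lipschitz_on UNIV h" and e: "0 < e"
  obtains k k' where "\<And>x. (k has_real_derivative k' x) (at x)" "\<And>x. isCont k' x" "\<And>x. \<bar>k' x\<bar> \<le> 1" "\<And>x. \<bar>k x - h x\<bar> \<le> e"
proof -
  have L: "\<bar>h x - h y\<bar> \<le> \<bar>x - y\<bar>" for x y
    using lipschitz_onD[OF h, of x y] by (simp add: dist_real_def)
  have c: "isCont h x" for x
    using lipschitz_on_continuous_on[OF h] by (simp add: continuous_on_eq_continuous_at)
  obtain p where p: "\<And>x. (p has_real_derivative h x) (at x)"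
    using einterval_antiderivative[of "-\<infinity>" "\<infinity>" h] c
    by (auto simp: has_real_derivative_iff_has_vector_derivative)
  show ?thesis
  proof (rule that[of "\<lambda>x. (p (x + e) - p x) / e" "\<lambda>x. (h (x + e) - h x) / e"])
    show "((\<lambda>x. (p (x + e) - p x) / e) has_real_derivative (h (x + e) - h x) / e) (at x)" for x
      using e by (auto intro!: derivative_eq_intros p DERIV_chain2[of p])
    show "isCont (\<lambda>x. (h (x + e) - h x) / e) x" for x
      using e by (intro continuous_intros c isCont_o2[where g=h and f="\<lambda>x. x + e"]) auto
    show "\<bar>(h (x + e) - h x) / e\<bar> \<le> 1" for x
      using L[of "x + e" x] e by (simp add: divide_le_eq)
    show "\<bar>(p (x + e) - p x) / e - h x\<bar> \<le> e" for x
    proof -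
      obtain z where z: "x < z" "z < x + e" "p (x + e) - p x = (x + e - x) * h z"
        using MVT2[of x "x + e" p h] e p by auto
      then have "(p (x + e) - p x) / e = h z" using e by simp
      then show ?thesis using L[of z x] z by simp
    qed
  qed
qed

subsection \<open>Normal approximation of the innovation\<close>

text \<open>Along a + s e with e = 1 or e = - 1, both s^2 plus and s^2 minus the remainder vanish at
  s = 0 and have nonnegative derivative, because f' changes by at most 2 s.\<close>

lemma taylor_lipschitz_deriv:
  fixes f f' :: "real \<Rightarrow> real"
  assumes f: "\<And>x. (f has_real_derivative f' x) (at x)" and lip: "\<And>x y. \<bar>f' x - f' y\<bar> \<le> 2 * \<bar>x - y\<bar>"
  shows "\<bar>f (a + d) - f a - f' a * d\<bar> \<le> d\<^sup>2"
proof -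
  have d1: "((\<lambda>s. s\<^sup>2 - (f (a + s * e) - f a - f' a * (s * e))) has_real_derivative 2 * s - (f' (a + s * e) - f' a) * e) (at s)"
    and d2: "((\<lambda>s. s\<^sup>2 + (f (a + s * e) - f a - f' a * (s * e))) has_real_derivative 2 * s + (f' (a + s * e) - f' a) * e) (at s)" for s e
    by (auto intro!: derivative_eq_intros DERIV_chain2[OF f] simp: algebra_simps)
  have main: "\<bar>f (a + s * e) - f a - f' a * (s * e)\<bar> \<le> s\<^sup>2" if s: "0 \<le> s" and e: "\<bar>e\<bar> = 1" for s e
  proof -
    have b: "\<bar>(f' (a + z * e) - f' a) * e\<bar> \<le> 2 * z" if "0 \<le> z" for z
      using lip[of "a + z * e" a] that e by (simp add: abs_mult)
    have "0\<^sup>2 - (f (a + 0 * e) - f a - f' a * (0 * e)) \<le> s\<^sup>2 - (f (a + s * e) - f a - f' a * (s * e))"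
    proof (rule DERIV_nonneg_imp_nondecreasing[OF s])
      fix z assume "0 \<le> z" "z \<le> s"
      then show "\<exists>y. ((\<lambda>s. s\<^sup>2 - (f (a + s * e) - f a - f' a * (s * e))) has_real_derivative y) (at z) \<and> 0 \<le> y"
        using d1[of e z] b[of z] by (intro exI[of _ "2 * z - (f' (a + z * e) - f' a) * e"]) auto
    qed
    moreover have "0\<^sup>2 + (f (a + 0 * e) - f a - f' a * (0 * e)) \<le> s\<^sup>2 + (f (a + s * e) - f a - f' a * (s * e))"
    proof (rule DERIV_nonneg_imp_nondecreasing[OF s])
      fix z assume "0 \<le> z" "z \<le> s"
      then show "\<exists>y. ((\<lambda>s. s\<^sup>2 + (f (a + s * e) - f a - f' a * (s * e))) has_real_derivative y) (at z) \<and> 0 \<le> y"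
        using d2[of e z] b[of z] by (intro exI[of _ "2 * z + (f' (a + z * e) - f' a) * e"]) auto
    qed
    ultimately show ?thesis by (simp add: abs_le_iff)
  qed
  show ?thesis
  proof (cases "0 \<le> d")
    case True then show ?thesis using main[of d 1] by simp
  next
    case False then show ?thesis using main[of "- d" "- 1"] by simp
  qed
qed

lemma (in prob_space) expectation_abs_le_sqrt:
  fixes Y :: "'a \<Rightarrow> real"
  assumes "random_variable borel Y" "integrable M (\<lambda>x. (Y x)\<^sup>2)"
  shows "expectation (\<lambda>x. \<bar>Y x\<bar>) \<le> sqrt (expectation (\<lambda>x. (Y x)\<^sup>2))"
proof (rule real_le_rsqrt)
  have "integrable M (\<lambda>x. \<bar>Y x\<bar>)"
    by (rule square_integrable_imp_integrable) (use assms in auto)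
  from variance_eq[OF this] assms(2) variance_positive[of "\<lambda>x. \<bar>Y x\<bar>"]
  show "(expectation (\<lambda>x. \<bar>Y x\<bar>))\<^sup>2 \<le> expectation (\<lambda>x. (Y x)\<^sup>2)" by simp
qed

lemma abs_integral_le:
  fixes f g :: "'b \<Rightarrow> real"
  assumes "integrable M f" "integrable M g" "AE x in M. \<bar>f x\<bar> \<le> g x"
  shows "\<bar>\<integral>x. f x \<partial>M\<bar> \<le> (\<integral>x. g x \<partial>M)"
  using integral_abs_bound[of M f] integral_mono_AE[OF Bochner_Integration.integrable_abs[OF assms(1)] assms(2,3)]
  by linarith

lemma integral_enn2real:
  assumes [measurable]: "S \<in> borel_measurable M" and fin: "(\<integral>\<^sup>+x. S x \<partial>M) < \<infinity>"
  shows "integrable M (\<lambda>x. enn2real (S x))" "(\<integral>x. enn2real (S x) \<partial>M) = enn2real (\<integral>\<^sup>+x. S x \<partial>M)"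
proof -
  have "AE x in M. S x \<noteq> \<infinity>" using fin by (intro nn_integral_PInf_AE) auto
  then have e: "(\<integral>\<^sup>+x. ennreal (enn2real (S x)) \<partial>M) = (\<integral>\<^sup>+x. S x \<partial>M)"
    by (intro nn_integral_cong_AE) (auto elim!: eventually_mono simp: less_top)
  show "integrable M (\<lambda>x. enn2real (S x))"
    by (rule integrableI_nonneg) (use e fin in auto)
  show "(\<integral>x. enn2real (S x) \<partial>M) = enn2real (\<integral>\<^sup>+x. S x \<partial>M)"
    by (subst integral_eq_nn_integral) (auto simp: e)
qed

lemma ennreal_minus_neg_mult: "0 \<le> c \<Longrightarrow> ennreal c * ennreal (- h) = ennreal (- (h * c))"
  by (subst ennreal_mult'[symmetric]) (auto simp: mult.commute)

text \<open>What the normal approximation uses of the Gibbs process: the GNZ equation and the bounds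
  on its conditional intensity c. The number q stands for |1 - exp (- \<beta> a)| and bounds,
  relative to \<tau>, the change of c caused by one more particle.\<close>

locale innovation_setting =
  fixes \<Lambda> :: "'a::euclidean_space set measure" and P :: "'a set set measure"
    and c :: "'a set \<Rightarrow> 'a set set \<Rightarrow> real" and \<tau> q :: real and \<phi> :: "'a set \<Rightarrow> real"
  assumes sets_\<Lambda> [measurable_cong]: "sets \<Lambda> = sets particles" and sf: "sigma_finite_measure \<Lambda>"
    and P: "prob_space P" and sets_P [measurable_cong]: "sets P = sets configs"
    and c_measurable: "(\<lambda>p. c (fst p) (snd p)) \<in> borel_measurable (particles \<Otimes>\<^sub>M configs)"
    and c_pos: "\<And>K x. K \<in> space particles \<Longrightarrow> x \<in> space configs \<Longrightarrow> 0 < c K x"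
    and c_le: "\<And>K x. K \<in> space particles \<Longrightarrow> x \<in> space configs \<Longrightarrow> c K x \<le> \<tau>"
    and c_insert: "\<And>K L x. K \<in> space particles \<Longrightarrow> L \<in> space particles \<Longrightarrow> x \<in> space configs \<Longrightarrow> K \<notin> x \<Longrightarrow>
      \<bar>c L (insert K x) - c L x\<bar> \<le> \<tau> * q"
    and gnz: "\<And>f. f \<in> borel_measurable (particles \<Otimes>\<^sub>M configs) \<Longrightarrow>
      (\<integral>\<^sup>+x. (\<integral>\<^sup>+K. f (K, x - {K}) \<partial>count_space x) \<partial>P) = (\<integral>\<^sup>+x. (\<integral>\<^sup>+K. ennreal (c K x) * f (K, x) \<partial>\<Lambda>) \<partial>P)"
    and \<tau>: "0 < \<tau>" and q: "0 \<le> q"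
    and \<phi> [measurable]: "\<phi> \<in> borel_measurable particles"
    and int1: "integrable \<Lambda> \<phi>" and int2: "integrable \<Lambda> (\<lambda>K. (\<phi> K)\<^sup>2)"
begin

sublocale P: prob_space P by (rule P)
sublocale \<Lambda>: sigma_finite_measure \<Lambda> by (rule sf)

lemma space_P: "space P = space configs" by (rule sets_eq_imp_space_eq[OF sets_P])
lemma space_\<Lambda>: "space \<Lambda> = space particles" by (rule sets_eq_imp_space_eq[OF sets_\<Lambda>])

lemma measurable_c [measurable (raw)]:
  assumes [measurable]: "k \<in> measurable M particles" "X \<in> measurable M configs"
  shows "(\<lambda>z. c (k z) (X z)) \<in> borel_measurable M"
  using measurable_compose[OF _ c_measurable, of "\<lambda>z. (k z, X z)" M] by simp

lemma c_abs: "K \<in> space particles \<Longrightarrow> x \<in> space configs \<Longrightarrow> \<bar>c K x\<bar> \<le> \<tau>"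
  using c_pos[of K x] c_le[of K x] by simp

definition "n1 = (\<integral>K. \<bar>\<phi> K\<bar> \<partial>\<Lambda>)"
definition "s = (\<integral>K. (\<phi> K)\<^sup>2 \<partial>\<Lambda>)"

lemma n1_nonneg: "0 \<le> n1" and s_nonneg: "0 \<le> s" by (simp_all add: n1_def s_def)

lemma integrable_abs: "integrable \<Lambda> (\<lambda>K. \<bar>\<phi> K\<bar>)" using int1 by (rule integrable_abs)

lemma integrable_c:
  assumes [measurable]: "h \<in> borel_measurable particles" and h: "\<And>K. K \<in> space particles \<Longrightarrow> \<bar>h K\<bar> \<le> \<bar>k K\<bar>"
    and k: "integrable \<Lambda> k" and [simp]: "x \<in> space configs"
  shows "integrable \<Lambda> (\<lambda>K. h K * c K x)"
proof (rule Bochner_Integration.integrable_bound)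
  show "integrable \<Lambda> (\<lambda>K. k K * \<tau>)" using k by simp
  show "AE K in \<Lambda>. norm (h K * c K x) \<le> norm (k K * \<tau>)"
    using h c_abs[of _ x] \<tau> by (intro AE_I2) (auto simp: abs_mult space_\<Lambda> intro!: mult_mono)
qed measurable

text \<open>Positive and negative parts satisfy the nonnegative GNZ equation separately. Domination
  by the integrable |\<phi>| and c \<le> \<tau> make all the integrals finite, so the difference can
  be formed.\<close>

lemma gnz_real:
  assumes H [measurable]: "(\<lambda>p. H (fst p) (snd p)) \<in> borel_measurable (particles \<Otimes>\<^sub>M configs)"
    and le: "\<And>K x. K \<in> space particles \<Longrightarrow> x \<in> space configs \<Longrightarrow> \<bar>H K x\<bar> \<le> \<bar>\<phi> K\<bar>"
  shows "integrable P (\<lambda>x. \<Sum>\<^sub>\<infinity>K\<in>x. H K (x - {K}))"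
    and "integrable P (\<lambda>x. \<integral>K. H K x * c K x \<partial>\<Lambda>)"
    and "(\<integral>x. (\<Sum>\<^sub>\<infinity>K\<in>x. H K (x - {K})) \<partial>P) = (\<integral>x. (\<integral>K. H K x * c K x \<partial>\<Lambda>) \<partial>P)"
    and "AE x in P. (\<lambda>K. H K (x - {K})) summable_on x"
proof -
  \<comment> \<open>\<open>ennreal\<close> sends negative numbers to 0, so the sign e = 1 or e = - 1
    selects the positive or the negative part.\<close>
  define S where "S e x = (\<integral>\<^sup>+K. ennreal (e * H K (x - {K})) \<partial>count_space x)" for e :: real and x
  define T where "T e x = (\<integral>\<^sup>+K. ennreal (c K x) * ennreal (e * H K x) \<partial>\<Lambda>)" for e :: real and x
  have Hx: "(\<lambda>K. H K x) \<in> borel_measurable particles" if "x \<in> space configs" for x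
    using measurable_compose[OF measurable_Pair2'[OF that] H] by simp
  have mS [measurable]: "S e \<in> borel_measurable P" for e
  proof -
    have "(\<lambda>p. ennreal (e * H (fst p) (snd p))) \<in> borel_measurable (particles \<Otimes>\<^sub>M configs)" by measurable
    from measurable_removed[OF this] show ?thesis by (simp add: S_def[abs_def])
  qed
  have [measurable]: "(\<lambda>p. H (snd p) (fst p)) \<in> borel_measurable (configs \<Otimes>\<^sub>M particles)"
    using measurable_compose[OF _ H, of "\<lambda>p. (snd p, fst p)" "configs \<Otimes>\<^sub>M particles"] by simp
  have mT [measurable]: "T e \<in> borel_measurable P" for e
    unfolding T_def[abs_def] by (rule \<Lambda>.borel_measurable_nn_integral) (unfold split_beta', measurable)
  have ST: "(\<integral>\<^sup>+x. S e x \<partial>P) = (\<integral>\<^sup>+x. T e x \<partial>P)" for e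
  proof -
    have "(\<lambda>p. ennreal (e * H (fst p) (snd p))) \<in> borel_measurable (particles \<Otimes>\<^sub>M configs)" by measurable
    from gnz[OF this] show ?thesis by (simp add: S_def T_def)
  qed
  have T_le: "T e x \<le> ennreal (\<tau> * n1)" if e: "\<bar>e\<bar> = 1" and x: "x \<in> space configs" for e x
  proof -
    have "T e x \<le> (\<integral>\<^sup>+K. ennreal (\<tau> * \<bar>\<phi> K\<bar>) \<partial>\<Lambda>)"
      unfolding T_def
    proof (rule nn_integral_mono)
      fix K assume "K \<in> space \<Lambda>"
      then have K: "K \<in> space particles" by (simp add: space_\<Lambda>)
      have "e * H K x \<le> \<bar>\<phi> K\<bar>" using le[OF K x] e by (metis abs_le_D1 abs_mult mult_1)
      then have "ennreal (c K x) * ennreal (e * H K x) \<le> ennreal \<tau> * ennreal \<bar>\<phi> K\<bar>"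
        using c_le[OF K x] by (intro mult_mono ennreal_leI) auto
      also have "\<dots> = ennreal (\<tau> * \<bar>\<phi> K\<bar>)" using \<tau> by (simp add: ennreal_mult)
      finally show "ennreal (c K x) * ennreal (e * H K x) \<le> ennreal (\<tau> * \<bar>\<phi> K\<bar>)" .
    qed
    also have "\<dots> = ennreal (\<tau> * n1)"
      using integrable_abs \<tau> by (subst nn_integral_eq_integral) (auto simp: n1_def)
    finally show ?thesis .
  qed
  have T_fin: "(\<integral>\<^sup>+x. T e x \<partial>P) < \<infinity>" if e: "\<bar>e\<bar> = 1" for e
  proof -
    have "(\<integral>\<^sup>+x. T e x \<partial>P) \<le> (\<integral>\<^sup>+x. ennreal (\<tau> * n1) \<partial>P)"
      by (rule nn_integral_mono) (use T_le[OF e] space_P in auto)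
    also have "\<dots> < \<infinity>" by (simp add: P.emeasure_space_1)
    finally show ?thesis .
  qed
  have S_fin: "(\<integral>\<^sup>+x. S e x \<partial>P) < \<infinity>" if "\<bar>e\<bar> = 1" for e using T_fin[OF that] ST by simp
  have AS: "AE x in P. S 1 x \<noteq> \<infinity> \<and> S (- 1) x \<noteq> \<infinity>"
    using nn_integral_PInf_AE[OF mS[of 1]] nn_integral_PInf_AE[OF mS[of "- 1"]] S_fin[of 1] S_fin[of "- 1"]
    by auto
  have A: "AE x in P. (\<lambda>K. H K (x - {K})) summable_on x \<and> (\<Sum>\<^sub>\<infinity>K\<in>x. H K (x - {K})) = enn2real (S 1 x) - enn2real (S (- 1) x)"
    using AS
  proof eventually_elim
    case (elim x)
    have i: "integrable (count_space x) (\<lambda>K. H K (x - {K}))"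
      using elim by (simp add: real_integrable_def S_def)
    then have "Infinite_Set_Sum.abs_summable_on (\<lambda>K. H K (x - {K})) x" by (simp add: Infinite_Set_Sum.abs_summable_on_def)
    then have "(\<lambda>K. H K (x - {K})) summable_on x"
      by (metis abs_summable_equivalent summable_on_iff_abs_summable_on_real)
    then show ?case using i by (simp add: infsum_eq_integral_count_space real_lebesgue_integral_def S_def)
  qed
  then show "AE x in P. (\<lambda>K. H K (x - {K})) summable_on x" by eventually_elim simp
  have B: "(\<integral>K. H K x * c K x \<partial>\<Lambda>) = enn2real (T 1 x) - enn2real (T (- 1) x)" if x: "x \<in> space P" for x
  proof -
    have x': "x \<in> space configs" using x by (simp add: space_P)
    have "integrable \<Lambda> (\<lambda>K. H K x * c K x)"
      using le[OF _ x'] by (intro integrable_c[OF Hx[OF x'] _ int1 x']) auto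
    then have "(\<integral>K. H K x * c K x \<partial>\<Lambda>) = enn2real (\<integral>\<^sup>+K. ennreal (H K x * c K x) \<partial>\<Lambda>) - enn2real (\<integral>\<^sup>+K. ennreal (- (H K x * c K x)) \<partial>\<Lambda>)"
      by (rule real_lebesgue_integral_def)
    also have "(\<integral>\<^sup>+K. ennreal (H K x * c K x) \<partial>\<Lambda>) = T 1 x"
      unfolding T_def by (intro nn_integral_cong) (auto simp: space_\<Lambda> ennreal_mult''[symmetric] less_imp_le[OF c_pos] x' mult.commute)
    also have "(\<integral>\<^sup>+K. ennreal (- (H K x * c K x)) \<partial>\<Lambda>) = T (- 1) x"
      unfolding T_def by (intro nn_integral_cong) (simp add: space_\<Lambda> ennreal_minus_neg_mult less_imp_le[OF c_pos] x')
    finally show ?thesis .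
  qed
  have iS: "integrable P (\<lambda>x. enn2real (S 1 x) - enn2real (S (- 1) x))"
    using S_fin[of 1] S_fin[of "- 1"] by (intro Bochner_Integration.integrable_diff integral_enn2real) auto
  have iT: "integrable P (\<lambda>x. enn2real (T 1 x) - enn2real (T (- 1) x))"
    using T_fin[of 1] T_fin[of "- 1"] by (intro Bochner_Integration.integrable_diff integral_enn2real) auto
  have mH: "(\<lambda>x. \<Sum>\<^sub>\<infinity>K\<in>x. H K (x - {K})) \<in> borel_measurable P"
  proof -
    have "(\<lambda>p. (snd p, fst p - {snd p})) \<in> measurable (configs \<Otimes>\<^sub>M particles) (particles \<Otimes>\<^sub>M (configs :: 'a set set measure))"
      by (intro measurable_Pair measurable_delete_config) measurable
    from measurable_compose[OF this H]
    have "(\<lambda>(x, K). H K (x - {K})) \<in> borel_measurable (configs \<Otimes>\<^sub>M particles)" by (simp add: split_beta')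
    from measurable_config_infsum[OF this, of "\<lambda>x. x"] show ?thesis by simp
  qed
  show "integrable P (\<lambda>x. \<Sum>\<^sub>\<infinity>K\<in>x. H K (x - {K}))"
    by (rule integrable_cong_AE_imp[OF iS mH]) (use A in \<open>eventually_elim, simp\<close>)
  show "integrable P (\<lambda>x. \<integral>K. H K x * c K x \<partial>\<Lambda>)"
    using iT B by (simp cong: Bochner_Integration.integrable_cong)
  have "(\<integral>x. (\<Sum>\<^sub>\<infinity>K\<in>x. H K (x - {K})) \<partial>P) = (\<integral>x. enn2real (S 1 x) - enn2real (S (- 1) x) \<partial>P)"
    by (rule integral_cong_AE[OF mH]) (measurable, use A in \<open>eventually_elim, simp\<close>)
  also have "\<dots> = (\<integral>x. enn2real (T 1 x) - enn2real (T (- 1) x) \<partial>P)"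
    using S_fin[of 1] S_fin[of "- 1"] T_fin[of 1] T_fin[of "- 1"] ST
    by (simp add: Bochner_Integration.integral_diff integral_enn2real)
  also have "\<dots> = (\<integral>x. (\<integral>K. H K x * c K x \<partial>\<Lambda>) \<partial>P)"
    by (rule Bochner_Integration.integral_cong) (simp_all add: B)
  finally show "(\<integral>x. (\<Sum>\<^sub>\<infinity>K\<in>x. H K (x - {K})) \<partial>P) = (\<integral>x. (\<integral>K. H K x * c K x \<partial>\<Lambda>) \<partial>P)" .
qed

text \<open>In the GNZ equation for the indicator of K \<in> x the left side vanishes, as K is
  removed first; on the right, positivity of c allows the factor to be dropped.\<close>

lemma AE_AE_not_mem: "AE x in P. AE K in \<Lambda>. K \<notin> x"
proof -
  have [measurable]: "Measurable.pred (particles \<Otimes>\<^sub>M configs) (\<lambda>p :: 'a set \<times> 'a set set. fst p \<in> snd p)"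
    "Measurable.pred (configs \<Otimes>\<^sub>M particles) (\<lambda>p :: 'a set set \<times> 'a set. snd p \<in> fst p)"
    by (rule pred_mem_config[of fst _ snd], measurable, rule pred_mem_config[of snd _ fst], measurable)
  have "(\<lambda>p :: 'a set \<times> 'a set set. if fst p \<in> snd p then 1 else 0 :: ennreal) \<in> borel_measurable (particles \<Otimes>\<^sub>M configs)"
    by measurable
  from gnz[OF this] have "(\<integral>\<^sup>+x. (\<integral>\<^sup>+K. ennreal (c K x) * (if K \<in> x then 1 else 0) \<partial>\<Lambda>) \<partial>P) = 0" by simp
  moreover have "(\<lambda>x. \<integral>\<^sup>+K. ennreal (c K x) * (if K \<in> x then 1 else 0) \<partial>\<Lambda>) \<in> borel_measurable P"
    by (rule \<Lambda>.borel_measurable_nn_integral) (unfold split_beta', measurable)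
  ultimately have "AE x in P. (\<integral>\<^sup>+K. ennreal (c K x) * (if K \<in> x then 1 else 0) \<partial>\<Lambda>) = 0"
    by (simp add: nn_integral_0_iff_AE)
  then show ?thesis
    using AE_space
  proof eventually_elim
    case (elim x)
    then have x [simp]: "x \<in> space configs" by (simp add: space_P)
    have [measurable]: "Measurable.pred particles (\<lambda>K. K \<in> x)"
      by (rule pred_mem_config[of "\<lambda>K. K" _ "\<lambda>_. x"]) measurable
    have "(\<lambda>K. ennreal (c K x) * (if K \<in> x then 1 else 0)) \<in> borel_measurable \<Lambda>" by measurable
    then have "AE K in \<Lambda>. ennreal (c K x) * (if K \<in> x then 1 else 0) = 0"
      using elim(1) by (simp add: nn_integral_0_iff_AE)
    then show ?case
      using AE_space
    proof eventually_elim
      case (elim K)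
      then show ?case using c_pos[of K x] by (auto simp: space_\<Lambda> split: if_splits)
    qed
  qed
qed

section \<open>The innovation and the cost of adding one particle\<close>

definition "F = innovation \<Lambda> c \<phi>"

lemma F_eq: "F x = (\<Sum>\<^sub>\<infinity>K\<in>x. \<phi> K) - (\<integral>K. \<phi> K * c K x \<partial>\<Lambda>)"
  by (simp add: F_def innovation_def)

lemma measurable_compensator: "(\<lambda>x. \<integral>K. \<phi> K * c K x \<partial>\<Lambda>) \<in> borel_measurable configs"
  by (rule \<Lambda>.borel_measurable_lebesgue_integral) (unfold split_beta', measurable)

lemma measurable_F [measurable]: "F \<in> borel_measurable configs"
proof -
  have "(\<lambda>x. \<Sum>\<^sub>\<infinity>K\<in>x. \<phi> K) \<in> borel_measurable configs"
    by (rule measurable_config_infsum) (simp_all add: split_beta', measurable)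
  then show ?thesis unfolding F_eq[abs_def] using measurable_compensator by (rule borel_measurable_diff)
qed

lemma integrable_F: "integrable P F"
proof -
  have "(\<lambda>p. \<phi> (fst p)) \<in> borel_measurable (particles \<Otimes>\<^sub>M (configs :: 'a set set measure))" by measurable
  note g = gnz_real(1,2)[of "\<lambda>K x. \<phi> K", OF this order_refl]
  show ?thesis unfolding F_eq[abs_def] using g by (rule Bochner_Integration.integrable_diff)
qed

lemma AE_summable: "AE x in P. \<phi> summable_on x"
proof -
  have "(\<lambda>p. \<phi> (fst p)) \<in> borel_measurable (particles \<Otimes>\<^sub>M (configs :: 'a set set measure))" by measurable
  from gnz_real(4)[of "\<lambda>K x. \<phi> K", OF this order_refl] show ?thesis .
qed

text \<open>One more particle changes c by at most \<tau> q, hence the integral that is subtracted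
  in the innovation by at most this amount.\<close>

definition "d = \<tau> * n1 * q"

lemma add_one_cost:
  assumes x: "x \<in> space configs" "\<phi> summable_on x" and K: "K \<in> space particles" "K \<notin> x"
  shows "\<bar>F (insert K x) - F x - \<phi> K\<bar> \<le> d"
proof -
  have x': "insert K x \<in> space configs" by (rule config_insert[OF x(1) K(1)])
  have i: "integrable \<Lambda> (\<lambda>L. \<phi> L * c L y)" if "y \<in> space configs" for y
    by (rule integrable_c[OF \<phi> _ int1 that]) simp
  \<comment> \<open>\<open>infsum\<close> would be 0 by default on a configuration where \<phi> is
    not summable, and this identity could fail; by \<open>AE_summable\<close> such configurations
    form a null set.\<close>
  have "(\<Sum>\<^sub>\<infinity>L\<in>insert K x. \<phi> L) = \<phi> K + (\<Sum>\<^sub>\<infinity>L\<in>x. \<phi> L)" using x(2) K(2) by (rule infsum_insert)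
  then have "F (insert K x) - F x - \<phi> K = (\<integral>L. \<phi> L * c L x \<partial>\<Lambda>) - (\<integral>L. \<phi> L * c L (insert K x) \<partial>\<Lambda>)"
    by (simp add: F_eq)
  also have "\<dots> = (\<integral>L. \<phi> L * c L x - \<phi> L * c L (insert K x) \<partial>\<Lambda>)"
    using i x(1) x' by (simp add: Bochner_Integration.integral_diff)
  finally have "\<bar>F (insert K x) - F x - \<phi> K\<bar> = \<bar>\<integral>L. \<phi> L * c L x - \<phi> L * c L (insert K x) \<partial>\<Lambda>\<bar>" by simp
  also have "\<dots> \<le> (\<integral>L. \<bar>\<phi> L\<bar> * (\<tau> * q) \<partial>\<Lambda>)"
  proof (rule abs_integral_le, goal_cases)
    case 3
    show ?case
    proof (rule AE_I2)
    fix L assume "L \<in> space \<Lambda>"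
    then have "\<bar>c L (insert K x) - c L x\<bar> \<le> \<tau> * q" using c_insert[OF K(1) _ x(1) K(2)] by (simp add: space_\<Lambda>)
    then have "\<bar>\<phi> L\<bar> * \<bar>c L x - c L (insert K x)\<bar> \<le> \<bar>\<phi> L\<bar> * (\<tau> * q)" by (intro mult_left_mono) (auto simp: abs_minus_commute)
    then show "\<bar>\<phi> L * c L x - \<phi> L * c L (insert K x)\<bar> \<le> \<bar>\<phi> L\<bar> * (\<tau> * q)"
      by (simp add: right_diff_distrib[symmetric] abs_mult)
    qed
  qed (use i x(1) x' integrable_abs in auto)
  also have "\<dots> = d" by (simp add: n1_def d_def mult_ac)
  finally show ?thesis .
qed

text \<open>Stein's expansion produces f'(F) V where the equation has f'(F), so the distance of V
  from 1 enters the bound.\<close>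

definition "V x = (\<integral>K. (\<phi> K)\<^sup>2 * c K x \<partial>\<Lambda>)"

lemma integrable_V_inner: "x \<in> space configs \<Longrightarrow> integrable \<Lambda> (\<lambda>K. (\<phi> K)\<^sup>2 * c K x)"
  by (rule integrable_c[OF _ _ int2]) auto

lemma measurable_V [measurable]: "V \<in> borel_measurable configs"
  unfolding V_def[abs_def] by (rule \<Lambda>.borel_measurable_lebesgue_integral) (unfold split_beta', measurable)

lemma V_bounds: assumes x: "x \<in> space configs" shows "0 \<le> V x" "V x \<le> \<tau> * s"
proof -
  show "0 \<le> V x" unfolding V_def using c_pos[OF _ x] by (intro Bochner_Integration.integral_nonneg_AE AE_I2) (auto simp: space_\<Lambda> less_imp_le)
  have "V x \<le> (\<integral>K. (\<phi> K)\<^sup>2 * \<tau> \<partial>\<Lambda>)" unfolding V_def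
    using c_le[OF _ x] by (intro integral_mono integrable_V_inner x) (auto simp: space_\<Lambda> int2 intro!: mult_left_mono)
  then show "V x \<le> \<tau> * s" by (simp add: s_def mult.commute)
qed

lemma integrable_V: "integrable P V"
  using V_bounds by (intro P.integrable_const_bound[of _ "\<tau> * s"] AE_I2) (auto simp: space_P)

lemma integrable_V2: "integrable P (\<lambda>x. (1 - V x)\<^sup>2)"
proof (rule P.integrable_const_bound[of _ "(1 + \<tau> * s)\<^sup>2"], rule AE_I2)
  fix x assume "x \<in> space P"
  then have "\<bar>1 - V x\<bar> \<le> 1 + \<tau> * s" using V_bounds[of x] by (auto simp: space_P)
  from power_mono[OF this, of 2] show "norm ((1 - V x)\<^sup>2) \<le> (1 + \<tau> * s)\<^sup>2" by simp
qed measurable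

text \<open>GNZ turns E F f(F) into an integral of differences of f, with first-order part f'(F) V.
  Besides B E |1 - V| there remain two errors: B d n1 from replacing the increment of F by \<phi> K,
  and the expanded square (|\<phi> K| + d)^2 from the Taylor remainder.\<close>

lemma stein_bound:
  fixes f f' :: "real \<Rightarrow> real"
  assumes f: "\<And>x. (f has_real_derivative f' x) (at x)" and f_le: "\<And>x. \<bar>f x\<bar> \<le> 1"
    and f'_le: "\<And>x. \<bar>f' x\<bar> \<le> B" and lip: "\<And>x y. \<bar>f' x - f' y\<bar> \<le> 2 * \<bar>x - y\<bar>"
    and int3: "integrable \<Lambda> (\<lambda>K. \<bar>\<phi> K\<bar> ^ 3)"
  shows "\<bar>\<integral>x. f' (F x) - F x * f (F x) \<partial>P\<bar>
    \<le> B * (\<integral>x. \<bar>1 - V x\<bar> \<partial>P) + \<tau> * (B * d * n1 + (\<integral>K. \<bar>\<phi> K\<bar> ^ 3 \<partial>\<Lambda>) + 2 * d * s + d\<^sup>2 * n1)"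
proof -
  have mf [measurable]: "f \<in> borel_measurable borel"
    using DERIV_isCont[OF f] by (intro borel_measurable_continuous_onI continuous_at_imp_continuous_on) auto
  have "continuous_on UNIV f'"
  proof (rule lipschitz_on_continuous_on)
    show "2-lipschitz_on UNIV f'" using lip by (intro lipschitz_onI) (auto simp: dist_real_def)
  qed
  then have mf' [measurable]: "f' \<in> borel_measurable borel" by (rule borel_measurable_continuous_onI)
  have B: "0 \<le> B" using f'_le[of 0] by linarith
  have [measurable]: "(\<lambda>p. insert (fst p) (snd p)) \<in> measurable (particles \<Otimes>\<^sub>M configs) (configs :: 'a set set measure)"
    by (rule measurable_insert_config) measurable
  have H: "(\<lambda>p. \<phi> (fst p) * f (F (insert (fst p) (snd p)))) \<in> borel_measurable (particles \<Otimes>\<^sub>M configs)"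
    by measurable
  have H_le: "\<bar>\<phi> K * f (F y)\<bar> \<le> \<bar>\<phi> K\<bar>" for K y
    using mult_left_mono[OF f_le[of "F y"], of "\<bar>\<phi> K\<bar>"] by (simp add: abs_mult)
  \<comment> \<open>For K in x, inserting K into x - {K} gives x back, so f is evaluated at F x and
    can be taken out of the sum.\<close>
  note g = gnz_real[of "\<lambda>K x. \<phi> K * f (F (insert K x))", OF H H_le]
  have sum_eq: "(\<Sum>\<^sub>\<infinity>K\<in>x. \<phi> K * f (F (insert K (x - {K})))) = (\<Sum>\<^sub>\<infinity>K\<in>x. \<phi> K) * f (F x)" for x
  proof -
    have "(\<Sum>\<^sub>\<infinity>K\<in>x. \<phi> K * f (F (insert K (x - {K})))) = (\<Sum>\<^sub>\<infinity>K\<in>x. \<phi> K * f (F x))"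
      by (rule infsum_cong) (simp add: insert_absorb)
    then show ?thesis by (simp add: infsum_cmult_left')
  qed
  define A where "A x = (\<integral>K. \<phi> K * f (F (insert K x)) * c K x \<partial>\<Lambda>) - (\<integral>K. \<phi> K * c K x \<partial>\<Lambda>) * f (F x)" for x
  have ic: "integrable P (\<lambda>x. (\<integral>K. \<phi> K * c K x \<partial>\<Lambda>) * f (F x))"
  proof (rule P.integrable_const_bound[of _ "\<tau> * n1"], rule AE_I2)
    fix x assume "x \<in> space P"
    then have x: "x \<in> space configs" by (simp add: space_P)
    have "\<bar>\<integral>K. \<phi> K * c K x \<partial>\<Lambda>\<bar> \<le> (\<integral>K. \<bar>\<phi> K\<bar> * \<tau> \<partial>\<Lambda>)"
    proof (rule abs_integral_le)
      show "integrable \<Lambda> (\<lambda>K. \<phi> K * c K x)" by (rule integrable_c[OF \<phi> _ int1 x]) simp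
      show "AE K in \<Lambda>. \<bar>\<phi> K * c K x\<bar> \<le> \<bar>\<phi> K\<bar> * \<tau>"
        using c_abs[OF _ x] by (intro AE_I2) (simp add: abs_mult space_\<Lambda> mult_left_mono)
    qed (use integrable_abs in simp)
    also have "\<dots> = \<tau> * n1" by (simp add: n1_def)
    finally have "\<bar>\<integral>K. \<phi> K * c K x \<partial>\<Lambda>\<bar> \<le> \<tau> * n1" by simp
    then have "\<bar>\<integral>K. \<phi> K * c K x \<partial>\<Lambda>\<bar> * \<bar>f (F x)\<bar> \<le> \<tau> * n1 * 1"
      using f_le[of "F x"] \<tau> n1_nonneg by (intro mult_mono) auto
    then show "norm ((\<integral>K. \<phi> K * c K x \<partial>\<Lambda>) * f (F x)) \<le> \<tau> * n1" by (simp add: abs_mult)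
  next
    have [measurable]: "(\<lambda>x. \<integral>K. \<phi> K * c K x \<partial>\<Lambda>) \<in> borel_measurable configs" by (rule measurable_compensator)
    show "(\<lambda>x. (\<integral>K. \<phi> K * c K x \<partial>\<Lambda>) * f (F x)) \<in> borel_measurable P" by measurable
  qed
  have iA: "integrable P A" unfolding A_def[abs_def] by (rule Bochner_Integration.integrable_diff[OF g(2) ic])
  have Ff: "F x * f (F x) = (\<Sum>\<^sub>\<infinity>K\<in>x. \<phi> K * f (F (insert K (x - {K})))) - (\<integral>K. \<phi> K * c K x \<partial>\<Lambda>) * f (F x)" for x
    unfolding sum_eq by (simp add: F_eq left_diff_distrib)
  have iFf: "integrable P (\<lambda>x. F x * f (F x))" unfolding Ff by (rule Bochner_Integration.integrable_diff[OF g(1) ic])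
  have EF: "(\<integral>x. F x * f (F x) \<partial>P) = (\<integral>x. A x \<partial>P)"
    unfolding Ff A_def by (simp only: Bochner_Integration.integral_diff[OF g(1) ic] Bochner_Integration.integral_diff[OF g(2) ic] g(3))
  have if': "integrable P (\<lambda>x. f' (F x))"
    using f'_le by (intro P.integrable_const_bound[of _ B] AE_I2) auto
  define C where "C = \<tau> * (B * d * n1 + (\<integral>K. \<bar>\<phi> K\<bar> ^ 3 \<partial>\<Lambda>) + 2 * d * s + d\<^sup>2 * n1)"
  have "AE x in P. \<bar>f' (F x) - A x\<bar> \<le> B * \<bar>1 - V x\<bar> + C"
    using AE_AE_not_mem AE_summable AE_space
  proof eventually_elim
    case (elim x)
    then have x: "x \<in> space configs" by (simp add: space_P)
    have [measurable]: "(\<lambda>K. insert K x) \<in> measurable particles configs"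
      by (rule measurable_insert_config) (use x in simp_all)
    have mc [measurable]: "(\<lambda>K. c K x) \<in> borel_measurable particles"
      using x by measurable
    \<comment> \<open>The error of replacing \<phi> K (f (F (insert K x)) - f (F x)) by f' (F x)
      (\<phi> K)^2, weighted with c.\<close>
    define e where "e K = f' (F x) * ((\<phi> K)\<^sup>2 * c K x) - (\<phi> K * f (F (insert K x)) * c K x - \<phi> K * c K x * f (F x))" for K
    have i1: "integrable \<Lambda> (\<lambda>K. \<phi> K * f (F (insert K x)) * c K x)"
      by (rule integrable_c[OF _ H_le int1 x]) measurable
    have i2: "integrable \<Lambda> (\<lambda>K. \<phi> K * c K x)" by (rule integrable_c[OF \<phi> _ int1 x]) simp
    have ie: "integrable \<Lambda> e" unfolding e_def[abs_def]
      using integrable_V_inner[OF x] i1 i2 by (intro Bochner_Integration.integrable_diff integrable_mult_right integrable_mult_left)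
    have eq: "f' (F x) - A x = f' (F x) * (1 - V x) + (\<integral>K. e K \<partial>\<Lambda>)"
    proof -
      have "(\<integral>K. e K \<partial>\<Lambda>) = f' (F x) * V x - A x"
        unfolding e_def A_def V_def using integrable_V_inner[OF x] i1 i2
        by (simp add: Bochner_Integration.integral_diff)
      then show ?thesis by (simp add: right_diff_distrib)
    qed
    have "\<bar>\<integral>K. e K \<partial>\<Lambda>\<bar> \<le> (\<integral>K. \<tau> * (B * d * \<bar>\<phi> K\<bar> + \<bar>\<phi> K\<bar> ^ 3 + 2 * d * (\<phi> K)\<^sup>2 + d\<^sup>2 * \<bar>\<phi> K\<bar>) \<partial>\<Lambda>)"
    proof (rule abs_integral_le)
      show "integrable \<Lambda> (\<lambda>K. \<tau> * (B * d * \<bar>\<phi> K\<bar> + \<bar>\<phi> K\<bar> ^ 3 + 2 * d * (\<phi> K)\<^sup>2 + d\<^sup>2 * \<bar>\<phi> K\<bar>))"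
        using integrable_abs int2 int3 by (intro integrable_mult_right Bochner_Integration.integrable_add)
      show "AE K in \<Lambda>. \<bar>e K\<bar> \<le> \<tau> * (B * d * \<bar>\<phi> K\<bar> + \<bar>\<phi> K\<bar> ^ 3 + 2 * d * (\<phi> K)\<^sup>2 + d\<^sup>2 * \<bar>\<phi> K\<bar>)"
        using elim(1) AE_space
      proof eventually_elim
        case (elim K)
        then have K: "K \<in> space particles" "K \<notin> x" by (auto simp: space_\<Lambda>)
        define D where "D = F (insert K x) - F x"
        have D: "\<bar>D - \<phi> K\<bar> \<le> d"
          using add_one_cost[OF x \<open>\<phi> summable_on x\<close> K] by (simp add: D_def)
        have tay: "\<bar>f (F x + D) - f (F x) - f' (F x) * D\<bar> \<le> D\<^sup>2" by (rule taylor_lipschitz_deriv[OF f lip])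
        have FD: "F x + D = F (insert K x)" by (simp add: D_def)
        \<comment> \<open>The error splits into a linear part, where \<phi> K is compared with the
          true increment D of F, and the Taylor remainder in D.\<close>
        have "e K = \<phi> K * c K x * (f' (F x) * (\<phi> K - D) - (f (F x + D) - f (F x) - f' (F x) * D))"
          unfolding e_def FD[symmetric] by (simp add: algebra_simps power2_eq_square)
        then have "\<bar>e K\<bar> = \<bar>\<phi> K\<bar> * \<bar>c K x\<bar> * \<bar>f' (F x) * (\<phi> K - D) - (f (F x + D) - f (F x) - f' (F x) * D)\<bar>"
          by (simp add: abs_mult)
        also have "\<dots> \<le> \<bar>\<phi> K\<bar> * \<tau> * (B * d + (\<bar>\<phi> K\<bar> + d)\<^sup>2)"
        proof (intro mult_mono)
          have "\<bar>f' (F x) * (\<phi> K - D)\<bar> \<le> B * d"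
            unfolding abs_mult using f'_le[of "F x"] D B by (intro mult_mono) (auto simp: abs_minus_commute)
          moreover have "D\<^sup>2 \<le> (\<bar>\<phi> K\<bar> + d)\<^sup>2"
          proof -
            have "\<bar>D\<bar> \<le> \<bar>\<phi> K\<bar> + d" using D by linarith
            from power_mono[OF this, of 2] show ?thesis by simp
          qed
          ultimately show "\<bar>f' (F x) * (\<phi> K - D) - (f (F x + D) - f (F x) - f' (F x) * D)\<bar> \<le> B * d + (\<bar>\<phi> K\<bar> + d)\<^sup>2"
            using tay by linarith
        qed (use c_abs[OF K(1) x] \<tau> in auto)
        also have "\<dots> = \<tau> * (B * d * \<bar>\<phi> K\<bar> + \<bar>\<phi> K\<bar> ^ 3 + 2 * d * (\<phi> K)\<^sup>2 + d\<^sup>2 * \<bar>\<phi> K\<bar>)"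
        proof -
          have "(\<phi> K)\<^sup>2 = \<bar>\<phi> K\<bar>\<^sup>2" by simp
          then show ?thesis by (simp only:) (simp add: algebra_simps power2_eq_square power3_eq_cube)
        qed
        finally show ?case .
      qed
    qed (use ie in simp)
    also have "\<dots> = C"
      using integrable_abs int2 int3 by (simp add: C_def n1_def s_def Bochner_Integration.integral_add)
    finally have "\<bar>\<integral>K. e K \<partial>\<Lambda>\<bar> \<le> C" .
    moreover have "\<bar>f' (F x) * (1 - V x)\<bar> \<le> B * \<bar>1 - V x\<bar>"
      unfolding abs_mult by (intro mult_right_mono f'_le) simp
    ultimately show ?case unfolding eq by linarith
  qed
  moreover have "integrable P (\<lambda>x. B * \<bar>1 - V x\<bar> + C)"
    using integrable_V by (intro Bochner_Integration.integrable_add integrable_mult_right Bochner_Integration.integrable_abs Bochner_Integration.integrable_diff) auto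
  moreover have "integrable P (\<lambda>x. f' (F x) - A x)" using if' iA by (rule Bochner_Integration.integrable_diff)
  ultimately have "\<bar>\<integral>x. f' (F x) - A x \<partial>P\<bar> \<le> (\<integral>x. B * \<bar>1 - V x\<bar> + C \<partial>P)"
    by (intro abs_integral_le)
  also have "\<dots> = B * (\<integral>x. \<bar>1 - V x\<bar> \<partial>P) + C"
    using integrable_V by (subst Bochner_Integration.integral_add) (auto simp: P.prob_space)
  also have "(\<integral>x. f' (F x) - A x \<partial>P) = (\<integral>x. f' (F x) - F x * f (F x) \<partial>P)"
    using if' iA iFf EF by (simp add: Bochner_Integration.integral_diff)
  finally show ?thesis by (simp add: C_def)
qed

text \<open>By Cauchy-Schwarz it suffices to bound E (1 - V)^2 = 1 - 2 E V + E V^2. Fubini and the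
  lower bound on E c give E V \<ge> m s, and V \<le> \<tau> s pointwise gives E V^2 \<le> \<tau>^2
  s^2.\<close>

lemma variance_bound:
  assumes "AE K in \<Lambda>. m \<le> (\<integral>x. c K x \<partial>P)"
  shows "(\<integral>x. \<bar>1 - V x\<bar> \<partial>P) \<le> sqrt (1 - 2 * m * s + \<tau>\<^sup>2 * s\<^sup>2)"
proof -
  interpret pair_sigma_finite \<Lambda> P ..
  have "(\<lambda>p. (\<phi> (fst p))\<^sup>2 * c (fst p) (snd p)) \<in> borel_measurable (\<Lambda> \<Otimes>\<^sub>M P)" by measurable
  then have "integrable (\<Lambda> \<Otimes>\<^sub>M P) (\<lambda>p. (\<phi> (fst p))\<^sup>2 * c (fst p) (snd p))"
  proof (rule Fubini_integrable)
    have cK: "integrable P (\<lambda>x. c K x)" if "K \<in> space particles" for K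
    proof (rule P.integrable_const_bound[of _ \<tau>])
      show "AE x in P. norm (c K x) \<le> \<tau>" using c_abs[OF that] by (auto simp: space_P)
      show "(\<lambda>x. c K x) \<in> borel_measurable P" using that by measurable
    qed
    then show "AE K in \<Lambda>. integrable P (\<lambda>x. (\<phi> (fst (K, x)))\<^sup>2 * c (fst (K, x)) (snd (K, x)))"
      by (intro AE_I2) (simp add: space_\<Lambda>)
    show "integrable \<Lambda> (\<lambda>K. \<integral>x. norm ((\<phi> (fst (K, x)))\<^sup>2 * c (fst (K, x)) (snd (K, x))) \<partial>P)"
    proof (rule Bochner_Integration.integrable_bound[where f="\<lambda>K. (\<phi> K)\<^sup>2 * \<tau>"])
      show "integrable \<Lambda> (\<lambda>K. (\<phi> K)\<^sup>2 * \<tau>)" using int2 by simp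
      show "(\<lambda>K. \<integral>x. norm ((\<phi> (fst (K, x)))\<^sup>2 * c (fst (K, x)) (snd (K, x))) \<partial>P) \<in> borel_measurable \<Lambda>"
      proof -
        have "(\<lambda>K. \<integral>x. norm ((\<phi> K)\<^sup>2 * c K x) \<partial>P) \<in> borel_measurable \<Lambda>"
          by measurable
        then show ?thesis by simp
      qed
      show "AE K in \<Lambda>. norm (\<integral>x. norm ((\<phi> (fst (K, x)))\<^sup>2 * c (fst (K, x)) (snd (K, x))) \<partial>P) \<le> norm ((\<phi> K)\<^sup>2 * \<tau>)"
      proof (rule AE_I2)
        fix K assume "K \<in> space \<Lambda>"
        then have K: "K \<in> space particles" by (simp add: space_\<Lambda>)
        have "(\<integral>x. \<bar>c K x\<bar> \<partial>P) \<le> (\<integral>x. \<tau> \<partial>P)"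
          using cK[OF K] c_abs[OF K] by (intro integral_mono) (auto simp: space_P)
        then have "(\<integral>x. \<bar>c K x\<bar> \<partial>P) \<le> \<tau>" by (simp add: P.prob_space)
        then show "norm (\<integral>x. norm ((\<phi> (fst (K, x)))\<^sup>2 * c (fst (K, x)) (snd (K, x))) \<partial>P) \<le> norm ((\<phi> K)\<^sup>2 * \<tau>)"
          using \<tau> by (simp add: abs_mult mult_left_mono)
      qed
    qed
  qed
  then have int': "integrable (\<Lambda> \<Otimes>\<^sub>M P) (\<lambda>(K, x). (\<phi> K)\<^sup>2 * c K x)" by (simp add: split_beta')
  have "m * s = (\<integral>K. (\<phi> K)\<^sup>2 * m \<partial>\<Lambda>)" by (simp add: s_def)
  also have "\<dots> \<le> (\<integral>K. (\<integral>x. (\<phi> K)\<^sup>2 * c K x \<partial>P) \<partial>\<Lambda>)"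
  proof (rule integral_mono_AE)
    show "integrable \<Lambda> (\<lambda>K. \<integral>x. (\<phi> K)\<^sup>2 * c K x \<partial>P)" by (rule integrable_fst[OF int'])
    show "AE K in \<Lambda>. (\<phi> K)\<^sup>2 * m \<le> (\<integral>x. (\<phi> K)\<^sup>2 * c K x \<partial>P)"
      using assms by eventually_elim (simp add: mult_left_mono)
  qed (use int2 in simp)
  also have "\<dots> = (\<integral>x. V x \<partial>P)"
    unfolding V_def by (rule Fubini_integral[OF int', symmetric])
  finally have EV: "m * s \<le> (\<integral>x. V x \<partial>P)" .
  have "(\<integral>x. (1 - V x)\<^sup>2 \<partial>P) \<le> (\<integral>x. 1 - 2 * V x + \<tau>\<^sup>2 * s\<^sup>2 \<partial>P)"
  proof (rule integral_mono[OF integrable_V2])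
    show "integrable P (\<lambda>x. 1 - 2 * V x + \<tau>\<^sup>2 * s\<^sup>2)"
      using integrable_V by (intro Bochner_Integration.integrable_add Bochner_Integration.integrable_diff) auto
    fix x assume "x \<in> space P"
    then have "(V x)\<^sup>2 \<le> (\<tau> * s)\<^sup>2" using V_bounds[of x] by (intro power_mono) (auto simp: space_P)
    then show "(1 - V x)\<^sup>2 \<le> 1 - 2 * V x + \<tau>\<^sup>2 * s\<^sup>2" by (simp add: power2_diff power_mult_distrib)
  qed
  also have "\<dots> = 1 - 2 * (\<integral>x. V x \<partial>P) + \<tau>\<^sup>2 * s\<^sup>2"
    using integrable_V by (simp add: P.prob_space Bochner_Integration.integral_add Bochner_Integration.integral_diff)
  also have "\<dots> \<le> 1 - 2 * m * s + \<tau>\<^sup>2 * s\<^sup>2" using EV by simp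
  finally have "(\<integral>x. (1 - V x)\<^sup>2 \<partial>P) \<le> 1 - 2 * m * s + \<tau>\<^sup>2 * s\<^sup>2" .
  then show ?thesis
    using P.expectation_abs_le_sqrt[OF _ integrable_V2] by (auto intro: order_trans)
qed

end

context innovation_setting
begin

lemma integrable_lipschitz_F:
  assumes h: "\<And>x y. \<bar>h x - h y\<bar> \<le> \<bar>x - y\<bar>" and [measurable]: "h \<in> borel_measurable borel"
  shows "integrable P (\<lambda>x. h (F x) :: real)"
proof (rule Bochner_Integration.integrable_bound)
  show "integrable P (\<lambda>x. \<bar>h 0\<bar> + \<bar>F x\<bar>)" using integrable_F by simp
  show "AE x in P. norm (h (F x)) \<le> norm (\<bar>h 0\<bar> + \<bar>F x\<bar>)"
  proof (rule AE_I2)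
    fix x show "norm (h (F x)) \<le> norm (\<bar>h 0\<bar> + \<bar>F x\<bar>)" using h[of "F x" 0] by simp
  qed
qed measurable

lemma stein_lipschitz_bound:
  fixes h :: "real \<Rightarrow> real"
  assumes h: "1-lipschitz_on UNIV h"
    and N: "prob_space N" and Z: "distributed N lborel Z (\<lambda>x. ennreal (std_normal_density x))"
    and m: "AE K in \<Lambda>. m \<le> (\<integral>x. c K x \<partial>P)" and int3: "integrable \<Lambda> (\<lambda>K. \<bar>\<phi> K\<bar> ^ 3)"
  shows "\<bar>(\<integral>x. h (F x) \<partial>P) - (\<integral>\<omega>. h (Z \<omega>) \<partial>N)\<bar>
    \<le> sqrt (2 / pi) * sqrt (1 - 2 * m * s + \<tau>\<^sup>2 * s\<^sup>2)
      + \<tau> * (sqrt (2 / pi) * d * n1 + (\<integral>K. \<bar>\<phi> K\<bar> ^ 3 \<partial>\<Lambda>) + 2 * d * s + d\<^sup>2 * n1)" (is "_ \<le> ?B")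
proof (rule field_le_epsilon)
  interpret N: prob_space N by fact
  fix e :: real assume e: "0 < e"
  \<comment> \<open>Replacing h by its smooth version k costs \<epsilon> once under the law of F and
    once under that of Z.\<close>
  define \<epsilon> where "\<epsilon> = e / 2"
  have "0 < \<epsilon>" using e by (simp add: \<epsilon>_def)
  obtain k k' where k: "\<And>x. (k has_real_derivative k' x) (at x)" "\<And>x. isCont k' x" "\<And>x. \<bar>k' x\<bar> \<le> 1" "\<And>x. \<bar>k x - h x\<bar> \<le> \<epsilon>"
    using lipschitz_smoothing[OF h \<open>0 < \<epsilon>\<close>] by blast
  obtain f f' where f: "\<And>x. (f has_real_derivative f' x) (at x)" "\<And>x. \<bar>f x\<bar> \<le> 1"
    "\<And>x. \<bar>f' x\<bar> \<le> sqrt (2 / pi)" "\<And>x y. \<bar>f' x - f' y\<bar> \<le> 2 * \<bar>x - y\<bar>"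
    "\<And>x. f' x - x * f x = k x - (\<integral>y. k y * std_normal_density y \<partial>lborel)"
    using stein_equation_C1[OF k(1-3)] by blast
  have hL: "\<bar>h x - h y\<bar> \<le> \<bar>x - y\<bar>" for x y
    using lipschitz_onD[OF h, of x y] by (simp add: dist_real_def)
  have kL: "\<bar>k x - k y\<bar> \<le> \<bar>x - y\<bar>" for x y
    using field_differentiable_bound[of UNIV k k' 1 x y] k(1,3) by (auto simp: dist_norm)
  have mh: "h \<in> borel_measurable borel"
    using lipschitz_on_continuous_on[OF h] by (rule borel_measurable_continuous_onI)
  have mk: "k \<in> borel_measurable borel"
    using DERIV_isCont[OF k(1)] by (intro borel_measurable_continuous_onI continuous_at_imp_continuous_on) auto
  have Z_int: "integrable N (\<lambda>\<omega>. l (Z \<omega>))" "(\<integral>\<omega>. l (Z \<omega>) \<partial>N) = (\<integral>y. l y * std_normal_density y \<partial>lborel)"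
    if l: "\<And>x y. \<bar>l x - l y\<bar> \<le> \<bar>x - y\<bar>" "l \<in> borel_measurable borel" for l :: "real \<Rightarrow> real"
  proof -
    have "\<bar>l x\<bar> \<le> \<bar>l 0\<bar> + \<bar>x\<bar>" for x using l(1)[of x 0] by simp
    from integrable_normal_bound[OF l(2) this]
    have i: "integrable lborel (\<lambda>x. std_normal_density x * l x)" by (simp add: mult.commute)
    show "integrable N (\<lambda>\<omega>. l (Z \<omega>))"
      using distributed_integrable[OF Z, of l] l(2) i by simp
    show "(\<integral>\<omega>. l (Z \<omega>) \<partial>N) = (\<integral>y. l y * std_normal_density y \<partial>lborel)"
      using distributed_integral[OF Z, of l] l(2) by (simp add: mult.commute)
  qed
  have iF: "integrable P (\<lambda>x. k (F x))" "integrable P (\<lambda>x. h (F x))"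
    by (rule integrable_lipschitz_F[OF kL mk], rule integrable_lipschitz_F[OF hL mh])
  have "(\<integral>x. k (F x) \<partial>P) - (\<integral>\<omega>. k (Z \<omega>) \<partial>N) = (\<integral>x. f' (F x) - F x * f (F x) \<partial>P)"
    unfolding f(5) Z_int(2)[OF kL mk] using iF by (simp add: Bochner_Integration.integral_diff P.prob_space)
  also have "\<bar>\<dots>\<bar> \<le> sqrt (2 / pi) * (\<integral>x. \<bar>1 - V x\<bar> \<partial>P) + \<tau> * (sqrt (2 / pi) * d * n1 + (\<integral>K. \<bar>\<phi> K\<bar> ^ 3 \<partial>\<Lambda>) + 2 * d * s + d\<^sup>2 * n1)"
    by (rule stein_bound[OF f(1-4) int3])
  also have "\<dots> \<le> ?B"
    by (intro add_right_mono mult_left_mono variance_bound m) simp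
  finally have 1: "\<bar>(\<integral>x. k (F x) \<partial>P) - (\<integral>\<omega>. k (Z \<omega>) \<partial>N)\<bar> \<le> ?B" .
  have "\<bar>\<integral>x. k (F x) - h (F x) \<partial>P\<bar> \<le> (\<integral>x. \<epsilon> \<partial>P)"
    using iF k(4) by (intro abs_integral_le) auto
  then have 2: "\<bar>(\<integral>x. k (F x) \<partial>P) - (\<integral>x. h (F x) \<partial>P)\<bar> \<le> \<epsilon>"
    using iF by (simp add: Bochner_Integration.integral_diff P.prob_space)
  have "\<bar>\<integral>\<omega>. k (Z \<omega>) - h (Z \<omega>) \<partial>N\<bar> \<le> (\<integral>\<omega>. \<epsilon> \<partial>N)"
    using Z_int(1)[OF kL mk] Z_int(1)[OF hL mh] k(4) by (intro abs_integral_le) auto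
  then have 3: "\<bar>(\<integral>\<omega>. k (Z \<omega>) \<partial>N) - (\<integral>\<omega>. h (Z \<omega>) \<partial>N)\<bar> \<le> \<epsilon>"
    using Z_int(1)[OF kL mk] Z_int(1)[OF hL mh] by (simp add: Bochner_Integration.integral_diff N.prob_space)
  have "\<epsilon> + \<epsilon> = e" by (simp add: \<epsilon>_def)
  then show "\<bar>(\<integral>x. h (F x) \<partial>P) - (\<integral>\<omega>. h (Z \<omega>) \<partial>N)\<bar> \<le> ?B + e" using 1 2 3 by linarith
qed

end

text \<open>\<open>powr\<close> agrees with the power for a positive base, and at base 0 both are 0
  because n > 0; finiteness of the norm excludes the infinite branch of
  \<open>lp_norm\<close>.\<close>

lemma lp_norm_nat:
  assumes [measurable]: "f \<in> borel_measurable M" and n: "0 < n" and fin: "lp_norm (real n) M f < \<infinity>"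
  shows "integrable M (\<lambda>x. \<bar>f x\<bar> ^ n)" "lp_norm (real n) M f ^ n = ennreal (\<integral>x. \<bar>f x\<bar> ^ n \<partial>M)"
    "enn2real (lp_norm (real n) M f) ^ n = (\<integral>x. \<bar>f x\<bar> ^ n \<partial>M)"
proof -
  have pw: "\<bar>f x\<bar> powr real n = \<bar>f x\<bar> ^ n" for x
    using n by (cases "f x = 0") (auto simp: powr_realpow)
  have I: "(\<integral>\<^sup>+x. ennreal (\<bar>f x\<bar> ^ n) \<partial>M) < \<infinity>"
    using fin by (auto simp: lp_norm_def pw Let_def less_top split: if_splits)
  show int: "integrable M (\<lambda>x. \<bar>f x\<bar> ^ n)" using I by (intro integrableI_nonneg) auto
  have e: "(\<integral>\<^sup>+x. ennreal (\<bar>f x\<bar> ^ n) \<partial>M) = ennreal (\<integral>x. \<bar>f x\<bar> ^ n \<partial>M)"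
    using int by (intro nn_integral_eq_integral) auto
  have nn: "0 \<le> (\<integral>x. \<bar>f x\<bar> ^ n \<partial>M)" by simp
  have lp: "lp_norm (real n) M f = ennreal ((\<integral>x. \<bar>f x\<bar> ^ n \<partial>M) powr (1 / real n))"
    using nn by (simp add: lp_norm_def pw e)
  have root: "((\<integral>x. \<bar>f x\<bar> ^ n \<partial>M) powr (1 / real n)) ^ n = (\<integral>x. \<bar>f x\<bar> ^ n \<partial>M)"
  proof (cases "(\<integral>x. \<bar>f x\<bar> ^ n \<partial>M) = 0")
    case False
    then have pos: "0 < (\<integral>x. \<bar>f x\<bar> ^ n \<partial>M)" using nn by linarith
    then have "((\<integral>x. \<bar>f x\<bar> ^ n \<partial>M) powr (1 / real n)) ^ n = ((\<integral>x. \<bar>f x\<bar> ^ n \<partial>M) powr (1 / real n)) powr real n"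
      by (simp add: powr_realpow)
    also have "\<dots> = (\<integral>x. \<bar>f x\<bar> ^ n \<partial>M)" using n pos by (simp add: powr_powr)
    finally show ?thesis .
  qed (use n in simp)
  show "lp_norm (real n) M f ^ n = ennreal (\<integral>x. \<bar>f x\<bar> ^ n \<partial>M)"
    unfolding lp by (simp add: ennreal_power root)
  show "enn2real (lp_norm (real n) M f) ^ n = (\<integral>x. \<bar>f x\<bar> ^ n \<partial>M)"
    unfolding lp by (simp add: root)
qed

section \<open>Application to the Gibbs particle process\<close>

lemma cond_intensity_insert:
  fixes x :: "'a::euclidean_space set set"
  assumes g: "pair_potential g" and L: "compact L" and x: "x \<in> space configs" and K: "K \<notin> x"
  shows "cond_intensity \<tau> \<beta> g L (insert K x) = cond_intensity \<tau> \<beta> g L x * exp (- \<beta> * g (L \<inter> K))"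
proof -
  have "(\<lambda>K. g (L \<inter> K)) summable_on x"
    by (rule finite_nonzero_values_imp_summable_on[OF finite_interactions[OF x g L]])
  from infsum_insert[OF this K] show ?thesis
    by (simp add: cond_intensity_def exp_add[symmetric] distrib_left)
qed

theorem theorem3p3:
  fixes Q :: "'a::euclidean_space set measure"
    and M :: "'w measure" and \<mu> :: "'w \<Rightarrow> 'a set set"
    and N :: "'z measure" and Z :: "'z \<Rightarrow> real"
    and g \<phi> :: "'a set \<Rightarrow> real"
    and R \<tau> \<beta> a b :: real
  assumes "prob_space Q" and "sets Q = sets particles"
    and "measure Q {K \<in> space Q. circumcentre K = 0} = 1"
    and "R > 0" and "measure Q {K \<in> space Q. circumball K \<subseteq> cball 0 R} = 1"
    and "\<tau> > 0" and "\<beta> \<ge> 0"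
    and "pair_potential g"
    and "a > 0" and "\<And>K. compact K \<Longrightarrow> g K \<le> a"
    and "stationary_gibbs_process M \<mu> \<tau> \<beta> g Q"
    and "b \<ge> 0"
    and "AE K in reference_measure Q. \<tau> * (1 - \<beta> * b) \<le> (\<integral>\<omega>. cond_intensity \<tau> \<beta> g K (\<mu> \<omega>) \<partial>M)
                 \<and> (\<integral>\<omega>. cond_intensity \<tau> \<beta> g K (\<mu> \<omega>) \<partial>M) \<le> \<tau>"
    and "\<phi> \<in> borel_measurable particles"
    and "lp_norm 1 (reference_measure Q) \<phi> < \<infinity>" and "lp_norm 2 (reference_measure Q) \<phi> < \<infinity>"
    and "prob_space N" and "distributed N lborel Z (\<lambda>x. ennreal (std_normal_density x))"
  shows "let \<Lambda> = reference_measure Q;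
             n1 = enn2real (lp_norm 1 \<Lambda> \<phi>);
             n2 = enn2real (lp_norm 2 \<Lambda> \<phi>)
         in wasserstein_dist M (\<lambda>\<omega>. innovation \<Lambda> (cond_intensity \<tau> \<beta> g) \<phi> (\<mu> \<omega>)) N Z
            \<le> ennreal (sqrt (2 / pi) * sqrt (1 - 2 * \<tau> * (1 - \<beta> * b) * n2 ^ 2 + \<tau> ^ 2 * n2 ^ 4))
              + ennreal \<tau> * lp_norm 3 \<Lambda> \<phi> ^ 3
              + ennreal (sqrt (2 / pi) * \<tau> ^ 2 * n1 ^ 2 * \<bar>1 - exp (- \<beta> * a)\<bar>)
              + ennreal (2 * \<tau> ^ 2 * n2 ^ 2 * n1 * \<bar>1 - exp (- \<beta> * a)\<bar>)
              + ennreal (\<tau> ^ 3 * n1 ^ 3 * \<bar>1 - exp (- \<beta> * a)\<bar> ^ 2)"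
proof -
  define \<Lambda> where "\<Lambda> = reference_measure Q"
  define c where "c = cond_intensity \<tau> \<beta> g"
  define P where "P = distr M configs \<mu>"
  define q where "q = \<bar>1 - exp (- \<beta> * a)\<bar>"
  interpret Q: prob_space Q by fact
  have mu [measurable]: "\<mu> \<in> measurable M configs" and M: "prob_space M" and dlr: "dlr_equations Q \<tau> \<beta> g P"
    using assms(11) by (auto simp: stationary_gibbs_process_def particle_process_def P_def)
  interpret M: prob_space M by (rule M)
  have AE1: "AE K in Q. K \<in> B" if "measure Q B = 1" for B
    using that by (intro Q.AE_prob_1)
  have c0: "AE K in Q. circumcentre K = 0" using AE1[OF assms(3)] by eventually_elim simp
  have cR: "AE K in Q. circumball K \<subseteq> cball 0 R" using AE1[OF assms(5)] by eventually_elim simp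
  have P: "prob_space P" "sets P = sets configs" unfolding P_def by (rule M.prob_space_distr[OF mu]) simp
  have phi: "\<phi> \<in> borel_measurable \<Lambda>" using assms(14) by (simp add: \<Lambda>_def cong: measurable_cong_sets)
  note l1 = lp_norm_nat[OF phi, of 1, simplified, OF assms(15)[folded \<Lambda>_def, simplified]]
  note l2 = lp_norm_nat[OF phi, of 2, simplified, OF assms(16)[folded \<Lambda>_def, simplified]]
  have c_pos: "0 < c K x" for K x using assms(6) by (simp add: c_def cond_intensity_def)
  have c_le: "c K x \<le> \<tau>" if K: "K \<in> space particles" and x: "x \<in> space configs" for K x
  proof -
    have "0 \<le> (\<Sum>\<^sub>\<infinity>L\<in>x. g (K \<inter> L))"
    proof (rule infsum_nonneg)
      fix L assume "L \<in> x"
      then have "L \<in> space particles" using config_particles[OF x] by blast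
      then show "0 \<le> g (K \<inter> L)"
        using K by (intro pair_potential_nonneg[OF assms(8)] compact_Int) (auto simp: in_space_particles)
    qed
    then have "exp (- \<beta> * (\<Sum>\<^sub>\<infinity>L\<in>x. g (K \<inter> L))) \<le> 1" using assms(7) by simp
    then show ?thesis using assms(6) mult_left_mono[of _ 1 \<tau>] by (simp add: c_def cond_intensity_def)
  qed
  interpret S: innovation_setting \<Lambda> P c \<tau> q \<phi>
  proof (rule innovation_setting.intro)
    show "sets \<Lambda> = sets particles" by (simp add: \<Lambda>_def)
    show "sigma_finite_measure \<Lambda>" unfolding \<Lambda>_def by (rule sigma_finite_reference_measure[OF assms(1,2) c0 cR])
    show "prob_space P" by (rule P(1))
    show "sets P = sets configs" by (rule P(2))
    show "(\<lambda>p. c (fst p) (snd p)) \<in> borel_measurable (particles \<Otimes>\<^sub>M configs)"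
      unfolding c_def by (rule measurable_cond_intensity[OF assms(8)]) measurable
    show "0 < c K x" for K x by (rule c_pos)
    show "c K x \<le> \<tau>" if "K \<in> space particles" "x \<in> space configs" for K x by (rule c_le[OF that])
    show "\<bar>c L (insert K x) - c L x\<bar> \<le> \<tau> * q"
      if KL: "K \<in> space particles" "L \<in> space particles" "x \<in> space configs" "K \<notin> x" for K L x
    proof -
      have cpt: "compact L" "compact (L \<inter> K)" using KL by (auto simp: in_space_particles intro: compact_Int)
      \<comment> \<open>Since g takes values between 0 and a, the factor 1 - exp (- \<beta> g) lies
        between 0 and q, while c is at most \<tau>.\<close>
      have "c L (insert K x) - c L x = - (c L x * (1 - exp (- \<beta> * g (L \<inter> K))))"
        unfolding c_def cond_intensity_insert[OF assms(8) cpt(1) KL(3,4)] by (simp add: algebra_simps)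
      moreover have "0 \<le> 1 - exp (- \<beta> * g (L \<inter> K))"
        using pair_potential_nonneg[OF assms(8) cpt(2)] assms(7) by simp
      moreover have "1 - exp (- \<beta> * g (L \<inter> K)) \<le> q"
      proof -
        have "exp (- \<beta> * a) \<le> exp (- \<beta> * g (L \<inter> K))"
          using mult_left_mono[OF assms(10)[OF cpt(2)] assms(7)] by simp
        then show ?thesis unfolding q_def using abs_ge_self[of "1 - exp (- \<beta> * a)"] by linarith
      qed
      ultimately show ?thesis
        using c_le[OF KL(2,3)] c_pos[of L x] assms(6) by (simp add: abs_mult mult_mono)
    qed
    show "(\<integral>\<^sup>+x. (\<integral>\<^sup>+K. f (K, x - {K}) \<partial>count_space x) \<partial>P) = (\<integral>\<^sup>+x. (\<integral>\<^sup>+K. ennreal (c K x) * f (K, x) \<partial>\<Lambda>) \<partial>P)"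
      if "f \<in> borel_measurable (particles \<Otimes>\<^sub>M configs)" for f
      unfolding c_def \<Lambda>_def by (rule gnz[OF assms(1,2) c0 cR assms(8,6) P dlr that])
    show "0 < \<tau>" by fact
    show "0 \<le> q" by (simp add: q_def)
    show "\<phi> \<in> borel_measurable particles" by fact
    show "integrable \<Lambda> \<phi>" using integrable_norm_cancel[of \<Lambda> \<phi>] l1(1) phi unfolding real_norm_def by blast
    show "integrable \<Lambda> (\<lambda>K. (\<phi> K)\<^sup>2)" using l2(1) by simp
  qed
  have n1: "enn2real (lp_norm 1 \<Lambda> \<phi>) = S.n1" using l1(3) by (simp add: S.n1_def)
  have n2: "(enn2real (lp_norm 2 \<Lambda> \<phi>))\<^sup>2 = S.s" using l2(3) by (simp add: S.s_def)
  have n4: "enn2real (lp_norm 2 \<Lambda> \<phi>) ^ 4 = S.s\<^sup>2" unfolding n2[symmetric] by (simp add: power_mult[symmetric])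
  have m: "AE K in \<Lambda>. \<tau> * (1 - \<beta> * b) \<le> (\<integral>x. c K x \<partial>P)"
    using assms(13)[folded \<Lambda>_def] AE_space
  proof eventually_elim
    case (elim K)
    then have "K \<in> space particles" by (simp add: \<Lambda>_def)
    then have "(\<lambda>x. c K x) \<in> borel_measurable configs"
      unfolding c_def by (intro measurable_cond_intensity[OF assms(8)]) measurable
    then have "(\<integral>x. c K x \<partial>P) = (\<integral>\<omega>. c K (\<mu> \<omega>) \<partial>M)" unfolding P_def by (intro integral_distr) auto
    then show ?case using elim by (simp add: c_def)
  qed
  have "wasserstein_dist M (\<lambda>\<omega>. innovation \<Lambda> c \<phi> (\<mu> \<omega>)) N Z
        \<le> ennreal (sqrt (2 / pi) * sqrt (1 - 2 * \<tau> * (1 - \<beta> * b) * S.s + \<tau> ^ 2 * S.s\<^sup>2))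
              + ennreal \<tau> * lp_norm 3 \<Lambda> \<phi> ^ 3
              + ennreal (sqrt (2 / pi) * \<tau> ^ 2 * S.n1 ^ 2 * q)
              + ennreal (2 * \<tau> ^ 2 * S.s * S.n1 * q)
              + ennreal (\<tau> ^ 3 * S.n1 ^ 3 * q ^ 2)" (is "_ \<le> ?R")
  proof (cases "lp_norm 3 \<Lambda> \<phi> < \<infinity>")
    case False
    then have "lp_norm 3 \<Lambda> \<phi> = \<infinity>" by (simp add: less_top[symmetric])
    then have "?R = \<infinity>" using assms(6) by (simp add: ennreal_mult_top)
    then show ?thesis by simp
  next
    case True
    note l3 = lp_norm_nat[OF phi, of 3, simplified, OF True[simplified]]
    define t where "t = (\<integral>K. \<bar>\<phi> K\<bar> ^ 3 \<partial>\<Lambda>)"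
    define B where "B = sqrt (2 / pi) * sqrt (1 - 2 * (\<tau> * (1 - \<beta> * b)) * S.s + \<tau>\<^sup>2 * S.s\<^sup>2)
      + \<tau> * (sqrt (2 / pi) * S.d * S.n1 + t + 2 * S.d * S.s + S.d\<^sup>2 * S.n1)"
    have t: "0 \<le> t" by (simp add: t_def)
    \<comment> \<open>\<open>sqrt\<close> of a negative number is negative by convention, so the
      sign needed for splitting \<open>ennreal\<close> of the sum is not automatic; it holds because
      \<open>variance_bound\<close> places a nonnegative expectation below this root.\<close>
    have sq: "0 \<le> sqrt (1 - 2 * \<tau> * (1 - \<beta> * b) * S.s + \<tau>\<^sup>2 * S.s\<^sup>2)"
    proof -
      have "0 \<le> (\<integral>x. \<bar>1 - S.V x\<bar> \<partial>P)" by simp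
      from order_trans[OF this S.variance_bound[OF m]] show ?thesis by (simp only: mult.assoc)
    qed
    \<comment> \<open>Substituting d = \<tau> * n1 * q turns the three terms of B that contain d
      into the last three terms of the bound.\<close>
    have "B = sqrt (2 / pi) * sqrt (1 - 2 * \<tau> * (1 - \<beta> * b) * S.s + \<tau> ^ 2 * S.s\<^sup>2) + \<tau> * t
        + sqrt (2 / pi) * \<tau> ^ 2 * S.n1 ^ 2 * q + 2 * \<tau> ^ 2 * S.s * S.n1 * q + \<tau> ^ 3 * S.n1 ^ 3 * q ^ 2"
      by (simp add: B_def S.d_def power2_eq_square power3_eq_cube algebra_simps)
    then have R: "?R = ennreal B"
      using sq t S.n1_nonneg S.s_nonneg S.q assms(6)
      by (simp add: l3(2) t_def[symmetric] ennreal_mult'[symmetric] ennreal_plus[symmetric] del: ennreal_plus)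
    show ?thesis
      unfolding R wasserstein_dist_def
    proof (rule SUP_least, rule ennreal_leI)
      fix h :: "real \<Rightarrow> real" assume "h \<in> {h. 1-lipschitz_on UNIV h}"
      then have h: "1-lipschitz_on UNIV h" by simp
      have [measurable]: "h \<in> borel_measurable borel"
        using lipschitz_on_continuous_on[OF h] by (rule borel_measurable_continuous_onI)
      have "(\<integral>\<omega>. h (innovation \<Lambda> c \<phi> (\<mu> \<omega>)) \<partial>M) = (\<integral>x. h (S.F x) \<partial>P)"
        unfolding P_def S.F_def[symmetric] by (rule integral_distr[symmetric]) measurable
      then show "\<bar>(\<integral>\<omega>. h (innovation \<Lambda> c \<phi> (\<mu> \<omega>)) \<partial>M) - (\<integral>\<omega>. h (Z \<omega>) \<partial>N)\<bar> \<le> B"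
        using S.stein_lipschitz_bound[OF h assms(17,18) m l3(1)] by (simp add: B_def t_def)
    qed
  qed
  then show ?thesis unfolding Let_def \<Lambda>_def[symmetric] c_def[symmetric] q_def[symmetric] n1 n2 n4 .
qed

end
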